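(* Let $N>0$ be an integer. Consider the $2N$-th order $q$-difference system \[ \frac{a_i^{2N+1}\big(\overline{F}_iF_i-1\big)}{a_i^{2N+1}-c^{2(-1)^i}F_i} =\begin{cases} \dfrac{\overline{F}_{i+1}F_{i+1}-1}{1-a_{i+1}^{2N+1}c^{2(-1)^i}\overline{F}_{i+1}} & \text{if } i=1,\dots,2N-1,\\[1.2em] \dfrac{\big(\prod_{k=1}^{2N}a_k^{\,k}\big)\,b\,c}{\prod_{k=1}^N F_{2k-1}} & \text{if } i=2N, \end{cases} \] where $b\in\mathbb C$ is the independent variable, $F_i=F_i(b)\in\mathbb C$ $(i=1,\dots,2N)$ are the dependent variables, $a_1,\dots,a_{2N},c,p\in\mathbb C$ are parameters, and the overline denotes the discrete time evolution $\overline{b}=pb$, $\overline{F}_i=F_i(pb)$, $\overline{a}_j=a_j$ $(j=1,\dots,2N)$, $\overline{c}=c^{-1}$, with $p$ constant. This system has an extended affine Weyl group symmetry of $(A_{2N}\rtimes A_1)^{(1)}\times A_1^{(1)}$-type, that is, it can be derived from a birational representation of an extended affine Weyl group of $(A_{2N}\rtimes A_1)^{(1)}\times A_1^{(1)}$-type, denoted by $\widetilde{W}\big((A_{2N}\rtimes A_1)^{(1)}\times A_1^{(1)}\big)$.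
   Context: Terminology. An affine Weyl group of $(A_{2N}\rtimes A_1)^{(1)}$-type is a semidirect product of an affine Weyl group of type $A_{2N}^{(1)}$ and one of type $A_1^{(1)}$. An affine Weyl group of $(A_{2N}\rtimes A_1)^{(1)}\times A_1^{(1)}$-type is the direct product of an affine Weyl group of $(A_{2N}\rtimes A_1)^{(1)}$-type and an affine Weyl group of type $A_1^{(1)}$. The extended affine Weyl group in the claim is such a group extended by an automorphism $r$ of Dynkin diagrams: \[ \widetilde{W}\big((A_{2N}\rtimes A_1)^{(1)}\times A_1^{(1)}\big) =\Big(\big(\langle s_0,\dots,s_{2N}\rangle\rtimes\langle w_0,w_1\rangle\big)\times\langle \mu_0,\mu_1\rangle\Big)\rtimes\langle r\rangle , \] whose fundamental relations are, with $i,j\in\mathbb Z/(2N+1)\mathbb Z$ and $k,h\in\{0,1\}$, \[ s_i^2=(s_is_{i\pm1})^3=1,\quad (s_is_j)^2=1\ (j\ne i\pm1),\quad w_0^2=w_1^2=(w_0w_1)^\infty=1, \] \[ w_0s_i=s_{2N-i+3}w_0,\quad w_1s_i=s_{2N-i+1}w_1, \] \[ r^2=1,\quad rs_i=s_{2N-i+2}r,\quad rw_0=w_1r,\quad rw_1=w_0r, \] \[ \mu_k^2=(\mu_0\mu_1)^\infty=1,\quad \mu_ks_i=s_i\mu_k,\quad \mu_kw_h=w_h\mu_k,\quad r\mu_0=\mu_1r,\quad r\mu_1=\mu_0r . \] Here $s^\infty=1$ means that there is no positive integer $k$ with $s^k=1$. Here $\langle s_0,\dots,s_{2N}\rangle$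 is the affine Weyl group of type $A_{2N}^{(1)}$, and $\langle w_0,w_1\rangle$, $\langle\mu_0,\mu_1\rangle$ are those of type $A_1^{(1)}$. A difference system of Painlevé type is "derived from" a birational representation of such a group (a realization of the group by birational transformations of parameters and dependent variables) when it is obtained by regarding the birational action of an infinite-order element of the group as the time evolution; for the system in the claim this is an element $T$ acting on the parameters by $T(a_i)=a_i$ $(i=1,\dots,2N)$, $T(b)=pb$, $T(c)=c^{-1}$, $T(p)=p$. "Symmetry" here refers to this larger group, which includes the time evolution, and not solely to Bäcklund transformations of the system. *)

theory Defs
  imports
    Complex_Main
    "HOL-Computational_Algebra.Fraction_Field"
    "HOL-Library.Poly_Mapping"
    "HOL-Number_Theory.Cong"
    "HOL-Algebra.Bij"
begin

section \<open>The group \<open>W((A\<^bsub>2N\<^esub> \<rtimes> A\<^sub>1)\<^sup>(\<^sup>1\<^sup>) \<times> A\<^sub>1\<^sup>(\<^sup>1\<^sup>))\<close> extended by \<open>r\<close>\<close>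

text \<open>
  Groups given by generators and relations. All generators used below are involutions, so words
  need no formal inverses: the monoid presented by the relations is already the presented group
  (see \<open>group_presented\<close>).
\<close>

inductive word_cong :: "('g list \<Rightarrow> 'g list \<Rightarrow> bool) \<Rightarrow> 'g list \<Rightarrow> 'g list \<Rightarrow> bool"
  for Q where
  rel: "Q u v \<Longrightarrow> word_cong Q (x @ u @ y) (x @ v @ y)"
| refl: "word_cong Q u u"
| sym: "word_cong Q u v \<Longrightarrow> word_cong Q v u"
| trans: "word_cong Q u v \<Longrightarrow> word_cong Q v w \<Longrightarrow> word_cong Q u w"

definition word_rel :: "('g list \<Rightarrow> 'g list \<Rightarrow> bool) \<Rightarrow> ('g list \<times> 'g list) set" where
  "word_rel Q = {(u, v). word_cong Q u v}"

definition presented :: "('g list \<Rightarrow> 'g list \<Rightarrow> bool) \<Rightarrow> 'g list set monoid" where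
  "presented Q =
     \<lparr>carrier = UNIV // word_rel Q,
      mult = \<lambda>A B. \<Union>u\<in>A. \<Union>v\<in>B. word_rel Q `` {u @ v},
      one = word_rel Q `` {[]}\<rparr>"

text \<open>
  \<open>S i\<close> stands for \<open>s\<^sub>i\<close> with \<open>i \<in> \<int>/(2N+1)\<int>\<close>; the relation \<open>index\<close> identifies \<open>S i\<close> and \<open>S j\<close>
  when \<open>i\<close> and \<open>j\<close> are congruent modulo \<open>2N+1\<close>.
\<close>

datatype gen = S int | W0 | W1 | M0 | M1 | R

inductive fund_rel :: "nat \<Rightarrow> gen list \<Rightarrow> gen list \<Rightarrow> bool" for N :: nat where
  index: "[i = j] (mod (2 * int N + 1)) \<Longrightarrow> fund_rel N [S i] [S j]"
| s_sq: "fund_rel N [S i, S i] []"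
| s_braid_succ: "fund_rel N (concat (replicate 3 [S i, S (i + 1)])) []"
| s_braid_pred: "fund_rel N (concat (replicate 3 [S i, S (i - 1)])) []"
| s_comm: "\<not> [j = i + 1] (mod (2 * int N + 1)) \<Longrightarrow> \<not> [j = i - 1] (mod (2 * int N + 1)) \<Longrightarrow>
    fund_rel N (concat (replicate 2 [S i, S j])) []"
| w0_sq: "fund_rel N [W0, W0] []"
| w1_sq: "fund_rel N [W1, W1] []"
| w0_s: "fund_rel N [W0, S i] [S (2 * int N - i + 3), W0]"
| w1_s: "fund_rel N [W1, S i] [S (2 * int N - i + 1), W1]"
| r_sq: "fund_rel N [R, R] []"
| r_s: "fund_rel N [R, S i] [S (2 * int N - i + 2), R]"
| r_w0: "fund_rel N [R, W0] [W1, R]"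
| r_w1: "fund_rel N [R, W1] [W0, R]"
| m_sq: "\<mu> \<in> {M0, M1} \<Longrightarrow> fund_rel N [\<mu>, \<mu>] []"
| m_s: "\<mu> \<in> {M0, M1} \<Longrightarrow> fund_rel N [\<mu>, S i] [S i, \<mu>]"
| m_w: "\<mu> \<in> {M0, M1} \<Longrightarrow> w \<in> {W0, W1} \<Longrightarrow> fund_rel N [\<mu>, w] [w, \<mu>]"
| r_m0: "fund_rel N [R, M0] [M1, R]"
| r_m1: "fund_rel N [R, M1] [M0, R]"

text \<open>
  \<open>(w\<^sub>0w\<^sub>1)\<^sup>\<infinity> = 1\<close> and \<open>(\<mu>\<^sub>0\<mu>\<^sub>1)\<^sup>\<infinity> = 1\<close> say that these elements have infinite order. They impose no
  relation; that they hold in the presented group is proved below (\<open>w_infinite\<close>, \<open>m_infinite\<close>).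
\<close>

definition ext_affine_weyl :: "nat \<Rightarrow> gen list set monoid" where
  "ext_affine_weyl N = presented (fund_rel N)"

lemma equiv_word_rel: "equiv UNIV (word_rel Q)"
  unfolding word_rel_def
  by (rule equivI) (auto simp: refl_on_def sym_def trans_def intro: word_cong.intros)

lemma word_cong_app:
  assumes "word_cong Q u u'"
  shows "word_cong Q (x @ u @ y) (x @ u' @ y)"
  using assms
proof induction
  case (rel u v a b)
  show ?case using word_cong.rel[where Q = Q and x = "x @ a" and y = "b @ y", OF rel] by simp
qed (auto intro: word_cong.intros)

lemma word_cong_append:
  assumes "word_cong Q u u'" "word_cong Q v v'"
  shows "word_cong Q (u @ v) (u' @ v')"
  using word_cong_app[OF assms(1), of "[]" v] word_cong_app[OF assms(2), of u' "[]"]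
  by (auto intro: word_cong.trans)

lemma presented_mult:
  "word_rel Q `` {u} \<otimes>\<^bsub>presented Q\<^esub> word_rel Q `` {v} = word_rel Q `` {u @ v}"
proof -
  let ?A = "word_rel Q `` {u}" and ?B = "word_rel Q `` {v}" and ?C = "word_rel Q `` {u @ v}"
  have "word_rel Q `` {u' @ v'} = ?C" if "u' \<in> ?A" "v' \<in> ?B" for u' v'
  proof -
    have "word_cong Q (u @ v) (u' @ v')"
      using that by (simp add: word_rel_def word_cong_append)
    then show ?thesis
      by (intro equiv_class_eq[OF equiv_word_rel]) (simp add: word_rel_def word_cong.sym)
  qed
  then have "(\<Union>u'\<in>?A. \<Union>v'\<in>?B. word_rel Q `` {u' @ v'}) = (\<Union>u'\<in>?A. \<Union>v'\<in>?B. ?C)"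
    by (intro SUP_cong HOL.refl)
  moreover have "u \<in> ?A" "v \<in> ?B"
    by (simp_all add: word_rel_def word_cong.refl)
  then have "(\<Union>u'\<in>?A. \<Union>v'\<in>?B. ?C) = ?C"
    by blast
  ultimately show ?thesis
    by (simp add: presented_def)
qed

lemma group_presented:
  assumes inv: "\<And>g. Q [g, g] []"
  shows "group (presented Q)"
proof (rule groupI)
  fix x assume "x \<in> carrier (presented Q)"
  then obtain u where x: "x = word_rel Q `` {u}"
    by (auto simp: presented_def quotient_def)
  have "word_cong Q (rev u @ u) []"
  proof (induction u)
    case (Cons g u)
    then show ?case
      using word_cong.rel[where Q = Q and x = "rev u" and y = u, OF inv[of g]] by (auto intro: word_cong.trans)
  qed (simp add: word_cong.refl)
  then have "word_rel Q `` {rev u} \<otimes>\<^bsub>presented Q\<^esub> x = \<one>\<^bsub>presented Q\<^esub>"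
    using equiv_class_eq[OF equiv_word_rel, of "rev u @ u" "[]" Q]
    unfolding x presented_mult by (simp add: presented_def word_rel_def)
  moreover have "word_rel Q `` {rev u} \<in> carrier (presented Q)"
    by (auto simp: presented_def quotient_def)
  ultimately show "\<exists>y\<in>carrier (presented Q). y \<otimes>\<^bsub>presented Q\<^esub> x = \<one>\<^bsub>presented Q\<^esub>"
    by blast
next
  fix x assume "x \<in> carrier (presented Q)"
  then obtain u where x: "x = word_rel Q `` {u}"
    by (auto simp: presented_def quotient_def)
  have "\<one>\<^bsub>presented Q\<^esub> = word_rel Q `` {[]}" by (simp add: presented_def)
  then show "\<one>\<^bsub>presented Q\<^esub> \<otimes>\<^bsub>presented Q\<^esub> x = x"
    unfolding x by (simp add: presented_mult)
next
  fix x y assume "x \<in> carrier (presented Q)" "y \<in> carrier (presented Q)"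
  then obtain u v where "x = word_rel Q `` {u}" "y = word_rel Q `` {v}"
    by (auto simp: presented_def quotient_def)
  then have "x \<otimes>\<^bsub>presented Q\<^esub> y = word_rel Q `` {u @ v}" by (simp add: presented_mult)
  then show "x \<otimes>\<^bsub>presented Q\<^esub> y \<in> carrier (presented Q)"
    by (auto simp: presented_def quotient_def)
next
  fix x y z
  assume "x \<in> carrier (presented Q)" "y \<in> carrier (presented Q)" "z \<in> carrier (presented Q)"
  then obtain u v w
    where "x = word_rel Q `` {u}" "y = word_rel Q `` {v}" "z = word_rel Q `` {w}"
    by (auto simp: presented_def quotient_def)
  then show "x \<otimes>\<^bsub>presented Q\<^esub> y \<otimes>\<^bsub>presented Q\<^esub> z = x \<otimes>\<^bsub>presented Q\<^esub> (y \<otimes>\<^bsub>presented Q\<^esub> z)"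
    by (simp add: presented_mult)
qed (auto simp: presented_def quotient_def)

lemma fund_rel_involution: "fund_rel N [g, g] []"
  by (cases g) (auto intro: fund_rel.intros)

lemma group_ext_affine_weyl: "group (ext_affine_weyl N)"
  unfolding ext_affine_weyl_def by (intro group_presented fund_rel_involution)

primrec act_w :: "gen \<Rightarrow> int \<Rightarrow> int" where
  "act_w (S i) x = x" | "act_w W0 x = - x" | "act_w W1 x = 2 - x"
| "act_w M0 x = x" | "act_w M1 x = x" | "act_w R x = 1 - x"

primrec act_m :: "gen \<Rightarrow> int \<Rightarrow> int" where
  "act_m (S i) x = x" | "act_m W0 x = x" | "act_m W1 x = x"
| "act_m M0 x = - x" | "act_m M1 x = 2 - x" | "act_m R x = 1 - x"

lemma fold_word_cong:
  assumes "word_cong Q u v" and "\<And>u v. Q u v \<Longrightarrow> foldr f u = foldr f v"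
  shows "foldr f u = foldr f v"
  using assms(1) by induction (simp_all add: assms(2))

lemma act_w_rel: "fund_rel N u v \<Longrightarrow> foldr act_w u = foldr act_w v"
  by (induction rule: fund_rel.induct) (auto simp: fun_eq_iff numeral_eq_Suc)

lemma act_m_rel: "fund_rel N u v \<Longrightarrow> foldr act_m u = foldr act_m v"
  by (induction rule: fund_rel.induct) (auto simp: fun_eq_iff numeral_eq_Suc)

lemma w_infinite: "k > 0 \<Longrightarrow> \<not> word_cong (fund_rel N) (concat (replicate k [W0, W1])) []"
proof
  assume k: "k > 0" and "word_cong (fund_rel N) (concat (replicate k [W0, W1])) []"
  from fold_word_cong[OF this(2) act_w_rel]
  have "foldr act_w (concat (replicate k [W0, W1])) 0 = 0" by simp
  moreover have "foldr act_w (concat (replicate k [W0, W1])) 0 = - 2 * int k"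
    by (induction k) auto
  ultimately show False using k by simp
qed

lemma m_infinite: "k > 0 \<Longrightarrow> \<not> word_cong (fund_rel N) (concat (replicate k [M0, M1])) []"
proof
  assume k: "k > 0" and "word_cong (fund_rel N) (concat (replicate k [M0, M1])) []"
  from fold_word_cong[OF this(2) act_m_rel]
  have "foldr act_m (concat (replicate k [M0, M1])) 0 = 0" by simp
  moreover have "foldr act_m (concat (replicate k [M0, M1])) 0 = - 2 * int k"
    by (induction k) auto
  ultimately show False using k by simp
qed


section \<open>Birational transformations\<close>

text \<open>
  \<open>ratfun\<close> is the field of rational functions over \<open>\<complex>\<close> in the countably many indeterminates
  \<open>indet 0\<close>, \<open>indet 1\<close>, \<dots>; each rational function involves finitely many of them.
\<close>

type_synonym ratfun = "((nat \<Rightarrow>\<^sub>0 nat) \<Rightarrow>\<^sub>0 complex) fract"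

definition const :: "complex \<Rightarrow> ratfun" where
  "const z = Fract (Poly_Mapping.single 0 z) 1"

definition indet :: "nat \<Rightarrow> ratfun" where
  "indet n = Fract (Poly_Mapping.single (Poly_Mapping.single n 1) 1) 1"

inductive_set gen_field :: "ratfun set \<Rightarrow> ratfun set" for V :: "ratfun set" where
  const: "const z \<in> gen_field V"
| var: "x \<in> V \<Longrightarrow> x \<in> gen_field V"
| add: "x \<in> gen_field V \<Longrightarrow> y \<in> gen_field V \<Longrightarrow> x + y \<in> gen_field V"
| mult: "x \<in> gen_field V \<Longrightarrow> y \<in> gen_field V \<Longrightarrow> x * y \<in> gen_field V"
| inverse: "x \<in> gen_field V \<Longrightarrow> inverse x \<in> gen_field V"

text \<open>
  A birational transformation of the affine space with coordinates \<open>V\<close> is given by its action on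
  functions, a field automorphism of \<open>\<complex>(V)\<close> over \<open>\<complex>\<close>.
\<close>

definition birational :: "ratfun set \<Rightarrow> (ratfun \<Rightarrow> ratfun) set" where
  "birational V =
     {\<sigma> \<in> Bij (gen_field V).
        (\<forall>x\<in>gen_field V. \<forall>y\<in>gen_field V. \<sigma> (x + y) = \<sigma> x + \<sigma> y \<and> \<sigma> (x * y) = \<sigma> x * \<sigma> y) \<and>
        (\<forall>z. \<sigma> (const z) = const z)}"

definition birational_group :: "ratfun set \<Rightarrow> (ratfun \<Rightarrow> ratfun) monoid" where
  "birational_group V = BijGroup (gen_field V) \<lparr>carrier := birational V\<rparr>"

lemma subgroup_birational: "subgroup (birational V) (BijGroup (gen_field V))"
proof (rule subgroup.intro)
  let ?K = "gen_field V"
  show "birational V \<subseteq> carrier (BijGroup ?K)"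
    by (auto simp: birational_def BijGroup_def)
  show "\<one>\<^bsub>BijGroup ?K\<^esub> \<in> birational V"
    by (auto simp: birational_def BijGroup_def id_Bij gen_field.intros)
  fix \<sigma> assume \<sigma>: "\<sigma> \<in> birational V"
  then have B: "\<sigma> \<in> Bij ?K" by (simp add: birational_def)
  then have "inj_on \<sigma> ?K" by (simp add: Bij_def bij_betw_def)
  then have "inv_into ?K \<sigma> (const z) = const z" for z
    using inv_into_f_f[of \<sigma> ?K "const z"] \<sigma> gen_field.const[of z V]
    by (metis (mono_tags, lifting) birational_def mem_Collect_eq)
  moreover have "inv_into ?K \<sigma> (x + y) = inv_into ?K \<sigma> x + inv_into ?K \<sigma> y"
      "inv_into ?K \<sigma> (x * y) = inv_into ?K \<sigma> x * inv_into ?K \<sigma> y" if "x \<in> ?K" "y \<in> ?K" for x y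
    using \<sigma> that
    by (intro Bij_inv_into_lemma[where g = "(+)", OF _ B] Bij_inv_into_lemma[where g = "(*)", OF _ B];
        auto simp: birational_def intro: gen_field.intros)+
  ultimately show "inv\<^bsub>BijGroup ?K\<^esub> \<sigma> \<in> birational V"
    using B by (auto simp: inv_BijGroup birational_def restrict_inv_into_Bij gen_field.intros)
  fix \<tau> assume \<tau>: "\<tau> \<in> birational V"
  then have T: "\<tau> \<in> Bij ?K" by (simp add: birational_def)
  then show "\<sigma> \<otimes>\<^bsub>BijGroup ?K\<^esub> \<tau> \<in> birational V"
    using \<sigma> \<tau> B Bij_imp_funcset[OF T] compose_Bij[OF B T]
    by (auto simp: birational_def BijGroup_def compose_eq Pi_iff gen_field.intros)
qed

lemma group_birational_group: "group (birational_group V)"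
  unfolding birational_group_def
  by (rule subgroup.subgroup_is_group[OF subgroup_birational group_BijGroup])


section \<open>Parameters, dependent variables and the system\<close>

text \<open>
  The coordinates are pairwise distinct indeterminates. The parameter \<open>p\<close> is expressed through a
  root \<open>q\<close>, as \<open>p = q^m\<close>: the reflection \<open>s\<^sub>0\<close> acts on the parameters through
  \<open>a\<^sub>0\<close>, and the product \<open>a\<^sub>0a\<^sub>1\<dots>a\<^bsub>2N\<^esub>\<close> is a root of \<open>p\<close> up to inversion, so that \<open>p\<close> itself
  does not suffice as a coordinate.
\<close>

definition b_par :: ratfun where "b_par = indet 0"
definition c_par :: ratfun where "c_par = indet 1"
definition q_par :: ratfun where "q_par = indet 2"
definition a_par :: "nat \<Rightarrow> ratfun" where "a_par i = indet (2 * i + 1)"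
definition F_var :: "nat \<Rightarrow> ratfun" where "F_var i = indet (2 * i + 2)"

definition params :: "nat \<Rightarrow> ratfun set" where
  "params N = a_par ` {1..2 * N} \<union> {b_par, c_par, q_par}"

definition coords :: "nat \<Rightarrow> ratfun set" where
  "coords N = params N \<union> F_var ` {1..2 * N}"

text \<open>
  A realization of the group by birational transformations of the parameters and dependent
  variables: the homomorphism is injective, i.e. the transformations satisfy the fundamental
  relations and no further ones, and the parameters are transformed among themselves.
\<close>

definition birational_representation ::
    "nat \<Rightarrow> (gen list set \<Rightarrow> ratfun \<Rightarrow> ratfun) \<Rightarrow> bool" where
  "birational_representation N \<rho> \<longleftrightarrow>
     \<rho> \<in> hom (ext_affine_weyl N) (birational_group (coords N)) \<and>
     inj_on \<rho> (carrier (ext_affine_weyl N)) \<and>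
     (\<forall>w\<in>carrier (ext_affine_weyl N). \<rho> w ` gen_field (params N) \<subseteq> gen_field (params N))"

text \<open>\<open>F' i\<close> is the overlined \<open>F i\<close>. Division being total, the denominators are required not to vanish.\<close>

definition painleve_system ::
    "nat \<Rightarrow> (nat \<Rightarrow> 'k::field) \<Rightarrow> 'k \<Rightarrow> 'k \<Rightarrow> (nat \<Rightarrow> 'k) \<Rightarrow> (nat \<Rightarrow> 'k) \<Rightarrow> bool" where
  "painleve_system N a b c F F' \<longleftrightarrow>
     (\<forall>i\<in>{1..2 * N}. a i ^ (2 * N + 1) - c powi (2 * (-1) ^ i) * F i \<noteq> 0) \<and>
     (\<forall>i\<in>{1..2 * N - 1}. 1 - a (i + 1) ^ (2 * N + 1) * c powi (2 * (-1) ^ i) * F' (i + 1) \<noteq> 0) \<and>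
     (\<Prod>k=1..N. F (2 * k - 1)) \<noteq> 0 \<and>
     (\<forall>i\<in>{1..2 * N}.
        a i ^ (2 * N + 1) * (F' i * F i - 1) / (a i ^ (2 * N + 1) - c powi (2 * (-1) ^ i) * F i) =
        (if i < 2 * N
         then (F' (i + 1) * F (i + 1) - 1)
                / (1 - a (i + 1) ^ (2 * N + 1) * c powi (2 * (-1) ^ i) * F' (i + 1))
         else (\<Prod>k=1..2 * N. a k ^ k) * b * c / (\<Prod>k=1..N. F (2 * k - 1))))"

text \<open>
  The birational transformation \<open>\<sigma>\<close>, regarded as the time evolution, is the one of the
  \<open>q\<close>-difference system: the overline is the application of \<open>\<sigma>\<close>.
\<close>

definition time_evolution :: "nat \<Rightarrow> ratfun \<Rightarrow> (ratfun \<Rightarrow> ratfun) \<Rightarrow> bool" where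
  "time_evolution N p \<sigma> \<longleftrightarrow>
     (\<forall>i\<in>{1..2 * N}. \<sigma> (a_par i) = a_par i) \<and>
     \<sigma> b_par = p * b_par \<and> \<sigma> c_par = inverse c_par \<and> \<sigma> p = p \<and>
     painleve_system N a_par b_par c_par F_var (\<lambda>i. \<sigma> (F_var i))"

end

theory Submission
  imports Defs
begin

text \<open>
  Put \<open>M = 2N+1\<close>, \<open>f\<^sub>i = c\<^bsup>2(-1)^i\<^esup>F\<^sub>i\<close> and \<open>A\<^sub>i = a\<^sub>i\<^sup>M\<close>. The \<open>f\<^sub>i\<close> continue to an infinite sequence with
  \<open>f\<^sub>i = -A\<^sub>i(1 + Z\<^sub>i)/Z\<^bsub>i-1\<^esub>\<close>, on which \<open>\<pi> = rw\<^sub>0\<close> acts by lowering the index of \<open>f\<close>, \<open>a\<close> and \<open>Z\<close> by one.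
  The system says that both sides of the \<open>i\<close>-th equation equal \<open>1/Z\<^sub>i\<close>, and its time evolution is
  \<open>T = \<pi>\<^sup>M\<close>, which fixes the \<open>a\<^sub>i\<close> because they have period \<open>M\<close>. The remaining generators act by the
  reversal of the sequence (\<open>w\<^sub>1\<close>), by a rational exchange of \<open>a\<^sub>j\<close> with its neighbours (\<open>s\<^sub>j\<close>), and by
  \<open>\<mu>\<^sub>0\<close>: the sequence \<open>H\<close> with \<open>H\<^bsub>i+1\<^esub> - H\<^sub>i\<close> proportional to \<open>\<Prod>\<^bsub>j<i\<^esub>(-f\<^sub>j\<^bsup>\<plusminus>1\<^esup>/A\<^sub>j)\<close> which is quasi-periodic with
  multiplier \<open>\<rho>\<close> has, up to a common factor, a reciprocal of the same kind with multiplier \<open>1/\<rho>\<close>,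
  and \<open>\<mu>\<^sub>0\<close> exchanges the two.

  Injectivity can be read off the parameters. Every element is a product of a word in the \<open>s\<^sub>i\<close>, a word
  in \<open>w\<^sub>0, w\<^sub>1\<close>, a word in \<open>\<mu>\<^sub>0, \<mu>\<^sub>1\<close> and possibly \<open>r\<close>; the last three factors are detected by \<open>b\<close>, \<open>c\<close>
  and \<open>q\<close>. Writing \<open>a\<^sub>i\<close> as the ratio of consecutive members of a sequence, the \<open>s\<^sub>i\<close> act on it through the affine permutations of \<open>\<int>\<close>, and the length argument for
  Coxeter groups shows that this action is faithful.
\<close>

section \<open>Substitution in rational functions\<close>

text \<open>A rational function is not defined at every point, so a list of images does not by
  itself give a field homomorphism. Values are therefore handled by the relation
  \<open>rat_eval\<close>, and \<open>subst\<close> is used only for lists of images with a verified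
  inverse list. The same relation, at numerical points, yields the non-vanishing statements. The
  roots of p have two origins. The weights in \<open>KK\<close> make the shift multiply it by
  \<open>q_par ^ (2 * N - 1) * AA 0\<close>, and b absorbs the power of q. The multiplier is
  c^(2(2N-1)) p, and \<mu>_0 must invert it with p fixed; this sends c to the inverse of c
  p^(1/(2N-1)), so a (2N-1)-th root of p is wanted besides the (2N+1)-th root coming from a_0. The
  period is odd, so one turn changes the parity of the index, while the exponents of f in H
  alternate with the parity. Hence only pairs of consecutive increments of H are multiplied by the
  multiplier, \<mu>_0 commutes with \<pi>^2 but not with \<pi>, and its commutation with s_1 spreads
  to all s_j in steps of two, which reach every residue.\<close>

definition monom_eval :: "(nat \<Rightarrow> ratfun) \<Rightarrow> (nat \<Rightarrow>\<^sub>0 nat) \<Rightarrow> ratfun" where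
  "monom_eval v m = (\<Prod>n\<in>Poly_Mapping.keys m. v n ^ Poly_Mapping.lookup m n)"

definition poly_eval ::
    "(nat \<Rightarrow> ratfun) \<Rightarrow> ((nat \<Rightarrow>\<^sub>0 nat) \<Rightarrow>\<^sub>0 complex) \<Rightarrow> ratfun" where
  "poly_eval v P = (\<Sum>m\<in>Poly_Mapping.keys P. const (Poly_Mapping.lookup P m) * monom_eval v m)"

lemma monom_eval_superset:
  assumes "finite A" "Poly_Mapping.keys m \<subseteq> A"
  shows "monom_eval v m = (\<Prod>n\<in>A. v n ^ Poly_Mapping.lookup m n)"
  unfolding monom_eval_def using assms by (intro prod.mono_neutral_left) (auto simp: in_keys_iff)

lemma monom_eval_0 [simp]: "monom_eval v 0 = 1"
  by (simp add: monom_eval_def)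

lemma monom_eval_add: "monom_eval v (m + m') = monom_eval v m * monom_eval v m'"
proof -
  let ?A = "Poly_Mapping.keys m \<union> Poly_Mapping.keys m'"
  have "Poly_Mapping.keys (m + m') \<subseteq> ?A" by (rule Poly_Mapping.keys_add)
  then show ?thesis
    by (simp add: monom_eval_superset[of ?A] lookup_add power_add prod.distrib)
qed

lemma monom_eval_single: "monom_eval v (Poly_Mapping.single n k) = v n ^ k"
  by (cases "k = 0") (simp_all add: monom_eval_def)

lemma poly_mapping_sum_single:
  "(P :: ('a \<Rightarrow>\<^sub>0 'b::comm_monoid_add)) = (\<Sum>m\<in>Poly_Mapping.keys P. Poly_Mapping.single m (Poly_Mapping.lookup P m))"
proof (rule poly_mapping_eqI)
  fix k
  show "Poly_Mapping.lookup P k = Poly_Mapping.lookup (\<Sum>m\<in>Poly_Mapping.keys P. Poly_Mapping.single m (Poly_Mapping.lookup P m)) k"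
    by (simp add: lookup_sum lookup_single when_def sum.delta' in_keys_iff)
qed

lemma const_0 [simp]: "const 0 = 0" and const_1 [simp]: "const 1 = 1"
  by (simp_all add: const_def Zero_fract_def One_fract_def)

lemma const_add: "const (x + y) = const x + const y"
  and const_mult: "const (x * y) = const x * const y"
  by (simp_all add: const_def single_add mult_single)

lemma poly_eval_superset:
  assumes "finite A" "Poly_Mapping.keys P \<subseteq> A"
  shows "poly_eval v P = (\<Sum>m\<in>A. const (Poly_Mapping.lookup P m) * monom_eval v m)"
  unfolding poly_eval_def using assms by (intro sum.mono_neutral_left) (auto simp: in_keys_iff)

lemma poly_eval_add: "poly_eval v (P + Q) = poly_eval v P + poly_eval v Q"
proof -
  let ?A = "Poly_Mapping.keys P \<union> Poly_Mapping.keys Q"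
  have "Poly_Mapping.keys (P + Q) \<subseteq> ?A" by (rule Poly_Mapping.keys_add)
  then show ?thesis
    by (simp add: poly_eval_superset[of ?A] lookup_add const_add sum.distrib algebra_simps)
qed

lemma poly_eval_0 [simp]: "poly_eval v 0 = 0"
  by (simp add: poly_eval_def)

lemma poly_eval_sum: "poly_eval v (sum g A) = (\<Sum>i\<in>A. poly_eval v (g i))"
  by (induction A rule: infinite_finite_induct) (simp_all add: poly_eval_add)

lemma poly_eval_single: "poly_eval v (Poly_Mapping.single m z) = const z * monom_eval v m"
  by (cases "z = 0") (simp_all add: poly_eval_def)

lemma poly_eval_1 [simp]: "poly_eval v 1 = 1"
  using poly_eval_single[of v 0 1] by (simp add: const_1)

lemma poly_eval_mult: "poly_eval v (P * Q) = poly_eval v P * poly_eval v Q"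
proof -
  have "P * Q = (\<Sum>m\<in>Poly_Mapping.keys P. Poly_Mapping.single m (Poly_Mapping.lookup P m))
      * (\<Sum>m'\<in>Poly_Mapping.keys Q. Poly_Mapping.single m' (Poly_Mapping.lookup Q m'))"
    by (simp flip: poly_mapping_sum_single)
  also have "\<dots> = (\<Sum>m\<in>Poly_Mapping.keys P. \<Sum>m'\<in>Poly_Mapping.keys Q.
      Poly_Mapping.single (m + m') (Poly_Mapping.lookup P m * Poly_Mapping.lookup Q m'))"
    by (simp add: sum_product mult_single)
  finally have "poly_eval v (P * Q) = (\<Sum>m\<in>Poly_Mapping.keys P. \<Sum>m'\<in>Poly_Mapping.keys Q.
      (const (Poly_Mapping.lookup P m) * monom_eval v m) * (const (Poly_Mapping.lookup Q m') * monom_eval v m'))"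
    by (simp add: poly_eval_sum poly_eval_single monom_eval_add const_mult ac_simps)
  also have "\<dots> = poly_eval v P * poly_eval v Q"
    by (simp add: poly_eval_def sum_product)
  finally show ?thesis .
qed


text \<open>
  \<open>rat_eval v x y\<close>: the rational function \<open>x\<close> is defined at \<open>v\<close> and has the value \<open>y\<close> there.
\<close>

definition rat_eval :: "(nat \<Rightarrow> ratfun) \<Rightarrow> ratfun \<Rightarrow> ratfun \<Rightarrow> bool" where
  "rat_eval v x y \<longleftrightarrow>
     (\<exists>P Q. poly_eval v Q \<noteq> 0 \<and> x = Fract P Q \<and> y = poly_eval v P / poly_eval v Q)"

lemma rat_evalI:
  "poly_eval v Q \<noteq> 0 \<Longrightarrow> x = Fract P Q \<Longrightarrow> y = poly_eval v P / poly_eval v Q \<Longrightarrow> rat_eval v x y"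
  unfolding rat_eval_def by blast

lemma rat_eval_const: "rat_eval v (const z) (const z)"
  by (rule rat_evalI[where P = "Poly_Mapping.single 0 z" and Q = 1])
    (simp, simp add: const_def, simp add: poly_eval_single)

lemma rat_eval_0: "rat_eval v 0 0" and rat_eval_1: "rat_eval v 1 1"
  using rat_eval_const[of v 0] rat_eval_const[of v 1] by simp_all

lemma rat_eval_indet: "rat_eval v (indet n) (v n)"
  unfolding rat_eval_def indet_def
  by (rule exI[of _ "Poly_Mapping.single (Poly_Mapping.single n 1) 1"], rule exI[of _ 1])
    (simp add: poly_eval_single monom_eval_single const_1)

lemma rat_eval_add:
  assumes "rat_eval v x y" "rat_eval v x' y'"
  shows "rat_eval v (x + x') (y + y')"
proof -
  obtain P Q P' Q' where *: "poly_eval v Q \<noteq> 0" "x = Fract P Q"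
    "y = poly_eval v P / poly_eval v Q" "poly_eval v Q' \<noteq> 0" "x' = Fract P' Q'"
    "y' = poly_eval v P' / poly_eval v Q'"
    using assms unfolding rat_eval_def by blast
  moreover from * have "Q \<noteq> 0" "Q' \<noteq> 0" by auto
  ultimately show ?thesis
    by (intro rat_evalI[where P = "P * Q' + P' * Q" and Q = "Q * Q'"])
      (simp_all add: poly_eval_mult poly_eval_add add_frac_eq)
qed

lemma rat_eval_mult:
  assumes "rat_eval v x y" "rat_eval v x' y'"
  shows "rat_eval v (x * x') (y * y')"
proof -
  obtain P Q P' Q' where *: "poly_eval v Q \<noteq> 0" "x = Fract P Q"
    "y = poly_eval v P / poly_eval v Q" "poly_eval v Q' \<noteq> 0" "x' = Fract P' Q'"
    "y' = poly_eval v P' / poly_eval v Q'"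
    using assms unfolding rat_eval_def by blast
  then show ?thesis
    by (intro rat_evalI[where P = "P * P'" and Q = "Q * Q'"]) (simp_all add: poly_eval_mult)
qed

lemma rat_eval_inverse:
  assumes "rat_eval v x y" "y \<noteq> 0"
  shows "rat_eval v (inverse x) (inverse y)"
proof -
  obtain P Q where "poly_eval v Q \<noteq> 0" "x = Fract P Q"
    "y = poly_eval v P / poly_eval v Q"
    using assms unfolding rat_eval_def by blast
  with assms(2) show ?thesis
    by (intro rat_evalI[where P = Q and Q = P]) auto
qed

lemma rat_eval_uminus: "rat_eval v x y \<Longrightarrow> rat_eval v (- x) (- y)"
proof -
  have "const (- 1) + 1 = 0"
    using const_add[of "- 1" 1] by (simp add:)
  then have "const (- 1) = - 1"
    by (simp add: eq_neg_iff_add_eq_0)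
  moreover have "const (- 1) = - 1"
    by (simp add: const_def One_fract_def single_uminus)
  ultimately have "rat_eval v (- 1) (- 1)"
    using rat_eval_const[of v "- 1"] by simp
  then show "rat_eval v x y \<Longrightarrow> rat_eval v (- x) (- y)"
    using rat_eval_mult[of v "- 1" "- 1" x y] by simp
qed

lemma rat_eval_diff:
  "rat_eval v x y \<Longrightarrow> rat_eval v x' y' \<Longrightarrow> rat_eval v (x - x') (y - y')"
  using rat_eval_add[of v x y "- x'" "- y'"] by (simp add: rat_eval_uminus)

lemma rat_eval_divide:
  "rat_eval v x y \<Longrightarrow> rat_eval v x' y' \<Longrightarrow> y' \<noteq> 0 \<Longrightarrow> rat_eval v (x / x') (y / y')"
  unfolding divide_inverse by (intro rat_eval_mult rat_eval_inverse)

lemma rat_eval_power: "rat_eval v x y \<Longrightarrow> rat_eval v (x ^ k) (y ^ k)"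
  by (induction k) (simp_all add: rat_eval_1 rat_eval_mult)

lemma rat_eval_prod:
  "(\<And>i. i \<in> A \<Longrightarrow> rat_eval v (g i) (h i)) \<Longrightarrow> rat_eval v (prod g A) (prod h A)"
  by (induction A rule: infinite_finite_induct) (simp_all add: rat_eval_1 rat_eval_mult)

lemma rat_eval_sum:
  "(\<And>i. i \<in> A \<Longrightarrow> rat_eval v (g i) (h i)) \<Longrightarrow> rat_eval v (sum g A) (sum h A)"
  by (induction A rule: infinite_finite_induct) (simp_all add: rat_eval_0 rat_eval_add)

lemma rat_eval_0_unique:
  assumes "rat_eval v 0 y" shows "y = 0"
proof -
  obtain P Q where *: "poly_eval v Q \<noteq> 0" "0 = Fract P Q" "y = poly_eval v P / poly_eval v Q"
    using assms unfolding rat_eval_def by blast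
  then have "Fract 0 1 = Fract P Q" "Q \<noteq> 0" by (auto simp: Zero_fract_def)
  then have "P = 0" by (simp add: eq_fract)
  with * show ?thesis by simp
qed

text \<open>Values do not depend on the chosen fraction: the difference of two values of
  \<open>x\<close> is a value of \<open>x - x = 0\<close>, and 0 has only the value 0.\<close>

lemma rat_eval_unique:
  assumes "rat_eval v x y" "rat_eval v x y'" shows "y = y'"
  using rat_eval_0_unique[of v "y - y'"] rat_eval_diff[OF assms] by simp

lemma rat_eval_nonzero: "rat_eval v x y \<Longrightarrow> y \<noteq> 0 \<Longrightarrow> x \<noteq> 0"
  using rat_eval_0_unique by blast

definition field_hom :: "(ratfun \<Rightarrow> ratfun) \<Rightarrow> bool" where
  "field_hom \<phi> \<longleftrightarrow> (\<forall>x y. \<phi> (x + y) = \<phi> x + \<phi> y) \<and> (\<forall>x y. \<phi> (x * y) = \<phi> x * \<phi> y) \<and>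
     (\<forall>z. \<phi> (const z) = const z)"

lemma field_hom_id: "field_hom (\<lambda>x. x)"
  by (simp add: field_hom_def)

lemma field_hom_comp: "field_hom \<phi> \<Longrightarrow> field_hom \<psi> \<Longrightarrow> field_hom (\<lambda>x. \<phi> (\<psi> x))"
  by (simp add: field_hom_def)

context
  fixes \<phi> assumes \<phi>: "field_hom \<phi>"
begin

lemma hom_add: "\<phi> (x + y) = \<phi> x + \<phi> y" and hom_mult: "\<phi> (x * y) = \<phi> x * \<phi> y"
  and hom_const: "\<phi> (const z) = const z"
  using \<phi> by (simp_all add: field_hom_def)

lemma hom_0: "\<phi> 0 = 0" and hom_1: "\<phi> 1 = 1"
  using hom_const[of 0] hom_const[of 1] by simp_all

lemma hom_uminus: "\<phi> (- x) = - \<phi> x"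
proof -
  have "\<phi> x + \<phi> (- x) = 0" using hom_add[of x "- x"] unfolding right_minus hom_0 by (rule HOL.sym)
  then show ?thesis by (rule minus_unique[symmetric])
qed

lemma hom_diff: "\<phi> (x - y) = \<phi> x - \<phi> y"
  using hom_add[of x "- y"] by (simp add: hom_uminus)

lemma hom_nonzero: "x \<noteq> 0 \<Longrightarrow> \<phi> x \<noteq> 0"
  using hom_mult[of x "inverse x"] by (auto simp: hom_1)

lemma hom_inverse: "\<phi> (inverse x) = inverse (\<phi> x)"
proof (cases "x = 0")
  case False
  then have "\<phi> x * \<phi> (inverse x) = 1"
    using hom_mult[of x "inverse x"] by (simp add: hom_1)
  then show ?thesis by (simp add: inverse_unique)
qed (simp add: hom_0)

lemma hom_divide: "\<phi> (x / y) = \<phi> x / \<phi> y"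
  by (simp add: divide_inverse hom_mult hom_inverse)

lemma hom_power: "\<phi> (x ^ n) = \<phi> x ^ n"
  by (induction n) (simp_all add: hom_1 hom_mult)

lemma hom_prod: "\<phi> (prod g A) = (\<Prod>i\<in>A. \<phi> (g i))"
  by (induction A rule: infinite_finite_induct) (simp_all add: hom_1 hom_mult)

lemma hom_sum: "\<phi> (sum g A) = (\<Sum>i\<in>A. \<phi> (g i))"
  by (induction A rule: infinite_finite_induct) (simp_all add: hom_0 hom_add)

lemmas hom_simps = hom_add hom_mult hom_const hom_0 hom_1 hom_uminus hom_diff hom_inverse
  hom_divide hom_power hom_prod hom_sum

end

lemma Fract_poly_eval: "Fract P 1 = poly_eval indet P"
proof -
  have ind: "indet n ^ k = Fract (Poly_Mapping.single (Poly_Mapping.single n k) 1) 1" for n k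
    by (induction k) (simp_all add: One_fract_def indet_def mult_single flip: single_add)
  have *: "finite A \<Longrightarrow> (\<Prod>n\<in>A. indet n ^ Poly_Mapping.lookup m n) =
      Fract (Poly_Mapping.single (\<Sum>n\<in>A. Poly_Mapping.single n (Poly_Mapping.lookup m n)) 1) 1" for A m
    by (induction A rule: finite_induct) (simp_all add: ind One_fract_def mult_single)
  have mon: "monom_eval indet m = Fract (Poly_Mapping.single m 1) 1" for m
    unfolding monom_eval_def using *[of "Poly_Mapping.keys m" m] by (simp flip: poly_mapping_sum_single)
  have sm: "finite A \<Longrightarrow> (\<Sum>m\<in>A. Fract (g m) (1::(nat \<Rightarrow>\<^sub>0 nat) \<Rightarrow>\<^sub>0 complex)) = Fract (sum g A) 1"
    for A and g :: "(nat \<Rightarrow>\<^sub>0 nat) \<Rightarrow> _"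
    by (induction A rule: finite_induct) (simp_all add: Zero_fract_def)
  show ?thesis
    unfolding poly_eval_def mon
    by (simp add: const_def mult_single sm flip: poly_mapping_sum_single)
qed

lemma hom_poly_eval: "field_hom \<phi> \<Longrightarrow> \<phi> (poly_eval v P) = poly_eval (\<lambda>n. \<phi> (v n)) P"
  by (simp add: poly_eval_def monom_eval_def hom_simps)

lemma field_hom_eqI:
  assumes "field_hom \<phi>" "field_hom \<psi>" "\<And>n. \<phi> (indet n) = \<psi> (indet n)"
  shows "\<phi> x = \<psi> x"
proof (cases x)
  case (Fract P Q)
  then have "x = poly_eval indet P / poly_eval indet Q"
    by (simp flip: Fract_poly_eval)
  with assms show ?thesis by (simp add: hom_poly_eval hom_divide)
qed

lemma rat_eval_hom:
  assumes "field_hom \<phi>" "\<And>n. \<phi> (indet n) = v n" "rat_eval v x y"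
  shows "\<phi> x = y"
proof -
  obtain P Q where *: "poly_eval v Q \<noteq> 0" "x = Fract P Q"
    "y = poly_eval v P / poly_eval v Q"
    using assms(3) unfolding rat_eval_def by blast
  then have "x = poly_eval indet P / poly_eval indet Q"
    by (auto simp flip: Fract_poly_eval)
  with *(3) assms(1,2) show ?thesis by (simp add: hom_poly_eval hom_divide)
qed

text \<open>A choice that is meaningful only if some field homomorphism has these images; the lemmas
  below secure this through an inverse substitution.\<close>

definition subst :: "(nat \<Rightarrow> ratfun) \<Rightarrow> ratfun \<Rightarrow> ratfun" where
  "subst v = (SOME \<phi>. field_hom \<phi> \<and> (\<forall>n. \<phi> (indet n) = v n))"

text \<open>
  A substitution \<open>v\<close> with a left inverse \<open>u\<close> on the indeterminates is injective on polynomials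
  and therefore extends to all rational functions.
\<close>

lemma subst_exists:
  assumes inv: "\<And>n. rat_eval u (v n) (indet n)"
  shows "\<exists>\<phi>. field_hom \<phi> \<and> (\<forall>n. \<phi> (indet n) = v n)"
proof -
  let ?e = "poly_eval v"
  have "rat_eval u (?e P) (poly_eval indet P)" for P
    unfolding poly_eval_def monom_eval_def
    by (intro rat_eval_sum rat_eval_mult rat_eval_const rat_eval_prod rat_eval_power inv)
  \<comment> \<open>The inverse substitution \<open>u\<close> recovers a polynomial from its image,
    so nonzero polynomials have nonzero images and every fraction is defined at
    \<open>v\<close>.\<close>
  then have nz: "?e P \<noteq> 0" if "P \<noteq> 0" for P
    using that rat_eval_nonzero[of u "?e P" "Fract P 1"]
    by (auto simp: Fract_poly_eval[symmetric] Zero_fract_def eq_fract)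
  then have defined: "rat_eval v (Fract P Q) (?e P / ?e Q)" if "Q \<noteq> 0" for P Q
    unfolding rat_eval_def using that by blast
  then have ex: "\<exists>y. rat_eval v x y" for x
    by (cases x) blast
  define \<phi> where "\<phi> x = (THE y. rat_eval v x y)" for x
  have \<phi>: "\<phi> x = y" if "rat_eval v x y" for x y
    unfolding \<phi>_def using that rat_eval_unique by blast
  then have \<phi>': "rat_eval v x (\<phi> x)" for x
    using ex by metis
  show ?thesis
    by (rule exI[of _ \<phi>]) (auto simp: field_hom_def intro!: \<phi> rat_eval_add rat_eval_mult
        rat_eval_const rat_eval_indet \<phi>')
qed

lemma
  assumes "\<And>n. rat_eval u (v n) (indet n)"
  shows subst_hom: "field_hom (subst v)" and subst_indet: "subst v (indet n) = v n"
    and subst_eval: "rat_eval v x y \<Longrightarrow> subst v x = y"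
proof -
  have *: "field_hom (subst v) \<and> (\<forall>n. subst v (indet n) = v n)"
    unfolding subst_def
    by (rule someI_ex[of "\<lambda>\<phi>. field_hom \<phi> \<and> (\<forall>n. \<phi> (indet n) = v n)"])
      (rule subst_exists, rule assms)
  then show "field_hom (subst v)" "subst v (indet n) = v n" by blast+
  from * show "rat_eval v x y \<Longrightarrow> subst v x = y"
    by (auto intro: rat_eval_hom)
qed

lemma subst_inverse:
  assumes u: "\<And>n. rat_eval u (v n) (indet n)" and v: "\<And>n. rat_eval v (u n) (indet n)"
  shows "subst u (subst v x) = x"
proof (rule field_hom_eqI[of "\<lambda>x. subst u (subst v x)" "\<lambda>x. x"])
  show "subst u (subst v (indet n)) = indet n" for n
    using subst_indet[OF u] subst_eval[OF v u] by simp
qed (rule field_hom_comp[OF subst_hom[OF v] subst_hom[OF u]], rule field_hom_id)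

section \<open>Characteristic zero, nonzero indeterminates and finite products\<close>

lemma const_of_nat: "const (of_nat n) = of_nat n"
  by (induction n) (simp_all add: const_add)

lemma const_eq_0_iff [simp]: "const z = 0 \<longleftrightarrow> z = 0"
proof
  assume *: "const z = 0"
  show "z = 0"
  proof (rule ccontr)
    assume "z \<noteq> 0"
    then show False using const_mult[of z "1 / z"] * by simp
  qed
qed simp

lemma ratfun_of_nat_eq_0_iff: "(of_nat n :: ratfun) = 0 \<longleftrightarrow> n = 0"
  by (simp flip: const_of_nat)

lemma ratfun_two_nonzero: "(2 :: ratfun) \<noteq> 0"
  using ratfun_of_nat_eq_0_iff[of 2] by simp

lemma indet_nonzero [simp]: "indet n \<noteq> 0"
  using rat_eval_nonzero[OF rat_eval_indet[of "\<lambda>_. 1" n]] by simp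

lemma coordinates_nonzero [simp]:
  "b_par \<noteq> 0" "c_par \<noteq> 0" "q_par \<noteq> 0" "a_par i \<noteq> 0" "F_var i \<noteq> 0"
  by (simp_all add: b_par_def c_par_def q_par_def a_par_def F_var_def)

lemma prod_shift_1:
  fixes h :: "nat \<Rightarrow> 'k::comm_monoid_mult"
  shows "(\<Prod>k=1..n. h (Suc k)) * h 1 = (\<Prod>k=1..n. h k) * h (Suc n)"
proof (induction n)
  case (Suc n)
  have "(\<Prod>k=1..Suc n. h (Suc k)) * h 1 = ((\<Prod>k=1..n. h (Suc k)) * h 1) * h (Suc (Suc n))"
    by (simp add: ac_simps)
  also have "\<dots> = (\<Prod>k=1..Suc n. h k) * h (Suc (Suc n))"
    unfolding Suc.IH by (simp add: ac_simps)
  finally show ?case .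
qed simp

lemma prod_telescope:
  fixes h :: "nat \<Rightarrow> 'k::field"
  assumes "\<And>k. k \<in> {1..n + 1} \<Longrightarrow> h k \<noteq> 0"
  shows "(\<Prod>k=1..n. h (k + 1) / h k) = h (n + 1) / h 1"
  using assms
proof (induction n)
  case (Suc n)
  then have "h (n + 1) \<noteq> 0" by simp
  with Suc show ?case by simp
qed simp

section \<open>Closure properties of the generated fields\<close>

lemma gen_field_0: "0 \<in> gen_field V" and gen_field_1: "1 \<in> gen_field V"
  using gen_field.const[of 0 V] gen_field.const[of 1 V] by simp_all

lemma gen_field_uminus: "x \<in> gen_field V \<Longrightarrow> - x \<in> gen_field V"
proof -
  have "const (- 1) = - 1" using const_add[of "- 1" 1] by (simp add: eq_neg_iff_add_eq_0)
  then show "x \<in> gen_field V \<Longrightarrow> - x \<in> gen_field V"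
    using gen_field.mult[OF gen_field.const[of "- 1"], of x V] by simp
qed

lemma gen_field_diff: "x \<in> gen_field V \<Longrightarrow> y \<in> gen_field V \<Longrightarrow> x - y \<in> gen_field V"
  using gen_field.add[of x V "- y"] by (simp add: gen_field_uminus)

lemma gen_field_divide: "x \<in> gen_field V \<Longrightarrow> y \<in> gen_field V \<Longrightarrow> x / y \<in> gen_field V"
  unfolding divide_inverse by (intro gen_field.mult gen_field.inverse)

lemma gen_field_power: "x \<in> gen_field V \<Longrightarrow> x ^ n \<in> gen_field V"
  by (induction n) (simp_all add: gen_field_1 gen_field.mult)

lemma gen_field_prod: "(\<And>i. i \<in> A \<Longrightarrow> g i \<in> gen_field V) \<Longrightarrow> prod g A \<in> gen_field V"
  by (induction A rule: infinite_finite_induct) (simp_all add: gen_field_1 gen_field.mult)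

lemma gen_field_sum: "(\<And>i. i \<in> A \<Longrightarrow> g i \<in> gen_field V) \<Longrightarrow> sum g A \<in> gen_field V"
  by (induction A rule: infinite_finite_induct) (simp_all add: gen_field_0 gen_field.add)

lemmas gen_field_intros = gen_field_0 gen_field_1 gen_field_uminus gen_field_diff gen_field_divide
  gen_field_power gen_field_prod gen_field_sum gen_field.add gen_field.mult

lemma gen_field_hom:
  assumes "field_hom \<phi>" "\<And>x. x \<in> V \<Longrightarrow> \<phi> x \<in> gen_field W" "x \<in> gen_field V"
  shows "\<phi> x \<in> gen_field W"
  using assms(3)
proof induction
  case (const z)
  then show ?case using assms(1) by (simp add: hom_const gen_field.const)
qed (use assms(1,2) in \<open>simp_all add: hom_simps gen_field.intros\<close>)

locale weyl_rep =
  fixes N :: nat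
  assumes N_pos: "N > 0"
begin

section \<open>Coordinates\<close>

text \<open>
  \<open>aa\<close> extends \<open>a\<^sub>1, \<dots>, a\<^bsub>2N\<^esub>\<close> to a family of period \<open>2N+1\<close>, with \<open>a\<^sub>0a\<^sub>1\<dots>a\<^bsub>2N\<^esub> = q\<^bsup>-(2N-1)\<^esup>\<close>;
  here \<open>p = q\<^bsup>(2N+1)(2N-1)\<^esup>\<close>. The exponent \<open>2N-1\<close> is needed for the action of \<open>\<mu>\<^sub>0\<close> and \<open>\<mu>\<^sub>1\<close> on \<open>c\<close>.
\<close>

definition aa :: "int \<Rightarrow> ratfun" where
  "aa k = (let j = nat (k mod (2 * int N + 1)) in
     if j = 0 then 1 / (q_par ^ (2 * N - 1) * (\<Prod>i=1..2*N. a_par i)) else a_par j)"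

definition AA :: "int \<Rightarrow> ratfun" where
  "AA k = aa k ^ (2 * N + 1)"

definition ff :: "nat \<Rightarrow> ratfun" where
  "ff i = (if even i then c_par\<^sup>2 * F_var i else F_var i / c_par\<^sup>2)"

definition KK :: ratfun where
  "KK = (\<Prod>i=1..2*N. a_par i ^ i)"

text \<open>The reciprocal of the right-hand side of the last equation of the system: rewriting each
  of the N odd \<open>F_var\<close> as \<open>c_par\<^sup>2 * ff\<close> turns the factor
  \<open>1 / c_par\<close> into the power \<open>2 * N - 1\<close>.\<close>

definition XX :: ratfun where
  "XX = c_par ^ (2 * N - 1) * (\<Prod>k=1..N. ff (2 * k - 1)) / (b_par * KK)"

text \<open>The common image of \<open>XX\<close> under the shift and under the reversal.\<close>

definition YY :: ratfun where
  "YY = (\<Prod>k=1..N. ff (2 * k)) / (c_par ^ (2 * N - 1) * AA 0 * b_par * KK)"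

text \<open>
  The dependent variables continue to both sides as a sequence on which \<open>w\<^sub>1r\<close> acts as a shift; the
  system is the recursion \<open>f\<^bsub>M\<^esub> X = - A\<^sub>0 (1 + Y)\<close> with \<open>M = 2N+1\<close> for it.
\<close>

definition fx :: "nat \<Rightarrow> ratfun" where
  "fx i = (if i = 0 then - (1 + XX) / (AA 0 * YY)
     else if i = 2 * N + 1 then - AA 0 * (1 + YY) / XX else ff i)"

text \<open>The images are prescribed for \<open>ff\<close> rather than for \<open>F_var\<close>,
  hence the correction by powers of the new \<open>C\<close>. Indeterminates beyond the coordinates
  go to \<open>D\<close>: \<open>indet\<close> for a transformation, a constant for a numerical test
  point.\<close>

definition coord_map ::
    "(nat \<Rightarrow> ratfun) \<Rightarrow> ratfun \<Rightarrow> ratfun \<Rightarrow> ratfun \<Rightarrow> (nat \<Rightarrow> ratfun) \<Rightarrow> (nat \<Rightarrow> ratfun) \<Rightarrow> nat \<Rightarrow> ratfun" where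
  "coord_map D B C Q A G n =
     (if n = 0 then B else if n = 1 then C else if n = 2 then Q
      else if n \<le> 4 * N + 2 then
        (let i = (n - 1) div 2 in
         if odd n then A i else if even i then G i / C\<^sup>2 else G i * C\<^sup>2)
      else D n)"

lemma coord_cases:
  obtains "n = 0" | "n = 1" | "n = 2"
  | i where "i \<in> {1..2*N}" "n = 2 * i + 1" | i where "i \<in> {1..2*N}" "n = 2 * i + 2"
  | "n > 4 * N + 2"
proof (cases "n > 4 * N + 2 \<or> n \<le> 2")
  case False
  show thesis
  proof (cases "odd n")
    case True
    then obtain i where "n = 2 * i + 1" by (elim oddE)
    with False show thesis by (intro that(4)[of i]) auto
  next
    case even: False
    then obtain i where "n = 2 * i" by (auto elim: evenE)
    with False show thesis by (intro that(5)[of "i - 1"]) auto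
  qed
qed (use that in \<open>auto simp: numeral_2_eq_2 le_Suc_eq\<close>)

lemma coord_map_simps:
  "coord_map D B C Q A G 0 = B" "coord_map D B C Q A G (Suc 0) = C" "coord_map D B C Q A G 2 = Q"
  "i \<in> {1..2*N} \<Longrightarrow> coord_map D B C Q A G (2 * i + 1) = A i"
  "i \<in> {1..2*N} \<Longrightarrow> coord_map D B C Q A G (2 * i + 2) = (if even i then G i / C\<^sup>2 else G i * C\<^sup>2)"
  "n > 4 * N + 2 \<Longrightarrow> coord_map D B C Q A G n = D n"
  by (auto simp: coord_map_def)

lemma eval_coord_map:
  fixes B C Q :: ratfun and D A G :: "nat \<Rightarrow> ratfun"
  defines "v \<equiv> coord_map D B C Q A G"
  shows "rat_eval v b_par B" "rat_eval v c_par C" "rat_eval v q_par Q"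
    and "i \<in> {1..2*N} \<Longrightarrow> rat_eval v (a_par i) (A i)"
    and "C \<noteq> 0 \<Longrightarrow> i \<in> {1..2*N} \<Longrightarrow> rat_eval v (ff i) (G i)"
proof -
  show b: "rat_eval v b_par B" and c: "rat_eval v c_par C" and q: "rat_eval v q_par Q"
    using rat_eval_indet[of v 0] rat_eval_indet[of v 1] rat_eval_indet[of v 2]
    by (simp_all add: v_def b_par_def c_par_def q_par_def coord_map_simps)
  show "rat_eval v (a_par i) (A i)" if "i \<in> {1..2*N}"
    using rat_eval_indet[of v "2 * i + 1"] coord_map_simps(4)[OF that] by (simp add: v_def a_par_def)
  show "rat_eval v (ff i) (G i)" if "C \<noteq> 0" "i \<in> {1..2*N}"
  proof -
    have F: "rat_eval v (F_var i) (if even i then G i / C\<^sup>2 else G i * C\<^sup>2)"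
      using rat_eval_indet[of v "2 * i + 2"] coord_map_simps(5)[OF that(2)]
      by (simp add: v_def F_var_def)
    have c2: "rat_eval v (c_par\<^sup>2) (C\<^sup>2)" by (intro rat_eval_power c)
    show ?thesis
      using rat_eval_mult[OF c2 F] rat_eval_divide[OF F c2] that by (auto simp: ff_def)
  qed
qed

lemma coord_map_inverse:
  assumes "rat_eval u B b_par" "rat_eval u C c_par" "rat_eval u Q q_par"
    and "\<And>i. i \<in> {1..2*N} \<Longrightarrow> rat_eval u (A i) (a_par i)"
    and "\<And>i. i \<in> {1..2*N} \<Longrightarrow> rat_eval u (G i) (ff i)"
    and "\<And>n. n > 4 * N + 2 \<Longrightarrow> u n = indet n"
  shows "rat_eval u (coord_map indet B C Q A G n) (indet n)"
proof (cases n rule: coord_cases)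
  case (5 i)
  have c2: "rat_eval u (C\<^sup>2) (c_par\<^sup>2)" by (intro rat_eval_power assms)
  have "rat_eval u (if even i then G i / C\<^sup>2 else G i * C\<^sup>2) (F_var i)"
    using rat_eval_mult[OF assms(5)[OF 5(1)] c2] rat_eval_divide[OF assms(5)[OF 5(1)] c2]
    by (auto simp: ff_def)
  then show ?thesis
    using coord_map_simps(5)[OF 5(1)] 5(2) by (simp add: F_var_def)
qed (use assms rat_eval_indet[of u n] in
    \<open>simp_all add: coord_map_simps(1-3,6) coord_map_simps(4)[simplified] b_par_def c_par_def q_par_def a_par_def\<close>)

lemma aa_mod: "aa (k mod (2 * int N + 1)) = aa k"
  by (simp add: aa_def)

lemma aa_cong: "[k = l] (mod (2 * int N + 1)) \<Longrightarrow> aa k = aa l"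
  by (simp add: aa_def cong_def)

lemma aa_add_period: "aa (k + (2 * int N + 1)) = aa k"
  by (simp add: aa_def)

lemma aa_a_par: "i \<in> {1..2*N} \<Longrightarrow> aa (int i) = a_par i"
  by (simp add: aa_def)

lemma aa_0: "aa 0 = 1 / (q_par ^ (2 * N - 1) * (\<Prod>i=1..2*N. a_par i))"
  by (simp add: aa_def)

lemma aa_nonzero [simp]: "aa k \<noteq> 0"
  by (simp add: aa_def Let_def)

lemma AA_nonzero [simp]: "AA k \<noteq> 0"
  by (simp add: AA_def)

lemma AA_add_period: "AA (k + (2 * int N + 1)) = AA k"
  by (simp add: AA_def aa_add_period)

lemma AA_M: "AA (2 * int N + 1) = AA 0" and aa_M: "aa (2 * int N + 1) = aa 0"
  using AA_add_period[of 0] aa_add_period[of 0] by simp_all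

lemma aa_prod: "(\<Prod>i=1..2*N. aa (k + int i)) * aa k = 1 / q_par ^ (2 * N - 1)"
proof (induction k rule: int_induct[of _ 0])
  case base
  have "(\<Prod>i=1..2*N. aa (0 + int i)) = (\<Prod>i=1..2*N. a_par i)"
    by (intro prod.cong) (auto simp: aa_a_par)
  then show ?case by (simp add: aa_0)
next
  case (step1 k)
  have "(\<Prod>i=1..2*N. aa (k + int (Suc i))) * aa (k + 1) = (\<Prod>i=1..2*N. aa (k + int i)) * aa (k + (2 * int N + 1))"
    using prod_shift_1[of "\<lambda>i. aa (k + int i)" "2 * N"] by (simp add: ac_simps)
  then have "(\<Prod>i=1..2*N. aa (k + 1 + int i)) * aa (k + 1) = (\<Prod>i=1..2*N. aa (k + int i)) * aa k"
    unfolding aa_add_period by (simp add: ac_simps)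
  with step1 show ?case by simp
next
  case (step2 k)
  have "(\<Prod>i=1..2*N. aa (k - 1 + int (Suc i))) * aa k = (\<Prod>i=1..2*N. aa (k - 1 + int i)) * aa (k - 1 + (2 * int N + 1))"
    using prod_shift_1[of "\<lambda>i. aa (k - 1 + int i)" "2 * N"] by (simp add: ac_simps)
  then have "(\<Prod>i=1..2*N. aa (k + int i)) * aa k = (\<Prod>i=1..2*N. aa (k - 1 + int i)) * aa (k - 1)"
    unfolding aa_add_period by simp
  with step2 show ?case by simp
qed

text \<open>Add the factor at \<open>k + 2N + 1\<close>, equal to the one at \<open>k\<close>, with
  weight 2N+1. Moving the window then lowers every weight by one, that is, divides by the full
  product \<open>1 / q_par ^ (2 * N - 1)\<close>. This is why the shift divides b by that power of
  q.\<close>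

lemma aa_weighted_prod:
  "(\<Prod>i=1..2*N. aa (k + 1 + int i) ^ i) = q_par ^ (2 * N - 1) * AA k * (\<Prod>i=1..2*N. aa (k + int i) ^ i)"
proof -
  have "(\<Prod>i=1..2*N. aa (k + int (Suc i)) ^ Suc i) * aa (k + 1) =
      (\<Prod>i=1..2*N. aa (k + int i) ^ i) * aa (k + (2 * int N + 1)) ^ (2 * N + 1)"
    using prod_shift_1[of "\<lambda>i. aa (k + int i) ^ i" "2 * N"] by (simp add: ac_simps)
  moreover have "(\<Prod>i=1..2*N. aa (k + int (Suc i)) ^ Suc i) =
      (\<Prod>i=1..2*N. aa (k + 1 + int i) ^ i) * (\<Prod>i=1..2*N. aa (k + 1 + int i))"
    by (simp add: prod.distrib ac_simps)
  ultimately have "(\<Prod>i=1..2*N. aa (k + 1 + int i) ^ i) * ((\<Prod>i=1..2*N. aa (k + 1 + int i)) * aa (k + 1)) =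
      (\<Prod>i=1..2*N. aa (k + int i) ^ i) * AA k"
    by (simp add: aa_add_period AA_def mult.assoc)
  then show ?thesis unfolding aa_prod by (simp add: field_simps)
qed

lemma KK_eq: "KK = (\<Prod>i=1..2*N. aa (int i) ^ i)"
  unfolding KK_def by (intro prod.cong) (auto simp: aa_a_par)

lemma KK_nonzero [simp]: "KK \<noteq> 0"
  by (simp add: KK_def)

lemma ff_nonzero [simp]: "ff i \<noteq> 0"
  by (simp add: ff_def)

lemma XX_nonzero [simp]: "XX \<noteq> 0" and YY_nonzero [simp]: "YY \<noteq> 0"
  by (simp_all add: XX_def YY_def)

lemma fx_simps: "fx 0 = - (1 + XX) / (AA 0 * YY)" "fx (2 * N + 1) = - AA 0 * (1 + YY) / XX"
  "i \<in> {1..2*N} \<Longrightarrow> fx i = ff i"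
  by (auto simp: fx_def)

lemma eval_aa_0:
  assumes "rat_eval v q_par Q" "Q \<noteq> 0" "\<And>i. i \<in> {1..2*N} \<Longrightarrow> rat_eval v (a_par i) (A i)"
    "\<And>i. i \<in> {1..2*N} \<Longrightarrow> A i \<noteq> 0"
  shows "rat_eval v (aa 0) (1 / (Q ^ (2 * N - 1) * (\<Prod>i=1..2*N. A i)))"
  unfolding aa_0
  by (intro rat_eval_divide rat_eval_mult rat_eval_1 rat_eval_power rat_eval_prod assms)
    (use assms in auto)

lemma eval_XX:
  assumes "rat_eval v b_par B" "B \<noteq> 0" "rat_eval v c_par C"
    "\<And>i. i \<in> {1..2*N} \<Longrightarrow> rat_eval v (a_par i) (A i)" "\<And>i. i \<in> {1..2*N} \<Longrightarrow> A i \<noteq> 0"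
    "\<And>i. i \<in> {1..2*N} \<Longrightarrow> rat_eval v (ff i) (G i)"
  shows "rat_eval v XX (C ^ (2 * N - 1) * (\<Prod>k=1..N. G (2 * k - 1)) / (B * (\<Prod>i=1..2*N. A i ^ i)))"
  unfolding XX_def KK_def
  by (intro rat_eval_divide rat_eval_mult rat_eval_power rat_eval_prod assms) (use assms in auto)

lemma eval_YY:
  assumes "rat_eval v b_par B" "B \<noteq> 0" "rat_eval v c_par C" "C \<noteq> 0" "rat_eval v (aa 0) A0" "A0 \<noteq> 0"
    "\<And>i. i \<in> {1..2*N} \<Longrightarrow> rat_eval v (a_par i) (A i)" "\<And>i. i \<in> {1..2*N} \<Longrightarrow> A i \<noteq> 0"
    "\<And>i. i \<in> {1..2*N} \<Longrightarrow> rat_eval v (ff i) (G i)"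
  shows "rat_eval v YY ((\<Prod>k=1..N. G (2 * k)) /
    (C ^ (2 * N - 1) * A0 ^ (2 * N + 1) * B * (\<Prod>i=1..2*N. A i ^ i)))"
  unfolding YY_def KK_def AA_def
  by (intro rat_eval_divide rat_eval_mult rat_eval_power rat_eval_prod assms) (use assms in auto)

lemma nonvanishing:
  shows one_plus_XX [simp]: "1 + XX \<noteq> 0" and one_plus_YY [simp]: "1 + YY \<noteq> 0"
    and ff_minus_AA: "i \<in> {1..2*N} \<Longrightarrow> ff i - AA (int i) \<noteq> 0"
    and AA_ff_minus_1: "i \<in> {1..2*N} \<Longrightarrow> AA (int i) * ff i - 1 \<noteq> 0"
proof -
  \<comment> \<open>At the point with all coordinates 1, both \<open>XX\<close> and
    \<open>YY\<close> take the value 1, so the two sums take the value 2.\<close>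
  let ?v = "coord_map (\<lambda>_. 1) 1 1 1 (\<lambda>_. 1) (\<lambda>_. 1)"
  note e = eval_coord_map[where D = "\<lambda>_. 1" and B = 1 and C = 1 and Q = 1 and A = "\<lambda>_. 1" and G = "\<lambda>_. 1"]
  have "rat_eval ?v (aa 0) 1"
    using eval_aa_0[of ?v 1 "\<lambda>_. 1"] e by simp
  then have "rat_eval ?v XX 1" "rat_eval ?v YY 1"
    using eval_XX[of ?v 1 1 "\<lambda>_. 1" "\<lambda>_. 1"] eval_YY[of ?v 1 1 1 "\<lambda>_. 1" "\<lambda>_. 1"] e by simp_all
  then show "1 + XX \<noteq> 0" "1 + YY \<noteq> 0"
    using rat_eval_nonzero rat_eval_add[OF rat_eval_1] ratfun_two_nonzero
    by (metis one_add_one)+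
  \<comment> \<open>With every \<open>ff\<close> equal to -1 and all other coordinates 1, both
    differences take the value -2.\<close>
  let ?w = "coord_map (\<lambda>_. 1) 1 1 1 (\<lambda>_. 1) (\<lambda>_. - 1)"
  note e = eval_coord_map[where D = "\<lambda>_. 1" and B = 1 and C = 1 and Q = 1 and A = "\<lambda>_. 1" and G = "\<lambda>_. - 1"]
  show "ff i - AA (int i) \<noteq> 0" if "i \<in> {1..2*N}"
  proof -
    have "rat_eval ?w (ff i - a_par i ^ (2 * N + 1)) (- 1 - 1 ^ (2 * N + 1))"
      using that e by (intro rat_eval_diff rat_eval_power) auto
    then show ?thesis
      using that ratfun_two_nonzero rat_eval_nonzero[of ?w "ff i - a_par i ^ (2 * N + 1)" "- 2"]
      by (simp add: AA_def aa_a_par)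
  qed
  show "AA (int i) * ff i - 1 \<noteq> 0" if "i \<in> {1..2*N}"
  proof -
    have "rat_eval ?w (a_par i ^ (2 * N + 1) * ff i - 1) (1 ^ (2 * N + 1) * (- 1) - 1)"
      using that e by (intro rat_eval_diff rat_eval_power rat_eval_mult rat_eval_1) auto
    then show ?thesis
      using that ratfun_two_nonzero rat_eval_nonzero[of ?w "a_par i ^ (2 * N + 1) * ff i - 1" "- 2"]
      by (simp add: AA_def aa_a_par)
  qed
qed

text \<open>\<open>aa 0\<close> is not a coordinate; the prescribed product over one period forces
  its value to be \<open>T 0\<close>, and periodicity gives the other indices.\<close>

lemma eval_aa:
  assumes "rat_eval v q_par Q" "Q \<noteq> 0" and per: "\<And>k. T (k mod (2 * int N + 1)) = T k"
    and nz: "\<And>k. T k \<noteq> 0" and a: "\<And>i. i \<in> {1..2*N} \<Longrightarrow> rat_eval v (a_par i) (T (int i))"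
    and prod: "(\<Prod>i=1..2*N. T (int i)) * T 0 = 1 / Q ^ (2 * N - 1)"
  shows "rat_eval v (aa k) (T k)"
proof -
  define j where "j = nat (k mod (2 * int N + 1))"
  have j: "int j = k mod (2 * int N + 1)" "j \<le> 2 * N"
    using pos_mod_bound[of "2 * int N + 1" k] by (auto simp: j_def)
  have "rat_eval v (aa (int j)) (T (int j))"
  proof (cases "j = 0")
    case True
    have "(\<Prod>i=1..2*N. T (int i)) \<noteq> 0" by (simp add: nz)
    with prod have "1 / (Q ^ (2 * N - 1) * (\<Prod>i=1..2*N. T (int i))) = T 0"
      using \<open>Q \<noteq> 0\<close> by (simp add: field_simps)
    then show ?thesis
      using eval_aa_0[of v Q "\<lambda>i. T (int i)"] assms True by simp
  next
    case False
    with j have "j \<in> {1..2*N}" by simp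
    then show ?thesis using a by (simp add: aa_a_par)
  qed
  then show ?thesis by (simp add: j aa_mod per)
qed

text \<open>The homomorphisms act on all indeterminates of \<open>ratfun\<close>; fixing those
  beyond the coordinates makes them determined by finitely many images.\<close>

definition fixes_rest :: "(ratfun \<Rightarrow> ratfun) \<Rightarrow> bool" where
  "fixes_rest \<phi> \<longleftrightarrow> (\<forall>n>4 * N + 2. \<phi> (indet n) = indet n)"

definition coord_hom :: "(ratfun \<Rightarrow> ratfun) \<Rightarrow> bool" where
  "coord_hom \<phi> \<longleftrightarrow> field_hom \<phi> \<and> fixes_rest \<phi>"

lemma coord_hom_field_hom [simp]: "coord_hom \<phi> \<Longrightarrow> field_hom \<phi>"
  by (simp add: coord_hom_def)

lemma coord_hom_id: "coord_hom (\<lambda>x. x)"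
  by (simp add: coord_hom_def fixes_rest_def field_hom_id)

lemma coord_hom_comp: "coord_hom \<phi> \<Longrightarrow> coord_hom \<psi> \<Longrightarrow> coord_hom (\<lambda>x. \<phi> (\<psi> x))"
  by (simp add: coord_hom_def fixes_rest_def field_hom_comp)

lemma coord_hom_eqI:
  assumes "coord_hom \<phi>" "coord_hom \<psi>" "\<phi> b_par = \<psi> b_par" "\<phi> c_par = \<psi> c_par" "\<phi> q_par = \<psi> q_par"
    and "\<And>i. i \<in> {1..2*N} \<Longrightarrow> \<phi> (a_par i) = \<psi> (a_par i)"
    and ff: "\<And>i. i \<in> {1..2*N} \<Longrightarrow> \<phi> (ff i) = \<psi> (ff i)"
  shows "\<phi> x = \<psi> x"
proof (rule field_hom_eqI[of \<phi> \<psi>])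
  have h: "field_hom \<phi>" "field_hom \<psi>" using assms by simp_all
  have "F_var i = (if even i then ff i / c_par\<^sup>2 else ff i * c_par\<^sup>2)" for i
    by (simp add: ff_def)
  then have F: "\<phi> (F_var i) = \<psi> (F_var i)" if "i \<in> {1..2*N}" for i
    using that assms(4) ff by (simp add: h[THEN hom_divide] h[THEN hom_mult] h[THEN hom_power])
  show "\<phi> (indet n) = \<psi> (indet n)" for n
  proof (cases n rule: coord_cases)
    case 6
    then show ?thesis using assms(1,2) by (simp add: coord_hom_def fixes_rest_def)
  qed (use assms(3-6) F in \<open>simp_all add: b_par_def c_par_def q_par_def a_par_def F_var_def\<close>)
qed (use assms in simp_all)

lemma coord_hom_subst:
  assumes "\<And>n. rat_eval u (coord_map indet B C Q A G n) (indet n)"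
  shows "coord_hom (subst (coord_map indet B C Q A G))"
  using subst_hom[OF assms] subst_indet[OF assms]
  by (auto simp: coord_hom_def fixes_rest_def coord_map_simps)

section \<open>The shift and the reversal\<close>

text \<open>\<open>c_par\<close> is inverted because \<open>XX\<close> and \<open>YY\<close> carry
  opposite powers of it. The power of q in the image of \<open>b_par\<close> cancels the one in the
  image of \<open>KK\<close>, so that \<open>b_par * KK\<close> is multiplied by
  \<open>AA 0\<close>.\<close>

definition shift_map :: "nat \<Rightarrow> ratfun" where
  "shift_map = coord_map indet (b_par / q_par ^ (2 * N - 1)) (1 / c_par) q_par
     (\<lambda>i. aa (int i + 1)) (\<lambda>i. fx (i + 1))"

definition unshift_map :: "nat \<Rightarrow> ratfun" where
  "unshift_map = coord_map indet (b_par * q_par ^ (2 * N - 1)) (1 / c_par) q_par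
     (\<lambda>i. aa (int i - 1)) (\<lambda>i. fx (i - 1))"

text \<open>The index goes from i to 2N+1-i and the parameters are inverted; the power of q again
  makes \<open>b_par * KK\<close> acquire exactly the factor \<open>AA 0\<close>, which sends
  \<open>XX\<close> to \<open>YY\<close>.\<close>

definition rev_map :: "nat \<Rightarrow> ratfun" where
  "rev_map = coord_map indet (b_par / q_par ^ ((2 * N - 1) * (2 * N + 1))) (1 / c_par) (1 / q_par)
     (\<lambda>i. 1 / aa (- int i)) (\<lambda>i. ff (2 * N + 1 - i))"

lemma minus_1_neq [simp]: "- 1 \<noteq> XX" "- 1 \<noteq> YY" "XX \<noteq> - 1" "YY \<noteq> - 1"
  using one_plus_XX one_plus_YY by (metis add.right_inverse)+

lemma fx_nonzero [simp]: "fx i \<noteq> 0"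
  by (simp add: fx_def)

lemma odd_in_range: "k \<in> {1..N} \<Longrightarrow> 2 * k - 1 \<in> {1..2*N}"
  by auto

lemma eval_shift_map:
  "rat_eval shift_map b_par (b_par / q_par ^ (2 * N - 1))"
  "rat_eval shift_map c_par (1 / c_par)" "rat_eval shift_map q_par q_par"
  "rat_eval shift_map (aa k) (aa (k + 1))"
  "i \<in> {1..2*N} \<Longrightarrow> rat_eval shift_map (ff i) (fx (i + 1))"
  "rat_eval shift_map XX YY" "rat_eval shift_map YY (- (1 + YY) / (AA 1 * ff 1))"
  "rat_eval shift_map (fx 0) (ff 1)"
proof -
  note e = eval_coord_map[where D = indet and B = "b_par / q_par ^ (2 * N - 1)" and C = "1 / c_par"
    and Q = q_par and A = "\<lambda>i. aa (int i + 1)" and G = "\<lambda>i. fx (i + 1)", folded shift_map_def]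
  show b: "rat_eval shift_map b_par (b_par / q_par ^ (2 * N - 1))"
    and c: "rat_eval shift_map c_par (1 / c_par)" and q: "rat_eval shift_map q_par q_par"
    using e by simp_all
  show f: "rat_eval shift_map (ff i) (fx (i + 1))" if "i \<in> {1..2*N}" for i
    using e(5) that by simp
  show aa: "rat_eval shift_map (aa k) (aa (k + 1))" for k
  proof (rule eval_aa[where T = "\<lambda>k. aa (k + 1)"])
    show "aa (k mod (2 * int N + 1) + 1) = aa (k + 1)" for k
      by (rule aa_cong) (simp add: cong_def mod_add_left_eq)
    show "(\<Prod>i=1..2*N. aa (int i + 1)) * aa (0 + 1) = 1 / q_par ^ (2 * N - 1)"
      using aa_prod[of 1] by (simp add: add.commute)
  qed (use q e(4) in auto)
  have A: "rat_eval shift_map (AA k) (AA (k + 1))" for k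
    unfolding AA_def by (intro rat_eval_power aa)
  have K: "(\<Prod>i=1..2*N. aa (int i + 1) ^ i) = q_par ^ (2 * N - 1) * AA 0 * KK"
    using aa_weighted_prod[of 0] by (simp add: KK_eq add.commute)
  have O: "(\<Prod>k=1..N. fx (2 * k - 1 + 1)) = (\<Prod>k=1..N. ff (2 * k))"
    by (intro prod.cong) (auto simp: fx_simps)
  \<comment> \<open>The even indices 2k go to 2k+1. Compared with the product over the odd indices,
    1 is lost and 2N+1 is gained, where \<open>fx\<close> leaves the coordinates.\<close>
  have "(\<Prod>k=1..N. fx (2 * Suc k - 1)) * ff 1 = (\<Prod>k=1..N. fx (2 * k - 1)) * fx (2 * N + 1)"
    using prod_shift_1[of "\<lambda>k. fx (2 * k - 1)" N] N_pos by (simp add: fx_simps(3))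
  moreover have "(\<Prod>k=1..N. fx (2 * k - 1)) = (\<Prod>k=1..N. ff (2 * k - 1))"
    using fx_simps(3)[OF odd_in_range] by (intro prod.cong) auto
  ultimately have E: "(\<Prod>k=1..N. fx (2 * k + 1)) = (\<Prod>k=1..N. ff (2 * k - 1)) * fx (2 * N + 1) / ff 1"
    by (simp add: field_simps)
  note X = eval_XX[OF b _ c, of "\<lambda>i. aa (int i + 1)" "\<lambda>i. fx (i + 1)", unfolded O K]
  show X: "rat_eval shift_map XX YY"
    using X e(4,5) by (simp add: YY_def field_simps)
  note Y = eval_YY[OF b _ c _ aa[of 0], of "\<lambda>i. aa (int i + 1)" "\<lambda>i. fx (i + 1)", unfolded E K]
  have "rat_eval shift_map YY (XX * fx (2 * N + 1) / (AA 0 * AA 1 * ff 1))"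
    using Y e(4,5) by (simp add: XX_def AA_def field_simps)
  \<comment> \<open>Here the recursion behind the continued sequence enters:
    \<open>XX * fx (2 * N + 1) = - AA 0 * (1 + YY)\<close>.\<close>
  moreover have "XX * fx (2 * N + 1) / (AA 0 * AA 1 * ff 1) = - (1 + YY) / (AA 1 * ff 1)"
    unfolding fx_simps(2) by (simp add: field_simps)
  ultimately show Y: "rat_eval shift_map YY (- (1 + YY) / (AA 1 * ff 1))" by simp
  have cancel: "- z / (a * (- z / (a * f))) = f" if "z \<noteq> 0" "a \<noteq> 0" "f \<noteq> 0" for z a f :: ratfun
    using that by (simp add: field_simps)
  have "rat_eval shift_map (fx 0) (- (1 + YY) / (AA (0 + 1) * (- (1 + YY) / (AA 1 * ff 1))))"
    unfolding fx_simps(1) by (intro rat_eval_divide rat_eval_uminus rat_eval_add rat_eval_1 rat_eval_mult X Y A) simp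
  moreover have "- (1 + YY) / (AA (0 + 1) * (- (1 + YY) / (AA 1 * ff 1))) = ff 1"
    using cancel[OF one_plus_YY AA_nonzero ff_nonzero] by simp
  ultimately show "rat_eval shift_map (fx 0) (ff 1)" by simp
qed

lemma eval_unshift_map:
  "rat_eval unshift_map b_par (b_par * q_par ^ (2 * N - 1))"
  "rat_eval unshift_map c_par (1 / c_par)" "rat_eval unshift_map q_par q_par"
  "rat_eval unshift_map (aa k) (aa (k - 1))"
  "i \<in> {1..2*N} \<Longrightarrow> rat_eval unshift_map (ff i) (fx (i - 1))"
  "rat_eval unshift_map (fx (2 * N + 1)) (ff (2 * N))"
proof -
  note e = eval_coord_map[where D = indet and B = "b_par * q_par ^ (2 * N - 1)" and C = "1 / c_par"
    and Q = q_par and A = "\<lambda>i. aa (int i - 1)" and G = "\<lambda>i. fx (i - 1)", folded unshift_map_def]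
  show b: "rat_eval unshift_map b_par (b_par * q_par ^ (2 * N - 1))"
    and c: "rat_eval unshift_map c_par (1 / c_par)" and q: "rat_eval unshift_map q_par q_par"
    using e by simp_all
  show f: "rat_eval unshift_map (ff i) (fx (i - 1))" if "i \<in> {1..2*N}" for i
    using e(5) that by simp
  show aa: "rat_eval unshift_map (aa k) (aa (k - 1))" for k
  proof (rule eval_aa[where T = "\<lambda>k. aa (k - 1)"])
    show "aa (k mod (2 * int N + 1) - 1) = aa (k - 1)" for k
      by (rule aa_cong) (simp add: cong_def mod_diff_left_eq)
    show "(\<Prod>i=1..2*N. aa (int i - 1)) * aa (0 - 1) = 1 / q_par ^ (2 * N - 1)"
      using aa_prod[of "- 1"] by simp
  qed (use q e(4) in auto)
  have A: "rat_eval unshift_map (AA k) (AA (k - 1))" for k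
    unfolding AA_def by (intro rat_eval_power aa)
  have A2N: "AA (- 1) = AA (2 * int N)"
    using AA_add_period[of "- 1"] by simp
  have K: "(\<Prod>i=1..2*N. aa (int i - 1) ^ i) = KK / (q_par ^ (2 * N - 1) * AA (2 * int N))"
    using aa_weighted_prod[of "- 1"] by (simp add: KK_eq A2N field_simps)
  have E: "(\<Prod>k=1..N. fx (2 * k - 1)) = (\<Prod>k=1..N. ff (2 * k - 1))"
    using fx_simps(3)[OF odd_in_range] by (intro prod.cong) auto
  have "(\<Prod>k=1..N. fx (2 * Suc k - 2)) * fx 0 = (\<Prod>k=1..N. fx (2 * k - 2)) * ff (2 * N)"
    using prod_shift_1[of "\<lambda>k. fx (2 * k - 2)" N] N_pos by (simp add: fx_simps(3))
  moreover have "(\<Prod>k=1..N. fx (2 * Suc k - 2)) = (\<Prod>k=1..N. ff (2 * k))"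
    by (intro prod.cong) (auto simp: fx_simps)
  ultimately have "(\<Prod>k=1..N. fx (2 * k - 2)) = (\<Prod>k=1..N. ff (2 * k)) * fx 0 / ff (2 * N)"
    by (simp add: field_simps)
  then have O: "(\<Prod>k=1..N. fx (2 * k - 1 - 1)) = (\<Prod>k=1..N. ff (2 * k)) * fx 0 / ff (2 * N)"
    by (simp add: numeral_2_eq_2)
  note X = eval_XX[OF b _ c, of "\<lambda>i. aa (int i - 1)" "\<lambda>i. fx (i - 1)", unfolded O K]
  have "rat_eval unshift_map XX (YY * fx 0 * AA 0 * AA (2 * int N) / ff (2 * N))"
    using X e(4,5) by (simp add: YY_def field_simps)
  moreover have "YY * fx 0 * AA 0 * AA (2 * int N) / ff (2 * N) = - AA (2 * int N) * (1 + XX) / ff (2 * N)"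
    unfolding fx_simps(1) by (simp add: field_simps)
  ultimately have X: "rat_eval unshift_map XX (- AA (2 * int N) * (1 + XX) / ff (2 * N))" by simp
  note Y = eval_YY[OF b _ c _ aa[of 0], of "\<lambda>i. aa (int i - 1)" "\<lambda>i. fx (i - 1)", unfolded E K]
  have Y: "rat_eval unshift_map YY XX"
    using Y e(4,5) A2N by (simp add: XX_def AA_def field_simps)
  have "rat_eval unshift_map (fx (2 * N + 1))
      (- AA (0 - 1) * (1 + XX) / (- AA (2 * int N) * (1 + XX) / ff (2 * N)))"
    unfolding fx_simps(2) by (intro rat_eval_divide rat_eval_uminus rat_eval_add rat_eval_1 rat_eval_mult X Y A) simp
  moreover have "- AA (0 - 1) * (1 + XX) / (- AA (2 * int N) * (1 + XX) / ff (2 * N)) = ff (2 * N)"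
    by (simp add: A2N)
  ultimately show "rat_eval unshift_map (fx (2 * N + 1)) (ff (2 * N))" by simp
qed

definition sh :: "ratfun \<Rightarrow> ratfun" where "sh = subst shift_map"
definition ush :: "ratfun \<Rightarrow> ratfun" where "ush = subst unshift_map"

lemma shift_unshift_map: "rat_eval shift_map (unshift_map n) (indet n)"
  unfolding unshift_map_def
proof (rule coord_map_inverse)
  have "rat_eval shift_map (b_par * q_par ^ (2 * N - 1)) (b_par / q_par ^ (2 * N - 1) * q_par ^ (2 * N - 1))"
    by (intro rat_eval_mult rat_eval_power eval_shift_map)
  then show "rat_eval shift_map (b_par * q_par ^ (2 * N - 1)) b_par" by simp
  have "rat_eval shift_map (1 / c_par) (1 / (1 / c_par))"
    by (intro rat_eval_divide rat_eval_1 eval_shift_map) simp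
  then show "rat_eval shift_map (1 / c_par) c_par" by simp
  show "rat_eval shift_map q_par q_par" by (rule eval_shift_map)
  fix i assume i: "i \<in> {1..2*N}"
  show "rat_eval shift_map (aa (int i - 1)) (a_par i)"
    using eval_shift_map(4)[of "int i - 1"] i by (simp add: aa_a_par)
  show "rat_eval shift_map (fx (i - 1)) (ff i)"
  proof (cases "i = 1")
    case False
    with i have "i - 1 \<in> {1..2*N}" by auto
    with i show ?thesis
      using eval_shift_map(5)[of "i - 1"] fx_simps(3)[of "i - 1"] fx_simps(3)[OF i] by simp
  qed (use eval_shift_map(8) in simp)
qed (simp add: shift_map_def coord_map_simps)

lemma unshift_shift_map: "rat_eval unshift_map (shift_map n) (indet n)"
  unfolding shift_map_def
proof (rule coord_map_inverse)
  have "rat_eval unshift_map (b_par / q_par ^ (2 * N - 1)) (b_par * q_par ^ (2 * N - 1) / q_par ^ (2 * N - 1))"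
    by (intro rat_eval_divide rat_eval_power eval_unshift_map) simp
  then show "rat_eval unshift_map (b_par / q_par ^ (2 * N - 1)) b_par" by simp
  have "rat_eval unshift_map (1 / c_par) (1 / (1 / c_par))"
    by (intro rat_eval_divide rat_eval_1 eval_unshift_map) simp
  then show "rat_eval unshift_map (1 / c_par) c_par" by simp
  show "rat_eval unshift_map q_par q_par" by (rule eval_unshift_map)
  fix i assume i: "i \<in> {1..2*N}"
  show "rat_eval unshift_map (aa (int i + 1)) (a_par i)"
    using eval_unshift_map(4)[of "int i + 1"] i by (simp add: aa_a_par)
  show "rat_eval unshift_map (fx (i + 1)) (ff i)"
    using eval_unshift_map(5)[of "i + 1"] eval_unshift_map(6) i
    by (cases "i = 2 * N") (auto simp: fx_simps(3))
qed (simp add: unshift_map_def coord_map_simps)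

lemma ush_sh [simp]: "ush (sh x) = x" and sh_ush [simp]: "sh (ush x) = x"
  unfolding sh_def ush_def
  by (rule subst_inverse, rule unshift_shift_map, rule shift_unshift_map,
      rule subst_inverse, rule shift_unshift_map, rule unshift_shift_map)

lemma coord_hom_sh [simp]: "coord_hom sh" and coord_hom_ush [simp]: "coord_hom ush"
  unfolding sh_def ush_def shift_map_def unshift_map_def
  by (rule coord_hom_subst, rule unshift_shift_map[unfolded shift_map_def],
      rule coord_hom_subst, rule shift_unshift_map[unfolded unshift_map_def])

lemma sh_eval: "rat_eval shift_map x y \<Longrightarrow> sh x = y"
  unfolding sh_def by (rule subst_eval[OF unshift_shift_map])

lemma ush_eval: "rat_eval unshift_map x y \<Longrightarrow> ush x = y"
  unfolding ush_def by (rule subst_eval[OF shift_unshift_map])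

lemmas sh_simps = eval_shift_map(1-4,6,7)[THEN sh_eval]

lemma sh_fx: "i \<le> 2 * N \<Longrightarrow> sh (fx i) = fx (i + 1)"
  using eval_shift_map(5,8)[THEN sh_eval] N_pos
  by (cases "i = 0") (simp_all add: fx_simps(3))

lemma sh_ff: "i \<in> {1..2*N} \<Longrightarrow> sh (ff i) = fx (i + 1)"
  using sh_fx[of i] by (simp add: fx_simps(3))

lemma sh_AA: "sh (AA k) = AA (k + 1)"
  by (simp only: AA_def hom_power[OF coord_hom_field_hom] coord_hom_sh sh_simps)

lemma ush_fx: "i \<in> {1..2*N+1} \<Longrightarrow> ush (fx i) = fx (i - 1)"
  using sh_fx[of "i - 1"] ush_sh[of "fx (i - 1)"] by (cases i) auto

lemmas ush_simps = eval_unshift_map(1-4)[THEN ush_eval]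

lemma ush_YY: "ush YY = XX"
  using ush_sh[of XX] by (simp add: sh_simps)

lemma eval_rev_map:
  "rat_eval rev_map b_par (b_par / q_par ^ ((2 * N - 1) * (2 * N + 1)))"
  "rat_eval rev_map c_par (1 / c_par)" "rat_eval rev_map q_par (1 / q_par)"
  "rat_eval rev_map (aa k) (1 / aa (- k))"
  "i \<in> {1..2*N} \<Longrightarrow> rat_eval rev_map (ff i) (ff (2 * N + 1 - i))"
  "rat_eval rev_map XX YY"
proof -
  note e = eval_coord_map[where D = indet and B = "b_par / q_par ^ ((2 * N - 1) * (2 * N + 1))"
    and C = "1 / c_par" and Q = "1 / q_par" and A = "\<lambda>i. 1 / aa (- int i)"
    and G = "\<lambda>i. ff (2 * N + 1 - i)", folded rev_map_def]
  show b: "rat_eval rev_map b_par (b_par / q_par ^ ((2 * N - 1) * (2 * N + 1)))"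
    and c: "rat_eval rev_map c_par (1 / c_par)" and q: "rat_eval rev_map q_par (1 / q_par)"
    using e by simp_all
  show f: "rat_eval rev_map (ff i) (ff (2 * N + 1 - i))" if "i \<in> {1..2*N}" for i
    using e(5) that by simp
  have neg: "aa (- int i) = aa (int (2 * N + 1 - i))" if "i \<in> {1..2*N}" for i
    using aa_add_period[of "- int i"] that by (simp add: of_nat_diff algebra_simps)
  have prod_neg: "(\<Prod>i=1..2*N. aa (- int i)) = (\<Prod>i=1..2*N. aa (int i))"
    by (subst prod.atLeastAtMost_rev, rule prod.cong) (auto simp: neg)
  have prod_a: "(\<Prod>i=1..2*N. aa (int i)) = 1 / (q_par ^ (2 * N - 1) * aa 0)"
    using aa_prod[of 0] by (simp add: field_simps)
  show aa: "rat_eval rev_map (aa k) (1 / aa (- k))" for k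
  proof (rule eval_aa[where T = "\<lambda>k. 1 / aa (- k)"])
    show "1 / aa (- (k mod (2 * int N + 1))) = 1 / aa (- k)" for k
      using aa_cong[of "- (k mod (2 * int N + 1))" "- k"] by (simp add: cong_def mod_minus_eq)
    show "(\<Prod>i=1..2*N. 1 / aa (- int i)) * (1 / aa (- 0)) = 1 / (1 / q_par) ^ (2 * N - 1)"
      using prod_a unfolding prod_neg[symmetric] by (simp add: prod_dividef power_one_over)
  qed (use q e(4) in auto)
  have "(\<Prod>i=1..2*N. aa (- int i) ^ i) * KK = (\<Prod>i=1..2*N. aa (int i) ^ (2 * N + 1 - i)) * KK"
    by (subst prod.atLeastAtMost_rev, rule arg_cong2[where f = "(*)"], rule prod.cong) (auto simp: neg)
  also have "\<dots> = (\<Prod>i=1..2*N. aa (int i)) ^ (2 * N + 1)"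
    unfolding KK_eq by (auto simp: prod_power_distrib simp flip: prod.distrib power_add intro!: prod.cong)
  also have "\<dots> = 1 / (q_par ^ ((2 * N - 1) * (2 * N + 1)) * AA 0)"
    unfolding prod_a AA_def by (simp add: power_divide power_mult_distrib power_add flip: power_mult)
  finally have K: "(\<Prod>i=1..2*N. aa (- int i) ^ i) = 1 / (q_par ^ ((2 * N - 1) * (2 * N + 1)) * AA 0 * KK)"
    by (simp add: field_simps)
  have "(\<Prod>i=1..2*N. (1 / aa (- int i)) ^ i) = 1 / (\<Prod>i=1..2*N. aa (- int i) ^ i)"
    by (simp add: prod_dividef power_divide)
  then have K: "(\<Prod>i=1..2*N. (1 / aa (- int i)) ^ i) = q_par ^ ((2 * N - 1) * (2 * N + 1)) * AA 0 * KK"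
    unfolding K by simp
  have O: "(\<Prod>k=1..N. ff (2 * N + 1 - (2 * k - 1))) = (\<Prod>k=1..N. ff (2 * k))"
    by (subst prod.atLeastAtMost_rev, rule prod.cong) (auto intro!: arg_cong[where f = ff])
  note X = eval_XX[OF b _ c, of "\<lambda>i. 1 / aa (- int i)" "\<lambda>i. ff (2 * N + 1 - i)", unfolded O K]
  show "rat_eval rev_map XX YY"
    using X e(4,5) by (simp add: YY_def field_simps)
qed

definition rv :: "ratfun \<Rightarrow> ratfun" where "rv = subst rev_map"

lemma rev_rev_map: "rat_eval rev_map (rev_map n) (indet n)"
proof -
  have "rat_eval rev_map (coord_map indet (b_par / q_par ^ ((2 * N - 1) * (2 * N + 1))) (1 / c_par) (1 / q_par)
     (\<lambda>i. 1 / aa (- int i)) (\<lambda>i. ff (2 * N + 1 - i)) n) (indet n)"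
proof (rule coord_map_inverse)
  let ?m = "(2 * N - 1) * (2 * N + 1)"
  have "rat_eval rev_map (b_par / q_par ^ ?m) (b_par / q_par ^ ?m / (1 / q_par) ^ ?m)"
    by (intro rat_eval_divide rat_eval_power eval_rev_map) simp
  then show "rat_eval rev_map (b_par / q_par ^ ?m) b_par" by (simp add: power_one_over)
  have "rat_eval rev_map (1 / c_par) (1 / (1 / c_par))"
    by (intro rat_eval_divide rat_eval_1 eval_rev_map) simp
  then show "rat_eval rev_map (1 / c_par) c_par" by simp
  have "rat_eval rev_map (1 / q_par) (1 / (1 / q_par))"
    by (intro rat_eval_divide rat_eval_1 eval_rev_map) simp
  then show "rat_eval rev_map (1 / q_par) q_par" by simp
  fix i assume i: "i \<in> {1..2*N}"
  have "rat_eval rev_map (1 / aa (- int i)) (1 / (1 / aa (- (- int i))))"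
    by (intro rat_eval_divide rat_eval_1 eval_rev_map) simp
  then show "rat_eval rev_map (1 / aa (- int i)) (a_par i)" using i by (simp add: aa_a_par)
  show "rat_eval rev_map (ff (2 * N + 1 - i)) (ff i)"
  proof -
    have "2 * N + 1 - i \<in> {1..2*N}" using i by auto
    from eval_rev_map(5)[OF this] show ?thesis using i by simp
  qed
qed (simp add: rev_map_def coord_map_simps)
  then show ?thesis by (simp add: rev_map_def)
qed

lemma rv_rv [simp]: "rv (rv x) = x"
  unfolding rv_def by (rule subst_inverse, rule rev_rev_map, rule rev_rev_map)

lemma coord_hom_rv [simp]: "coord_hom rv"
  using coord_hom_subst[OF rev_rev_map[unfolded rev_map_def]] by (simp add: rv_def rev_map_def)

lemma rv_eval: "rat_eval rev_map x y \<Longrightarrow> rv x = y"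
  unfolding rv_def by (rule subst_eval[OF rev_rev_map])

lemmas rv_simps = eval_rev_map(1-4,6)[THEN rv_eval]

lemma rv_YY: "rv YY = XX"
  using rv_rv[of XX] by (simp add: rv_simps)

lemma rv_AA: "rv (AA k) = 1 / AA (- k)"
  by (simp only: AA_def hom_power[OF coord_hom_field_hom] coord_hom_rv rv_simps power_one_over)

lemma rv_ff: "i \<in> {1..2*N} \<Longrightarrow> rv (ff i) = ff (2 * N + 1 - i)"
  by (rule rv_eval, rule eval_rev_map)

lemma rv_fx: "i \<le> 2 * N + 1 \<Longrightarrow> rv (fx i) = fx (2 * N + 1 - i)"
proof -
  have "rv (fx (2 * N + 1)) = fx 0"
    unfolding fx_simps(1,2) by (simp add: hom_simps rv_simps rv_YY rv_AA field_simps)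
  moreover from this have "rv (fx 0) = fx (2 * N + 1)"
    using rv_rv by metis
  moreover have "rv (fx i) = fx (2 * N + 1 - i)" if "i \<in> {1..2*N}"
  proof -
    have "2 * N + 1 - i \<in> {1..2*N}" using that by auto
    then show ?thesis using rv_ff[OF that] by (simp only: fx_simps(3) that)
  qed
  moreover assume "i \<le> 2 * N + 1"
  then have "i = 0 \<or> i = 2 * N + 1 \<or> i \<in> {1..2*N}" by auto
  ultimately show ?thesis by auto
qed

text \<open>The dihedral relation between reversal and translation of the index; it is behind all
  relations among w_0, w_1 and r.\<close>

lemma rv_sh_rv: "rv (sh (rv x)) = ush x"
proof -
  have "rv (sh x) = ush (rv x)" for x
  proof (rule coord_hom_eqI[of "\<lambda>x. rv (sh x)" "\<lambda>x. ush (rv x)"])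
    fix i assume i: "i \<in> {1..2*N}"
    show "rv (sh (ff i)) = ush (rv (ff i))"
      using i sh_fx[of i] rv_fx[of "i + 1"] rv_fx[of i] ush_fx[of "Suc (2 * N - i)"]
      by (auto simp: fx_simps(3) Suc_diff_le)
    show "rv (sh (a_par i)) = ush (rv (a_par i))"
      using i by (simp add: aa_a_par[symmetric] sh_simps rv_simps ush_simps hom_simps)
  qed (simp_all add: coord_hom_comp sh_simps rv_simps ush_simps hom_simps power_one_over
      field_simps flip: power_add)
  then show ?thesis by simp
qed

section \<open>The reflections \<open>s\<^sub>1, \<dots>, s\<^bsub>2N\<^esub>\<close>\<close>

abbreviation cong_M :: "int \<Rightarrow> int \<Rightarrow> bool" where
  "cong_M k l \<equiv> [k = l] (mod (2 * int N + 1))"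

lemma cong_M_offset:
  assumes "cong_M k j" "\<bar>d - e\<bar> \<le> 2 * int N"
  shows "cong_M (k + d) (j + e) \<longleftrightarrow> d = e"
proof
  assume "cong_M (k + d) (j + e)"
  with assms(1) have "2 * int N + 1 dvd (k + d - (j + e)) - (k - j)"
    unfolding cong_iff_dvd_diff by (rule dvd_diff[rotated])
  then have "2 * int N + 1 dvd d - e" by (simp add: algebra_simps)
  with assms(2) show "d = e"
    using zdvd_imp_le[of "2 * int N + 1" "\<bar>d - e\<bar>"] by (cases "d = e") auto
qed (use assms in \<open>auto intro: cong_add\<close>)

lemma cong_M_eq: "\<bar>k - l\<bar> \<le> 2 * int N \<Longrightarrow> cong_M k l \<longleftrightarrow> k = l"
  using cong_M_offset[of 0 0 k l] by simp

text \<open>The simple reflection of affine type A on multiplicative simple roots. The three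
  congruences exclude one another because the period is at least 3.\<close>

definition refl_par :: "int \<Rightarrow> int \<Rightarrow> ratfun" where
  "refl_par j k = aa k * (if cong_M k j then 1 / (aa j)\<^sup>2 else 1)
     * (if cong_M k (j + 1) then aa j else 1) * (if cong_M k (j - 1) then aa j else 1)"

text \<open>Replacing \<open>AA (int j)\<close> by its inverse with \<open>ff j\<close> fixed
  inverts this fraction, which is what makes the exchange an involution.\<close>

definition rr :: "nat \<Rightarrow> ratfun" where
  "rr j = (AA (int j) * ff j - 1) / (ff j - AA (int j))"

definition refl_map :: "nat \<Rightarrow> nat \<Rightarrow> ratfun" where
  "refl_map j = coord_map indet b_par c_par q_par (\<lambda>i. refl_par (int j) (int i))
     (\<lambda>i. ff i * (if i + 1 = j then rr j else 1) * (if i = j + 1 then 1 / rr j else 1))"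

lemma two_le_period: "2 \<le> 2 * int N" using N_pos by simp

lemma refl_par_cong: "cong_M j j' \<Longrightarrow> cong_M k k' \<Longrightarrow> refl_par j k = refl_par j' k'"
proof -
  assume *: "cong_M j j'" "cong_M k k'"
  then have "cong_M (j + d) (j' + d)" for d by (intro cong_add cong_refl)
  from this[of 0] this[of 1] this[of "- 1"]
  have "cong_M k j = cong_M k' j'" "cong_M k (j + 1) = cong_M k' (j' + 1)" "cong_M k (j - 1) = cong_M k' (j' - 1)"
    using *(2) by (simp_all, meson cong_sym cong_trans)+
  then show ?thesis
    using * by (simp add: refl_par_def aa_cong[OF *(1)] aa_cong[OF *(2)])
qed

lemma refl_par_nonzero [simp]: "refl_par j k \<noteq> 0"
  by (simp add: refl_par_def)

lemma refl_par_self: "refl_par j j = 1 / aa j"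
  using cong_M_offset[of j j 0 1] cong_M_offset[of j j 0 "- 1"] two_le_period
  by (simp add: refl_par_def power2_eq_square)

lemma refl_par_far:
  "\<not> cong_M k j \<Longrightarrow> \<not> cong_M k (j + 1) \<Longrightarrow> \<not> cong_M k (j - 1) \<Longrightarrow> refl_par j k = aa k"
  by (simp add: refl_par_def)

lemma refl_par_neighbour:
  "cong_M k (j + 1) \<or> cong_M k (j - 1) \<Longrightarrow> refl_par j k = aa k * aa j"
proof -
  assume *: "cong_M k (j + 1) \<or> cong_M k (j - 1)"
  show ?thesis
  proof (cases "cong_M k (j + 1)")
    case True
    then show ?thesis
      using cong_M_offset[OF True, of 0 "- 1"] cong_M_offset[OF True, of 0 "- 2"] two_le_period
      by (simp add: refl_par_def)
  next
    case False
    with * have k: "cong_M k (j - 1)" by simp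
    then have "\<not> cong_M k j" "\<not> cong_M k (j + 1)"
      using cong_M_offset[OF k, of 0 1] cong_M_offset[OF k, of 0 2] two_le_period
      by (simp_all add: add.commute)
    with k show ?thesis by (simp add: refl_par_def)
  qed
qed

lemma prod_residue: "(\<Prod>k=0..2*N. if cong_M (int k) m then x else 1) = (x :: ratfun)"
proof -
  define k0 where "k0 = nat (m mod (2 * int N + 1))"
  have k0: "int k0 = m mod (2 * int N + 1)" "k0 \<le> 2 * N"
    using pos_mod_bound[of "2 * int N + 1" m] by (auto simp: k0_def)
  have "cong_M (int k) m \<longleftrightarrow> k = k0" if "k \<in> {0..2*N}" for k
    using that k0 by (auto simp: cong_def)
  then have "(\<Prod>k=0..2*N. if cong_M (int k) m then x else 1) = (\<Prod>k=0..2*N. if k = k0 then x else 1)"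
    by (intro prod.cong) auto
  then show ?thesis using k0 by simp
qed

text \<open>Each of the three correction factors occurs exactly once in a period, and
  \<open>1 / (aa j)\<^sup>2\<close> cancels the factors of the two neighbours.\<close>

lemma prod_refl_par: "(\<Prod>i=1..2*N. refl_par j (int i)) * refl_par j 0 = 1 / q_par ^ (2 * N - 1)"
proof -
  have split: "(\<Prod>i=0..2*N. g i) = g 0 * (\<Prod>i=1..2*N. g i)" for g :: "nat \<Rightarrow> ratfun"
    using prod.atLeast_Suc_atMost[of 0 "2 * N" g] by simp
  have "(\<Prod>i=1..2*N. refl_par j (int i)) * refl_par j 0 = (\<Prod>i=0..2*N. refl_par j (int i))"
    by (simp add: split)
  also have "\<dots> = (\<Prod>i=0..2*N. aa (int i)) * (1 / (aa j)\<^sup>2) * aa j * aa j"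
    by (simp add: refl_par_def prod.distrib prod_residue)
  also have "\<dots> = (\<Prod>i=1..2*N. aa (int i)) * aa 0"
    by (simp add: split power2_eq_square)
  finally show ?thesis using aa_prod[of 0] by simp
qed

lemma rr_nonzero [simp]: "j \<in> {1..2*N} \<Longrightarrow> rr j \<noteq> 0"
  using ff_minus_AA[of j] AA_ff_minus_1[of j] by (simp add: rr_def)

lemma eval_refl_map:
  assumes j: "j \<in> {1..2*N}"
  shows "rat_eval (refl_map j) b_par b_par" "rat_eval (refl_map j) c_par c_par"
    "rat_eval (refl_map j) q_par q_par" "rat_eval (refl_map j) (aa k) (refl_par (int j) k)"
    "i \<in> {1..2*N} \<Longrightarrow> rat_eval (refl_map j) (ff i)
      (ff i * (if i + 1 = j then rr j else 1) * (if i = j + 1 then 1 / rr j else 1))"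
    "rat_eval (refl_map j) (rr j) (1 / rr j)"
proof -
  note e = eval_coord_map[where D = indet and B = b_par and C = c_par and Q = q_par
    and A = "\<lambda>i. refl_par (int j) (int i)"
    and G = "\<lambda>i. ff i * (if i + 1 = j then rr j else 1) * (if i = j + 1 then 1 / rr j else 1)",
    folded refl_map_def]
  show "rat_eval (refl_map j) b_par b_par" "rat_eval (refl_map j) c_par c_par"
    and q: "rat_eval (refl_map j) q_par q_par"
    using e by simp_all
  show f: "rat_eval (refl_map j) (ff i)
      (ff i * (if i + 1 = j then rr j else 1) * (if i = j + 1 then 1 / rr j else 1))"
    if "i \<in> {1..2*N}" for i
    using e(5) that by simp
  show aa: "rat_eval (refl_map j) (aa k) (refl_par (int j) k)" for k
    by (rule eval_aa[where T = "refl_par (int j)"])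
      (use q e(4) prod_refl_par[of "int j"] in \<open>auto intro: refl_par_cong simp: cong_def\<close>)
  have A: "rat_eval (refl_map j) (AA (int j)) (1 / AA (int j))"
    using rat_eval_power[OF aa[of "int j"], of "2 * N + 1"] unfolding refl_par_self AA_def power_one_over .
  have F: "rat_eval (refl_map j) (ff j) (ff j)"
    using f[OF j] by simp
  have *: "ff j - 1 / AA (int j) = (AA (int j) * ff j - 1) / AA (int j)"
    by (simp add: field_simps)
  have "rat_eval (refl_map j) (rr j) ((1 / AA (int j) * ff j - 1) / (ff j - 1 / AA (int j)))"
    unfolding rr_def using AA_ff_minus_1[OF j]
    by (intro rat_eval_divide rat_eval_diff rat_eval_mult rat_eval_1 A F) (simp add: *)
  moreover have "(1 / AA (int j) * ff j - 1) / (ff j - 1 / AA (int j)) = 1 / rr j"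
    unfolding * using AA_ff_minus_1[OF j] ff_minus_AA[OF j] by (simp add: rr_def field_simps)
  ultimately show "rat_eval (refl_map j) (rr j) (1 / rr j)" by simp
qed

lemma refl_refl_map:
  assumes j: "j \<in> {1..2*N}"
  shows "rat_eval (refl_map j) (refl_map j n) (indet n)"
proof -
  note e = eval_refl_map[OF j]
  have "rat_eval (refl_map j) (coord_map indet b_par c_par q_par (\<lambda>i. refl_par (int j) (int i))
     (\<lambda>i. ff i * (if i + 1 = j then rr j else 1) * (if i = j + 1 then 1 / rr j else 1)) n) (indet n)"
  proof (rule coord_map_inverse)
    fix i assume i: "i \<in> {1..2*N}"
    let ?i = "int i" and ?j = "int j"
    have aj: "rat_eval (refl_map j) (aa ?j) (1 / aa ?j)"
      using e(4)[of ?j] by (simp add: refl_par_self)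
    have "rat_eval (refl_map j) (1 / (aa ?j)\<^sup>2) (1 / (1 / aa ?j)\<^sup>2)"
      by (intro rat_eval_divide rat_eval_1 rat_eval_power aj) simp
    with aj have "rat_eval (refl_map j) (aa ?i * (if cong_M ?i ?j then 1 / (aa ?j)\<^sup>2 else 1)
        * (if cong_M ?i (?j + 1) then aa ?j else 1) * (if cong_M ?i (?j - 1) then aa ?j else 1))
        (refl_par ?j ?i *
        (if cong_M ?i ?j then 1 / (1 / aa ?j)\<^sup>2 else 1) * (if cong_M ?i (?j + 1) then 1 / aa ?j else 1)
        * (if cong_M ?i (?j - 1) then 1 / aa ?j else 1))"
      by (intro rat_eval_mult e) (auto simp: rat_eval_1)
    then show "rat_eval (refl_map j) (refl_par ?j ?i) (a_par i)"
      using i by (auto simp: refl_par_def aa_a_par power2_eq_square split: if_splits)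
    have "rat_eval (refl_map j) (1 / rr j) (1 / (1 / rr j))"
      using j by (intro rat_eval_divide rat_eval_1 e) simp
    then have "rat_eval (refl_map j) (ff i * (if i + 1 = j then rr j else 1) * (if i = j + 1 then 1 / rr j else 1))
        (ff i * (if i + 1 = j then rr j else 1) * (if i = j + 1 then 1 / rr j else 1) *
        (if i + 1 = j then 1 / rr j else 1) * (if i = j + 1 then rr j else 1))"
      using e by (intro rat_eval_mult e i) (auto simp: rat_eval_1)
    then show "rat_eval (refl_map j) (ff i * (if i + 1 = j then rr j else 1) *
        (if i = j + 1 then 1 / rr j else 1)) (ff i)"
      using j by (auto split: if_splits)
  qed (use e in \<open>simp_all add: refl_map_def coord_map_simps\<close>)
  then show ?thesis by (simp add: refl_map_def)
qed

definition rf :: "nat \<Rightarrow> ratfun \<Rightarrow> ratfun" where "rf j = subst (refl_map j)"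

context
  fixes j assumes j: "j \<in> {1..2*N}"
begin

lemma rf_rf: "rf j (rf j x) = x"
  unfolding rf_def by (rule subst_inverse, rule refl_refl_map[OF j], rule refl_refl_map[OF j])

lemma coord_hom_rf: "coord_hom (rf j)"
  using coord_hom_subst[OF refl_refl_map[OF j, unfolded refl_map_def]] by (simp add: rf_def refl_map_def)

lemmas rf_simps = eval_refl_map(1-4,6)[OF j, THEN subst_eval[OF refl_refl_map[OF j]], folded rf_def]

lemma rf_ff: "i \<in> {1..2*N} \<Longrightarrow>
    rf j (ff i) = ff i * (if i + 1 = j then rr j else 1) * (if i = j + 1 then 1 / rr j else 1)"
  using eval_refl_map(5)[OF j, THEN subst_eval[OF refl_refl_map[OF j]], folded rf_def] .

lemma rf_AA: "rf j (AA k) = refl_par (int j) k ^ (2 * N + 1)"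
  by (simp only: AA_def hom_power[OF coord_hom_field_hom[OF coord_hom_rf]] rf_simps)

text \<open>The exponents \<open>j - 1\<close>, \<open>- 2 * j\<close> and \<open>j + 1\<close> of
  \<open>aa (int j)\<close> add up to 0. At \<open>j = 2 * N\<close> the right neighbour has index
  2N+1, outside the product, and its missing weight 2N+1 leaves
  \<open>1 / AA (int j)\<close>.\<close>

lemma rf_KK: "rf j KK = KK * (if j = 2 * N then 1 / AA (int j) else 1)"
proof -
  have cong: "cong_M (int i) (int j) \<longleftrightarrow> i = j" "cong_M (int i) (int j + 1) \<longleftrightarrow> i = j + 1"
    "cong_M (int i) (int j - 1) \<longleftrightarrow> Suc i = j" if "i \<in> {1..2*N}" for i
  proof -
    have "\<bar>int i - int j\<bar> \<le> 2 * int N" "\<bar>int i - (int j + 1)\<bar> \<le> 2 * int N" "\<bar>int i - (int j - 1)\<bar> \<le> 2 * int N"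
      using that j by auto
    then show "cong_M (int i) (int j) \<longleftrightarrow> i = j" "cong_M (int i) (int j + 1) \<longleftrightarrow> i = j + 1"
      "cong_M (int i) (int j - 1) \<longleftrightarrow> Suc i = j"
      by (auto simp only: cong_M_eq)
  qed
  have "rf j KK = (\<Prod>i=1..2*N. refl_par (int j) (int i) ^ i)"
    by (simp only: KK_eq hom_prod[OF coord_hom_field_hom[OF coord_hom_rf]]
        hom_power[OF coord_hom_field_hom[OF coord_hom_rf]] rf_simps)
  also have "\<dots> = (\<Prod>i=1..2*N. aa (int i) ^ i * (if i = j then (1 / (aa (int j))\<^sup>2) ^ j else 1)
      * (if i = j + 1 then aa (int j) ^ (j + 1) else 1) * (if i = j - 1 then aa (int j) ^ (j - 1) else 1))"
    using j by (intro prod.cong) (auto simp: refl_par_def cong power_mult_distrib)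
  also have "\<dots> = KK * (1 / (aa (int j))\<^sup>2) ^ j * (if j < 2 * N then aa (int j) ^ (j + 1) else 1)
      * aa (int j) ^ (j - 1)"
    using j by (auto simp: KK_eq prod.distrib)
  also have "\<dots> = KK * (if j = 2 * N then 1 / AA (int j) else 1)"
  proof -
    define x y where "x = aa (int j)" and "y = x ^ (j - 1)"
    have nz: "x \<noteq> 0" "y \<noteq> 0" by (simp_all add: x_def y_def)
    have p: "x ^ j = x * y" using j unfolding y_def by (cases j) auto
    have "(1 / x\<^sup>2) ^ j = 1 / (x * y)\<^sup>2"
      unfolding p[symmetric] by (simp add: power_one_over flip: power_mult) (simp add: mult.commute)
    moreover have "x ^ (j + 1) = x * (x * y)" by (simp add: p)
    moreover have "AA (int j) = x * (x * y)" if "j = 2 * N"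
      using that p by (simp add: AA_def x_def)
    ultimately have "KK * (1 / x\<^sup>2) ^ j * (if j < 2 * N then x ^ (j + 1) else 1) * y =
        KK * (if j = 2 * N then 1 / AA (int j) else 1)"
      using nz j by (simp add: power2_eq_square)
    then show ?thesis unfolding x_def y_def .
  qed
  finally show ?thesis .
qed

text \<open>For odd j no odd index is a neighbour. For even j the two neighbours contribute
  \<open>rr j\<close> and \<open>1 / rr j\<close>, which cancel unless the right one, 2N+1, lies
  outside the product. The factor \<open>AA (int j)\<close> comes from \<open>KK\<close>.\<close>

lemma rf_XX: "rf j XX = XX * (if j = 2 * N then rr j * AA (int j) else 1)"
proof -
  have "(\<Prod>k=1..N. rf j (ff (2 * k - 1))) = (\<Prod>k=1..N. ff (2 * k - 1)
      * (if k = j div 2 then if even j then rr j else 1 else 1)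
      * (if k = j div 2 + 1 then if even j then 1 / rr j else 1 else 1))"
  proof (rule prod.cong)
    fix k assume k: "k \<in> {1..N}"
    then have "1 \<le> k" by simp
    have "2 * k - 1 + 1 = j \<longleftrightarrow> k = j div 2 \<and> even j" "2 * k - 1 = j + 1 \<longleftrightarrow> k = j div 2 + 1 \<and> even j"
      using \<open>1 \<le> k\<close> by presburger+
    then show "rf j (ff (2 * k - 1)) = ff (2 * k - 1)
      * (if k = j div 2 then if even j then rr j else 1 else 1)
      * (if k = j div 2 + 1 then if even j then 1 / rr j else 1 else 1)"
      by (subst rf_ff[OF odd_in_range[OF k]]) auto
  qed simp
  also have "\<dots> = (\<Prod>k=1..N. ff (2 * k - 1)) * (if j = 2 * N then rr j else 1)"
  proof (cases "even j")
    case True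
    then obtain l where "j = 2 * l" by (auto elim: evenE)
    then show ?thesis using j by (simp add: prod.distrib)
  qed auto
  finally have O: "(\<Prod>k=1..N. rf j (ff (2 * k - 1))) = (\<Prod>k=1..N. ff (2 * k - 1)) * (if j = 2 * N then rr j else 1)" .
  have "rf j XX = c_par ^ (2 * N - 1) * (\<Prod>k=1..N. rf j (ff (2 * k - 1))) / (b_par * rf j KK)"
    unfolding XX_def by (simp add: hom_simps[OF coord_hom_field_hom[OF coord_hom_rf]] rf_simps)
  then show ?thesis
    unfolding O rf_KK by (simp add: XX_def)
qed

lemma rf_AA_0: "rf j (AA 0) = AA 0 * (if j = 1 \<or> j = 2 * N then AA (int j) else 1)"
proof -
  have A0: "refl_par (int j) 0 = aa 0 * (if j = 1 \<or> j = 2 * N then aa (int j) else 1)"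
    using j cong_M_offset[of 0 0 0 "int j"] cong_M_offset[of 0 0 0 "int j - 1"]
      cong_M_offset[of 0 "2 * int N + 1" 0 "int j + 1 - (2 * int N + 1)"]
      cong_M_offset[of 0 0 0 "int j + 1 - (2 * int N + 1)"] N_pos
    by (auto simp: refl_par_def cong_def)
  show ?thesis
    unfolding rf_AA A0 by (simp add: AA_def power_mult_distrib)
qed

text \<open>Now the odd j matter, and the boundary case is \<open>j = 1\<close>, whose left
  neighbour 0 lies outside the product. At \<open>j = 2 * N\<close> the changes of
  \<open>AA 0\<close> and of \<open>KK\<close> cancel.\<close>

lemma rf_YY: "rf j YY = YY * (if j = 1 then 1 / (rr j * AA (int j)) else 1)"
proof -
  have range: "2 * k \<in> {1..2*N}" if "k \<in> {1..N}" for k using that by auto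
  have "(\<Prod>k=1..N. rf j (ff (2 * k))) = (\<Prod>k=1..N. ff (2 * k)
      * (if k = j div 2 then if odd j then rr j else 1 else 1)
      * (if k = j div 2 + 1 then if odd j then 1 / rr j else 1 else 1))"
  proof (rule prod.cong)
    fix k assume k: "k \<in> {1..N}"
    then have "1 \<le> k" by simp
    have "2 * k + 1 = j \<longleftrightarrow> k = j div 2 \<and> odd j" "2 * k = j + 1 \<longleftrightarrow> k = j div 2 + 1 \<and> odd j"
      using \<open>1 \<le> k\<close> by presburger+
    then show "rf j (ff (2 * k)) = ff (2 * k)
      * (if k = j div 2 then if odd j then rr j else 1 else 1)
      * (if k = j div 2 + 1 then if odd j then 1 / rr j else 1 else 1)"
      by (subst rf_ff[OF range[OF k]]) auto
  qed simp
  also have "\<dots> = (\<Prod>k=1..N. ff (2 * k)) * (if j = 1 then 1 / rr j else 1)"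
  proof (cases "odd j")
    case True
    then obtain l where "j = 2 * l + 1" by (auto elim: oddE)
    then show ?thesis using j rr_nonzero[OF j] by (auto simp: prod.distrib)
  qed auto
  finally have E: "(\<Prod>k=1..N. rf j (ff (2 * k))) = (\<Prod>k=1..N. ff (2 * k)) * (if j = 1 then 1 / rr j else 1)" .
  have "rf j YY = (\<Prod>k=1..N. rf j (ff (2 * k))) / (c_par ^ (2 * N - 1) * rf j (AA 0) * b_par * rf j KK)"
    unfolding YY_def by (simp add: hom_simps[OF coord_hom_field_hom[OF coord_hom_rf]] rf_simps)
  then show ?thesis
    unfolding E rf_KK rf_AA_0 using N_pos by (simp add: YY_def)
qed

text \<open>The index 1 is congruent to 2N+2, a neighbour of 2N+1, so the image under
  \<open>rf 1\<close> involves the next term of the sequence and is treated separately.\<close>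

lemma rf_fx_M: "j \<noteq> 1 \<Longrightarrow> rf j (fx (2 * N + 1)) = fx (2 * N + 1) * (if j = 2 * N then 1 / rr j else 1)"
  unfolding fx_simps(2)
  by (simp add: hom_simps[OF coord_hom_field_hom[OF coord_hom_rf]] rf_XX rf_YY rf_AA_0)

end

section \<open>Affine permutations and the multiplicative potential\<close>

definition perm :: "int \<Rightarrow> int \<Rightarrow> int" where
  "perm j k = (if cong_M k j then k + 1 else if cong_M k (j + 1) then k - 1 else k)"

text \<open>A multiplicative potential of \<open>aa\<close>, on which the reflections act by affine permutations of the index.\<close>

definition al :: "int \<Rightarrow> ratfun" where
  "al k = (if k \<ge> 0 then (\<Prod>i<nat k. 1 / aa (int i)) else (\<Prod>i<nat (- k). aa (- int i - 1)))"

lemma al_nonzero [simp]: "al k \<noteq> 0"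
  by (simp add: al_def)

lemma al_step: "al k = aa k * al (k + 1)"
proof (cases "k \<ge> 0")
  case True
  then have "nat (k + 1) = Suc (nat k)" by simp
  with True show ?thesis by (simp add: al_def)
next
  case False
  then have "nat (- k) = Suc (nat (- (k + 1)))" by simp
  with False show ?thesis by (auto simp: al_def)
qed

lemma al_ratio: "al k / al (k + 1) = aa k" "al (k + 1) / al k = 1 / aa k"
  using al_step[of k] by simp_all

lemma cong_cases:
  obtains (at) "cong_M k j" "perm j k = k + 1" "perm j (k + 1) = k" "refl_par j k = 1 / aa k"
  | (above) "cong_M k (j + 1)" "perm j k = k - 1" "perm j (k + 1) = k + 1" "refl_par j k = aa k * aa (k - 1)"
  | (below) "cong_M k (j - 1)" "perm j k = k" "perm j (k + 1) = k + 2" "refl_par j k = aa k * aa (k + 1)"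
  | (far) "perm j k = k" "perm j (k + 1) = k + 1" "refl_par j k = aa k"
proof (cases "cong_M k j")
  case True
  have "cong_M (k + 1) (j + 1)" "\<not> cong_M (k + 1) j"
    using cong_M_offset[OF True, of 1 1] cong_M_offset[OF True, of 1 0] N_pos by auto
  moreover have "refl_par j k = 1 / aa k"
    using refl_par_cong[OF _ True, of j j] aa_cong[OF True] by (simp add: refl_par_self)
  ultimately show ?thesis using True by (intro at) (auto simp: perm_def)
next
  case not_at: False
  show ?thesis
  proof (cases "cong_M k (j + 1)")
    case True
    have *: "cong_M (k - 1) j" "\<not> cong_M (k + 1) j" "\<not> cong_M (k + 1) (j + 1)"
      using cong_M_offset[OF True, of "- 1" "- 1"] cong_M_offset[OF True, of 1 "- 1"]
        cong_M_offset[OF True, of 1 0] N_pos by auto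
    then show ?thesis
      using True not_at refl_par_neighbour[of k j] aa_cong[OF *(1)]
      by (intro above) (auto simp: perm_def)
  next
    case not_above: False
    have k1: "\<not> cong_M (k + 1) (j + 1)"
      using not_at cong_add_rcancel[of k 1 j] by simp
    show ?thesis
    proof (cases "cong_M k (j - 1)")
      case True
      have *: "cong_M (k + 1) j"
        using cong_M_offset[OF True, of 1 1] by simp
      then show ?thesis
        using True not_at not_above refl_par_neighbour[of k j] aa_cong[OF *]
        by (intro below) (auto simp: perm_def)
    next
      case False
      then have "\<not> cong_M (k + 1) j"
        using cong_add_rcancel[of k 1 "j - 1"] by simp
      then show ?thesis
        using False not_at not_above k1 by (intro far) (auto simp: perm_def refl_par_far)
    qed
  qed
qed

lemma refl_par_al: "refl_par j k = al (perm j k) / al (perm j (k + 1))"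
proof (cases rule: cong_cases[of k j])
  case above
  then show ?thesis using al_ratio(1)[of "k - 1"] al_ratio(1)[of k] al_step[of "k - 1"] al_step[of k] by simp
next
  case below
  then show ?thesis using al_step[of "k + 1"] al_step[of k] by (simp add: add.assoc)
qed (simp_all add: al_ratio)

lemma cong_M_add_right: "cong_M (k + d) l \<longleftrightarrow> cong_M k (l - d)"
  using cong_add_rcancel[of k d "l - d"] by simp

lemma perm_shift: "perm (j + 1) (k + 1) = perm j k + 1"
  using cong_add_rcancel[of k 1 j] cong_add_rcancel[of k 1 "j + 1"] by (simp add: perm_def)

lemma refl_par_shift: "refl_par (j + 1) (k + 1) = al (perm j k + 1) / al (perm j (k + 1) + 1)"
  by (simp only: refl_par_al perm_shift)

text \<open>Only ratios are shifted: \<open>al\<close> is normalised at 0, so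
  \<open>sh (al k)\<close> and \<open>al (k + 1)\<close> differ by a factor that does not depend on
  k.\<close>

lemma sh_al: "sh (al m / al n) = al (m + 1) / al (n + 1)"
proof -
  have h: "field_hom sh" by simp
  have step: "sh (al k) / al (k + 1) = sh (al (k + 1)) / al (k + 1 + 1)" for k
    using al_step[of k] al_step[of "k + 1"] by (simp add: hom_mult[OF h] sh_simps)
  have "sh (al k) / al (k + 1) = sh (al 0) / al (0 + 1)" for k
  proof (induction k rule: int_induct[of _ 0])
    case (step2 i) then show ?case using step[of "i - 1"] by simp
  qed (use step in simp_all)
  from this[of m] this[of n] have "sh (al m) / al (m + 1) = sh (al n) / al (n + 1)" by simp
  then show ?thesis using hom_nonzero[OF h] by (simp add: hom_divide[OF h] field_simps)
qed

lemma sh_refl_par: "sh (refl_par j k) = refl_par (j + 1) (k + 1)"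
  unfolding refl_par_shift unfolding refl_par_al by (rule sh_al)

text \<open>Two factors determine a multiplicative cocycle; hence it suffices to know the images of \<open>aa\<close>.\<close>

lemma hom_al:
  assumes h: "field_hom \<phi>" and a: "\<And>k. \<phi> (aa k) = al (p k) / al (p (k + 1))"
  shows "\<phi> (al m / al n) = al (p m) / al (p n)"
proof -
  have step: "\<phi> (al k) / al (p k) = \<phi> (al (k + 1)) / al (p (k + 1))" for k
    by (subst al_step[of k]) (simp add: hom_mult[OF h] a)
  have "\<phi> (al k) / al (p k) = \<phi> (al 0) / al (p 0)" for k
  proof (induction k rule: int_induct[of _ 0])
    case (step2 i) then show ?case using step[of "i - 1"] by simp
  qed (use step in simp_all)
  from this[of m] this[of n] have "\<phi> (al m) / al (p m) = \<phi> (al n) / al (p n)" by simp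
  then show ?thesis using hom_nonzero[OF h] by (simp add: hom_divide[OF h] field_simps)
qed

lemma rf_al: "j \<in> {1..2*N} \<Longrightarrow> rf j (al m / al n) = al (perm (int j) m) / al (perm (int j) n)"
  by (rule hom_al) (simp_all add: coord_hom_rf rf_simps refl_par_al)

lemma perm_far: "\<not> cong_M k j \<Longrightarrow> \<not> cong_M k (j + 1) \<Longrightarrow> perm j k = k"
  by (simp add: perm_def)

lemma perm_at: "cong_M k j \<Longrightarrow> perm j k = k + 1"
  by (simp add: perm_def)

lemma perm_above: "cong_M k (j + 1) \<Longrightarrow> perm j k = k - 1"
  using cong_M_offset[of k "j + 1" 0 "- 1"] N_pos by (simp add: perm_def)

lemma perm_perm: "perm j (perm j k) = k"
proof (cases "cong_M k j")
  case True
  then have "cong_M (k + 1) (j + 1)" by (simp add: cong_M_add_right)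
  then show ?thesis using True by (simp add: perm_at perm_above)
next
  case not_at: False
  show ?thesis
  proof (cases "cong_M k (j + 1)")
    case True
    then have "cong_M (k - 1) j" using cong_M_offset[OF True, of "- 1" "- 1"] by simp
    then show ?thesis using perm_above[OF True] by (simp add: perm_at)
  qed (simp add: perm_far not_at)
qed

lemma perm_commute:
  assumes "\<not> cong_M i j" "\<not> cong_M i (j + 1)" "\<not> cong_M j (i + 1)"
  shows "perm i (perm j k) = perm j (perm i k)"
proof -
  have ne: "\<not> (cong_M x i \<and> cong_M x j)" "\<not> (cong_M x i \<and> cong_M x (j + 1))"
    "\<not> (cong_M x (i + 1) \<and> cong_M x j)" "\<not> (cong_M x (i + 1) \<and> cong_M x (j + 1))" for x
    using assms cong_add_rcancel[of i 1 j] by (metis cong_sym cong_trans)+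
  have e: "cong_M (x + 1) (l + 1) \<longleftrightarrow> cong_M x l" "cong_M (x - 1) l \<longleftrightarrow> cong_M x (l + 1)" for x l
    using cong_add_rcancel[of x 1 l] cong_add_rcancel[of "x - 1" 1 l] by simp_all
  consider "cong_M k i" | "cong_M k (i + 1)" | "cong_M k j" | "cong_M k (j + 1)"
    | "\<not> cong_M k i" "\<not> cong_M k (i + 1)" "\<not> cong_M k j" "\<not> cong_M k (j + 1)" by blast
  then show ?thesis
  proof cases
    case 1
    then have "perm i k = k + 1" "perm j k = k" "perm j (k + 1) = k + 1"
      using ne[of k] ne[of "k + 1"] e(1)[of k i] by (auto simp: perm_at perm_far)
    then show ?thesis by simp
  next
    case 2
    then have "perm i k = k - 1" "perm j k = k" "perm j (k - 1) = k - 1"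
      using ne[of k] ne[of "k - 1"] e(2)[of k i] by (auto simp: perm_above perm_far)
    then show ?thesis by simp
  next
    case 3
    then have "perm j k = k + 1" "perm i k = k" "perm i (k + 1) = k + 1"
      using ne[of k] ne[of "k + 1"] e(1)[of k j] by (auto simp: perm_at perm_far)
    then show ?thesis by simp
  next
    case 4
    then have "perm j k = k - 1" "perm i k = k" "perm i (k - 1) = k - 1"
      using ne[of k] ne[of "k - 1"] e(2)[of k j] by (auto simp: perm_above perm_far)
    then show ?thesis by simp
  qed (simp add: perm_far)
qed

lemma perm_braid: "perm j (perm (j + 1) (perm j k)) = perm (j + 1) (perm j (perm (j + 1) k))"
proof -
  have o: "cong_M (k + d) (j + e) \<longleftrightarrow> d = e - f" if "cong_M k (j + f)" "\<bar>d - (e - f)\<bar> \<le> 2" for d e f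
    using cong_M_offset[OF that(1), of d "e - f"] that(2) two_le_period by simp
  consider "cong_M k (j + 0)" | "cong_M k (j + 1)" | "cong_M k (j + 2)"
    | "\<not> cong_M k j" "\<not> cong_M k (j + 1)" "\<not> cong_M k (j + 2)" by auto
  then show ?thesis
  proof cases
    case 1
    note o = o[OF 1]
    show ?thesis
      using o[of 0 0] o[of 0 1] o[of 0 2] o[of 1 1] o[of 1 2] o[of 2 0] o[of 2 1]
      by (simp add: perm_def ac_simps)
  next
    case 2
    note o = o[OF 2]
    show ?thesis
      using o[of 0 0] o[of 0 1] o[of 0 2] o[of "- 1" 0] o[of "- 1" 1] o[of "- 1" 2] o[of 1 0] o[of 1 1] o[of 1 2]
      by (simp add: perm_def ac_simps)
  next
    case 3
    note o = o[OF 3]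
    show ?thesis
      using o[of 0 0] o[of 0 1] o[of 0 2] o[of "- 1" 0] o[of "- 1" 1] o[of "- 2" 1] o[of "- 2" 2]
      by (simp add: perm_def ac_simps)
  qed (simp add: perm_def ac_simps)
qed

section \<open>The relations between shift, reversal and reflections\<close>

context
  notes One_nat_def [simp del]
begin

lemma rf_eqI:
  assumes "coord_hom \<phi>" "coord_hom \<psi>" "\<phi> b_par = \<psi> b_par" "\<phi> c_par = \<psi> c_par" "\<phi> q_par = \<psi> q_par"
    and aa: "\<And>k. \<phi> (aa k) = \<psi> (aa k)"
    and ff: "\<And>i. i \<in> {1..2*N} \<Longrightarrow> \<phi> (ff i) = \<psi> (ff i)"
  shows "\<phi> x = \<psi> x"
proof (rule coord_hom_eqI[OF assms(1-5)])
  show "\<phi> (a_par i) = \<psi> (a_par i)" if "i \<in> {1..2*N}" for i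
    using aa[of "int i"] that by (simp add: aa_a_par)
qed (rule ff)

lemma sh_rr: "j \<in> {1..2*N} \<Longrightarrow> sh (rr j) = (AA (int j + 1) * fx (j + 1) - 1) / (fx (j + 1) - AA (int j + 1))"
  by (simp add: rr_def hom_simps sh_ff sh_AA)

lemma rf_fx: "i \<in> {1..2*N+1} \<Longrightarrow> j \<in> {1..2*N} \<Longrightarrow> j \<noteq> 1 \<or> i \<le> 2 * N \<Longrightarrow>
    rf j (fx i) = fx i * (if i + 1 = j then rr j else 1) * (if i = j + 1 then 1 / rr j else 1)"
  using rf_fx_M[of j] rf_ff[of j i] fx_simps(3)[of i] by (cases "i = 2 * N + 1") auto

lemma sh_rf:
  assumes j: "j \<in> {1..2*N-1}"
  shows "sh (rf j x) = rf (j + 1) (sh x)"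
proof (rule rf_eqI[of "\<lambda>x. sh (rf j x)" "\<lambda>x. rf (j + 1) (sh x)"])
  have j': "j \<in> {1..2*N}" "j + 1 \<in> {1..2*N}" using j N_pos by auto
  note h = coord_hom_rf[OF j'(1)] coord_hom_rf[OF j'(2)]
  show "coord_hom (\<lambda>x. sh (rf j x))" "coord_hom (\<lambda>x. rf (j + 1) (sh x))"
    by (rule coord_hom_comp[OF coord_hom_sh h(1)], rule coord_hom_comp[OF h(2) coord_hom_sh])
  note hs = hom_simps[OF coord_hom_field_hom[OF h(2)]] rf_simps[OF j'(1)] rf_simps[OF j'(2)] sh_simps
  show "sh (rf j b_par) = rf (j + 1) (sh b_par)" "sh (rf j c_par) = rf (j + 1) (sh c_par)"
    "sh (rf j q_par) = rf (j + 1) (sh q_par)" by (simp_all add: hs)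
  show "sh (rf j (aa k)) = rf (j + 1) (sh (aa k))" for k
    by (simp only: hs sh_refl_par of_nat_add of_nat_1)
  have rr: "sh (rr j) = rr (j + 1)"
    using sh_rr[OF j'(1)] j'(2) by (simp add: rr_def fx_simps(3) add.commute)
  fix i assume i: "i \<in> {1..2*N}"
  then have i': "i + 1 \<in> {1..2*N+1}" by simp
  have "rf (j + 1) (fx (i + 1)) = fx (i + 1) * (if i + 1 + 1 = j + 1 then rr (j + 1) else 1)
      * (if i + 1 = j + 1 + 1 then 1 / rr (j + 1) else 1)"
    by (rule rf_fx[OF i' j'(2)]) (use j in simp)
  then show "sh (rf j (ff i)) = rf (j + 1) (sh (ff i))"
    using i by (simp add: rf_ff[OF j'(1)] sh_ff hom_simps rr)
qed

text \<open>The term of index 2N+2 of the continued sequence.\<close>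

definition fx1 :: ratfun where "fx1 = (1 + YY - AA 1 * ff 1) / (YY * ff 1)"

lemma sh_fx_M: "sh (fx (2 * N + 1)) = fx1"
proof -
  have "sh (fx (2 * N + 1)) = - AA 1 * (1 - (1 + YY) / (AA 1 * ff 1)) / YY"
    unfolding fx_simps(2) by (simp add: hom_simps sh_simps sh_AA field_simps)
  also have "\<dots> = fx1"
    by (simp add: fx1_def field_simps)
  finally show ?thesis .
qed

lemma AA_cong: "cong_M k l \<Longrightarrow> AA k = AA l"
  by (simp add: AA_def aa_cong)

lemma AA_ff1_minus_1 [simp]: "AA 1 * ff 1 - 1 \<noteq> 0" "ff 1 - AA 1 \<noteq> 0"
  using AA_ff_minus_1[of 1] ff_minus_AA[of 1] N_pos by simp_all

lemma rf1_YY: "rf 1 YY = YY * (ff 1 - AA 1) / (AA 1 * (AA 1 * ff 1 - 1))"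
  using rf_YY[of 1] N_pos by (simp add: rr_def)

lemma one_in_range: "1 \<in> {1..2*N}" using N_pos by simp

text \<open>A reflection fixes the term of its own index, and 2N+2 is congruent to 1.\<close>

lemma rf1_fx1: "rf 1 fx1 = fx1"
proof -
  note h = coord_hom_field_hom[OF coord_hom_rf[OF one_in_range]]
  have A: "rf 1 (AA 1) = 1 / AA 1"
    using rf_AA[OF one_in_range, of 1] refl_par_self[of 1] by (simp add: AA_def power_one_over)
  have "rf 1 fx1 = (1 + rf 1 YY - 1 / AA 1 * ff 1) / (rf 1 YY * ff 1)"
    using N_pos by (simp add: fx1_def hom_simps[OF h] A rf_ff[OF one_in_range])
  also have "\<dots> = fx1"
  proof -
    define A x z where d: "A = AA 1" "x = ff 1" "z = A * x - 1"
    have nz: "A \<noteq> 0" "x \<noteq> 0" "z \<noteq> 0" "x - A \<noteq> 0" using AA_ff1_minus_1 by (simp_all add: d)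
    have "(1 + YY * (x - A) / (A * z) - 1 / A * x) / (YY * (x - A) / (A * z) * x) = (1 + YY - A * x) / (YY * x)"
    proof -
      have "1 + YY * (x - A) / (A * z) - 1 / A * x = (x - A) * (YY - z) / (A * z)"
        using nz by (simp add: field_simps)
      then show ?thesis using nz by (simp add: d(3))
    qed
    then show ?thesis by (simp add: rf1_YY fx1_def d)
  qed
  finally show ?thesis .
qed

text \<open>With s_0 defined as the conjugate of s_{2N} by the shift, this closes the cycle from
  s_{2N} through s_0 to s_1. The real computation concerns the terms that are moved past the end of
  the coordinates.\<close>

lemma rf1_sh_sh: "rf 1 (sh (sh x)) = sh (sh (rf (2 * N) x))"
proof (rule rf_eqI[of "\<lambda>x. rf 1 (sh (sh x))" "\<lambda>x. sh (sh (rf (2 * N) x))"])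
  have j: "1 \<in> {1..2*N}" "2 * N \<in> {1..2*N}" using N_pos by auto
  note h = coord_hom_rf[OF j(1)] coord_hom_rf[OF j(2)]
  show "coord_hom (\<lambda>x. rf 1 (sh (sh x)))" "coord_hom (\<lambda>x. sh (sh (rf (2 * N) x)))"
    by (rule coord_hom_comp[OF h(1) coord_hom_comp[OF coord_hom_sh coord_hom_sh]],
        rule coord_hom_comp[OF coord_hom_sh coord_hom_comp[OF coord_hom_sh h(2)]])
  note hs = hom_simps[OF coord_hom_field_hom[OF h(1)]] rf_simps[OF j(1)] rf_simps[OF j(2)] sh_simps
    hom_simps[OF coord_hom_field_hom[OF coord_hom_sh]]
  show "rf 1 (sh (sh b_par)) = sh (sh (rf (2 * N) b_par))" "rf 1 (sh (sh c_par)) = sh (sh (rf (2 * N) c_par))"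
    "rf 1 (sh (sh q_par)) = sh (sh (rf (2 * N) q_par))" by (simp_all add: hs)
  have "cong_M (int 1) (int (2 * N) + 1 + 1)"
    using cong_M_offset[of 0 "2 * int N + 1" 1 1] by (simp add: cong_def)
  then have "refl_par (int 1) (k + 1 + 1) = refl_par (int (2 * N) + 1 + 1) (k + 1 + 1)" for k
    by (rule refl_par_cong) (simp add: cong_def)
  then show "rf 1 (sh (sh (aa k))) = sh (sh (rf (2 * N) (aa k)))" for k
    by (simp only: rf_simps[OF j(1)] rf_simps[OF j(2)] sh_simps sh_refl_par)
  fix i assume i: "i \<in> {1..2*N}"
  consider "i = 2 * N" | "i = 2 * N - 1" | "i < 2 * N - 1" using i by force
  then show "rf 1 (sh (sh (ff i))) = sh (sh (rf (2 * N) (ff i)))"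
  proof cases
    case 1
    then show ?thesis
      using sh_ff[OF i] sh_fx_M rf1_fx1 rf_ff[OF j(2) i] by simp
  next
    case 3
    then have "sh (sh (ff i)) = fx (i + 1 + 1)"
      using sh_ff[OF i] sh_fx[of "i + 1"] by simp
    then show ?thesis
      using 3 i rf_fx[of "i + 1 + 1" 1] rf_ff[OF j(2) i] by auto
  next
    case 2
    have s: "sh (sh (ff i)) = fx (2 * N + 1)"
      using 2 i sh_ff[OF i] sh_fx[of "i + 1"] by simp
    have AA1: "AA (2 * int N + 2) = AA 1"
      using AA_add_period[of 1] by (simp add: add.commute)
    \<comment> \<open>This is the exchange factor of index 2N+2, formed with \<open>AA 1\<close> and
      \<open>fx1\<close>; it has to be the factor by which \<open>rf 1\<close> changes the term of
      index 2N+1.\<close>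
    have "sh (sh (rr (2 * N))) = (AA 1 * fx1 - 1) / (fx1 - AA 1)"
      using N_pos by (simp add: sh_rr hs sh_AA sh_fx_M[simplified] AA1[simplified add.commute] AA1)
    moreover have "rf (2 * N) (ff i) = ff i * rr (2 * N)"
      using rf_ff[OF j(2) i] 2 N_pos by auto
    ultimately have R: "sh (sh (rf (2 * N) (ff i))) = fx (2 * N + 1) * ((AA 1 * fx1 - 1) / (fx1 - AA 1))"
      by (simp add: hs s)
    have A0: "rf 1 (AA 0) = AA 0 * AA 1"
      using rf_AA_0[OF j(1)] by simp
    have X: "rf 1 XX = XX"
      using rf_XX[OF j(1)] N_pos by simp
    define A x Y z where d: "A = AA 1" "x = ff 1" "Y = YY" "z = A * x - 1"
    have nz: "A \<noteq> 0" "x \<noteq> 0" "Y \<noteq> 0" "z \<noteq> 0" "x - A \<noteq> 0" "1 + Y \<noteq> 0"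
      using AA_ff1_minus_1 by (simp_all add: d)
    have L: "rf 1 (fx (2 * N + 1)) = - (AA 0 * A) * (1 + Y * (x - A) / (A * z)) / XX"
      unfolding fx_simps(2) by (simp only: hs A0 X rf1_YY d)
    have e1: "fx1 - A = - ((1 + Y) * z) / (Y * x)" and e2: "A * fx1 - 1 = - (A * z + Y * (x - A)) / (Y * x)"
      and fx1: "fx1 = (1 + Y - A * x) / (Y * x)"
      using nz by (simp_all add: fx1_def d field_simps)
    have cancel: "(- p / d) / (- s / d) = p / s" if "d \<noteq> 0" for p d s :: ratfun
      using that by simp
    have "(A * fx1 - 1) / (fx1 - A) = (A * z + Y * (x - A)) / ((1 + Y) * z)"
      unfolding e1 e2 by (rule cancel) (use nz in simp)
    then have "fx (2 * N + 1) * ((A * fx1 - 1) / (fx1 - A)) = - AA 0 * (A * z + Y * (x - A)) / (XX * z)"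
      unfolding fx_simps(2) using nz(6) by (simp add: d(3)[symmetric])
    also have "\<dots> = rf 1 (fx (2 * N + 1))"
      unfolding L using nz by (simp add: field_simps)
    finally show ?thesis using R s by (simp add: d)
  qed
qed

lemma rf_commute:
  assumes j: "j \<in> {3..2*N}"
  shows "rf 1 (rf j x) = rf j (rf 1 x)"
proof (rule rf_eqI[of "\<lambda>x. rf 1 (rf j x)" "\<lambda>x. rf j (rf 1 x)"])
  have j': "1 \<in> {1..2*N}" "j \<in> {1..2*N}" using j by auto
  note h = coord_hom_rf[OF j'(1)] coord_hom_rf[OF j'(2)]
  show "coord_hom (\<lambda>x. rf 1 (rf j x))" "coord_hom (\<lambda>x. rf j (rf 1 x))"
    by (rule coord_hom_comp[OF h], rule coord_hom_comp[OF h(2,1)])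
  note hs = rf_simps[OF j'(1)] rf_simps[OF j'(2)] hom_simps[OF coord_hom_field_hom[OF h(1)]]
    hom_simps[OF coord_hom_field_hom[OF h(2)]]
  show "rf 1 (rf j b_par) = rf j (rf 1 b_par)" "rf 1 (rf j c_par) = rf j (rf 1 c_par)"
    "rf 1 (rf j q_par) = rf j (rf 1 q_par)" by (simp_all add: hs)
  have n: "\<not> cong_M 1 (int j)" "\<not> cong_M 1 (int j + 1)" "\<not> cong_M (int j) (1 + 1)" "\<not> cong_M (int j) 1"
     "\<not> cong_M 1 (int j - 1)" "\<not> cong_M (int j) (1 - 1)"
    using j cong_M_eq[of 1 "int j"] cong_M_eq[of 1 "int j + 1"] cong_M_eq[of "int j" "1 + 1"] cong_M_eq[of "int j" 1]
       cong_M_eq[of 1 "int j - 1"] cong_M_eq[of "int j" "1 - 1"] by auto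
  show "rf 1 (rf j (aa k)) = rf j (rf 1 (aa k))" for k
    using perm_commute[OF n(1-3)]
    by (simp add: rf_simps[OF j'(1)] rf_simps[OF j'(2)] refl_par_al rf_al[OF j'(1)] rf_al[OF j'(2)])
  have far: "refl_par 1 (int j) = aa (int j)" "refl_par (int j) 1 = aa 1"
    by (rule refl_par_far; rule n)+
  have r1: "rf 1 (rr j) = rr j"
    using j by (simp add: rr_def hs rf_AA[OF j'(1)] rf_ff[OF j'(1) j'(2)] far AA_def)
  have r2: "rf j (rr 1) = rr 1"
    using j by (simp add: rr_def hs rf_AA[OF j'(2)] rf_ff[OF j'(2) j'(1)] far AA_def)
  have r3: "rf 1 (if t then rr j else 1) = (if t then rr j else 1)" "rf 1 (if t then 1 / rr j else 1) = (if t then 1 / rr j else 1)"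
    "rf j (if t then rr 1 else 1) = (if t then rr 1 else 1)" "rf j (if t then 1 / rr 1 else 1) = (if t then 1 / rr 1 else 1)" for t
    by (simp_all add: hs r1 r2)
  show "rf 1 (rf j (ff i)) = rf j (rf 1 (ff i))" if i: "i \<in> {1..2*N}" for i
    by (simp only: rf_ff[OF j'(1) i] rf_ff[OF j'(2) i] hom_mult[OF coord_hom_field_hom[OF h(1)]]
        hom_mult[OF coord_hom_field_hom[OF h(2)]] r3 ac_simps)
qed

text \<open>On the parameters this is the braid relation of affine permutations. On
  \<open>ff 1\<close> and \<open>ff 3\<close> it amounts to the cocycle identity \<open>i1\<close>
  for \<open>rr 2\<close>, on \<open>ff 2\<close> to the identity \<open>i2\<close> for
  \<open>rr 1\<close>.\<close>

lemma rf_braid: "rf 1 (rf 2 (rf 1 x)) = rf 2 (rf 1 (rf 2 x))"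
proof (rule rf_eqI[of "\<lambda>x. rf 1 (rf 2 (rf 1 x))" "\<lambda>x. rf 2 (rf 1 (rf 2 x))"])
  have j: "1 \<in> {1..2*N}" "2 \<in> {1..2*N}" using N_pos by auto
  note h = coord_hom_rf[OF j(1)] coord_hom_rf[OF j(2)]
  show "coord_hom (\<lambda>x. rf 1 (rf 2 (rf 1 x)))" "coord_hom (\<lambda>x. rf 2 (rf 1 (rf 2 x)))"
    by (rule coord_hom_comp[OF h(1) coord_hom_comp[OF h(2,1)]], rule coord_hom_comp[OF h(2) coord_hom_comp[OF h]])
  note hs = rf_simps[OF j(1)] rf_simps[OF j(2)] hom_simps[OF coord_hom_field_hom[OF h(1)]]
    hom_simps[OF coord_hom_field_hom[OF h(2)]]
  show "rf 1 (rf 2 (rf 1 b_par)) = rf 2 (rf 1 (rf 2 b_par))" "rf 1 (rf 2 (rf 1 c_par)) = rf 2 (rf 1 (rf 2 c_par))"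
    "rf 1 (rf 2 (rf 1 q_par)) = rf 2 (rf 1 (rf 2 q_par))" by (simp_all add: hs)
  show "rf 1 (rf 2 (rf 1 (aa k))) = rf 2 (rf 1 (rf 2 (aa k)))" for k
    using perm_braid[of 1]
    by (simp add: rf_simps[OF j(1)] rf_simps[OF j(2)] refl_par_al rf_al[OF j(1)] rf_al[OF j(2)])
  define A B x y where d: "A = AA 1" "B = AA 2" "x = ff 1" "y = ff 2"
  have nz: "A \<noteq> 0" "B \<noteq> 0" "x \<noteq> 0" "y \<noteq> 0" "A * x - 1 \<noteq> 0" "x - A \<noteq> 0" "B * y - 1 \<noteq> 0" "y - B \<noteq> 0"
    using AA_ff_minus_1[OF j(1)] ff_minus_AA[OF j(1)] AA_ff_minus_1[OF j(2)] ff_minus_AA[OF j(2)]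
    by (simp_all add: d)
  have neighb: "refl_par 1 2 = aa 2 * aa 1" "refl_par 2 1 = aa 1 * aa 2"
    by (simp_all add: refl_par_neighbour cong_def)
  have r: "rr 1 = (A * x - 1) / (x - A)" "rr 2 = (B * y - 1) / (y - B)"
    by (simp_all add: rr_def d)
  have im: "rf 1 A = 1 / A" "rf 2 B = 1 / B" "rf 1 B = A * B" "rf 2 A = A * B"
      "rf 1 x = x" "rf 2 y = y" "rf 1 y = y * (x - A) / (A * x - 1)" "rf 2 x = x * (B * y - 1) / (y - B)"
    using rf_AA[OF j(1), of 1] rf_AA[OF j(1), of 2] rf_AA[OF j(2), of 1] rf_AA[OF j(2), of 2]
      rf_ff[OF j(1) j(1)] rf_ff[OF j(1) j(2)] rf_ff[OF j(2) j(1)] rf_ff[OF j(2) j(2)]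
      refl_par_self[of 1] refl_par_self[of 2]
    by (simp_all add: d neighb AA_def power_one_over power_mult_distrib rr_def)
  have frac: "(k * (u / z) - 1) / (u / z - k) = (k * u - z) / (u - k * z)" if "z \<noteq> 0" for k u z :: ratfun
  proof -
    have "k * (u / z) - 1 = (k * u - z) / z" "u / z - k = (u - k * z) / z"
      using that by (simp_all add: field_simps)
    then show ?thesis using that by simp
  qed
  have e1: "rf 1 (rr 2) = (A * B * (y * (x - A)) - (A * x - 1)) / (y * (x - A) - A * B * (A * x - 1))"
    unfolding r by (simp only: hs im frac[OF nz(5)])
  have e2: "rf 2 (rr 1) = (A * B * (x * (B * y - 1)) - (y - B)) / (x * (B * y - 1) - A * B * (y - B))"
    unfolding r by (simp only: hs im frac[OF nz(8)])
  have i1: "rf 1 (rr 2) = rr 2 * rf 2 (rf 1 (rr 2))"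
  proof -
    define x' where "x' = x * (B * y - 1) / (y - B)"
    define z w where "z = y - B" and "w = B * y - 1"
    have nz': "z \<noteq> 0" "A * B * (1 / B) = A" and x': "x' * z = x * w"
      using nz by (simp_all add: z_def w_def x'_def)
    \<comment> \<open>\<open>x'\<close> has denominator z, and \<open>x' * z\<close> is the
      polynomial \<open>x * w\<close>; multiplied by z, the numerator and the denominator of the
      image become polynomial identities.\<close>
    have "z * (A * (y * (x' - A * B)) - (A * B * x' - 1)) = A * (y * (x' * z - A * B * z)) - (A * B * (x' * z) - z)"
      by (simp add: algebra_simps)
    also have "\<dots> = z * (A * B * (y * (x - A)) - (A * x - 1))"
      unfolding x' unfolding z_def w_def by (simp add: algebra_simps)
    finally have c1: "A * B * (1 / B) * (y * (x' - A * B)) - (A * B * x' - 1) = A * B * (y * (x - A)) - (A * x - 1)"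
      using nz' by simp
    have "(y * (x' - A * B) - A * (A * B * x' - 1)) * z = y * (x' * z - A * B * z) - A * (A * B * (x' * z) - z)"
      by (simp add: algebra_simps)
    also have "\<dots> = w * (y * (x - A) - A * B * (A * x - 1))"
      unfolding x' unfolding z_def w_def by (simp add: algebra_simps)
    finally have c2: "y * (x' - A * B) - A * B * (1 / B) * (A * B * x' - 1) =
        (B * y - 1) / (y - B) * (y * (x - A) - A * B * (A * x - 1))"
      using nz' by (simp add: eq_divide_eq flip: z_def w_def)
    have "rf 2 (rf 1 (rr 2)) = (A * B * (1 / B) * (y * (x' - A * B)) - (A * B * x' - 1)) /
        (y * (x' - A * B) - A * B * (1 / B) * (A * B * x' - 1))"
      unfolding e1 by (simp only: hs im x'_def)
    then show ?thesis unfolding c1 c2 unfolding e1 unfolding r using nz by simp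
  qed
  have i2: "rf 2 (rr 1) = rr 1 * rf 1 (rf 2 (rr 1))"
  proof -
    define y' where "y' = y * (x - A) / (A * x - 1)"
    define z w where "z = A * x - 1" and "w = x - A"
    have nz': "z \<noteq> 0" "1 / A * (A * B) = B" and y': "y' * z = y * w"
      using nz by (simp_all add: z_def w_def y'_def)
    have "(B * (x * (A * B * y' - 1)) - (y' - A * B)) * z = B * (x * (A * B * (y' * z) - z)) - (y' * z - A * B * z)"
      by (simp add: algebra_simps)
    also have "\<dots> = w * (A * B * (x * (B * y - 1)) - (y - B))"
      unfolding y' unfolding z_def w_def by (simp add: algebra_simps)
    finally have c1: "1 / A * (A * B) * (x * (A * B * y' - 1)) - (y' - A * B) =
        (x - A) / (A * x - 1) * (A * B * (x * (B * y - 1)) - (y - B))"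
      using nz' by (simp add: eq_divide_eq flip: z_def w_def)
    have "z * (x * (A * B * y' - 1) - B * (y' - A * B)) = x * (A * B * (y' * z) - z) - B * (y' * z - A * B * z)"
      by (simp add: algebra_simps)
    also have "\<dots> = z * (x * (B * y - 1) - A * B * (y - B))"
      unfolding y' unfolding z_def w_def by (simp add: algebra_simps)
    finally have c2: "x * (A * B * y' - 1) - 1 / A * (A * B) * (y' - A * B) = x * (B * y - 1) - A * B * (y - B)"
      using nz' by simp
    have "rf 1 (rf 2 (rr 1)) = (1 / A * (A * B) * (x * (A * B * y' - 1)) - (y' - A * B)) /
        (x * (A * B * y' - 1) - 1 / A * (A * B) * (y' - A * B))"
      unfolding e2 by (simp only: hs im y'_def)
    then show ?thesis unfolding c1 c2 unfolding e2 unfolding r using nz by simp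
  qed
  fix i assume i: "i \<in> {1..2*N}"
  consider "i = 1" | "i = 2" | "i = 3" | "i > 3" using i by force
  then show "rf 1 (rf 2 (rf 1 (ff i))) = rf 2 (rf 1 (rf 2 (ff i)))"
  proof cases
    case 1
    then show ?thesis using i1 by (simp add: rf_ff[OF j(1) j(1)] rf_ff[OF j(2) j(1)] hs)
  next
    case 2
    then show ?thesis using i2 by (simp add: rf_ff[OF j(1) j(2)] rf_ff[OF j(2) j(2)] hs)
  next
    case 3
    have "rr 2 \<noteq> 0" using rr_nonzero[OF j(2)] .
    then have "1 / rf 1 (rr 2) = 1 / rr 2 / rf 2 (rf 1 (rr 2))" by (subst i1) simp
    then show ?thesis using 3 i by (simp add: rf_ff[OF j(1)] rf_ff[OF j(2)] hs)
  qed (simp add: rf_ff[OF j(1) i] rf_ff[OF j(2) i])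
qed

lemma rv_refl_par: "rv (refl_par j k) = 1 / refl_par (- j) (- k)"
proof -
  have neg: "cong_M (- k) (- l) \<longleftrightarrow> cong_M k l" for k l by (rule cong_minus_minus_iff)
  show ?thesis
    using neg[of k j] neg[of k "j + 1"] neg[of k "j - 1"]
    by (auto simp: refl_par_def hom_simps rv_simps power2_eq_square)
qed

text \<open>Two effects compensate: the reversal inverts the parameters and with them
  \<open>rr\<close>, and it exchanges the left and the right neighbour.\<close>

lemma rv_rf:
  assumes j: "j \<in> {1..2*N}"
  shows "rv (rf j x) = rf (2 * N + 1 - j) (rv x)"
proof (rule rf_eqI[of "\<lambda>x. rv (rf j x)" "\<lambda>x. rf (2 * N + 1 - j) (rv x)"])
  let ?j = "2 * N + 1 - j"
  have j': "?j \<in> {1..2*N}" using j by auto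
  note h = coord_hom_rf[OF j] coord_hom_rf[OF j']
  show "coord_hom (\<lambda>x. rv (rf j x))" "coord_hom (\<lambda>x. rf ?j (rv x))"
    by (rule coord_hom_comp[OF coord_hom_rv h(1)], rule coord_hom_comp[OF h(2) coord_hom_rv])
  note hs = rf_simps[OF j] rf_simps[OF j'] hom_simps[OF coord_hom_field_hom[OF h(1)]]
    hom_simps[OF coord_hom_field_hom[OF h(2)]] rv_simps
  show "rv (rf j b_par) = rf ?j (rv b_par)" "rv (rf j c_par) = rf ?j (rv c_par)"
    "rv (rf j q_par) = rf ?j (rv q_par)" by (simp_all add: hs)
  have c: "cong_M (- int j) (int ?j)"
  proof -
    have "int ?j = - int j + (2 * int N + 1)" using j by (simp add: of_nat_diff)
    then show ?thesis by (simp add: cong_def)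
  qed
  have "refl_par (- int j) (- k) = refl_par (int ?j) (- k)" for k
    by (rule refl_par_cong[OF c]) simp
  then show "rv (rf j (aa k)) = rf ?j (rv (aa k))" for k
    by (simp only: hs rv_refl_par)
  have A: "AA (- int j) = AA (int ?j)" by (rule AA_cong[OF c])
  have rr: "rv (rr j) = 1 / rr ?j"
  proof -
    define x y where "x = AA (int ?j)" and "y = ff ?j"
    have nz: "x \<noteq> 0" "x * y - 1 \<noteq> 0" "y - x \<noteq> 0"
      using AA_ff_minus_1[OF j'] ff_minus_AA[OF j'] by (simp_all add: x_def y_def)
    have "rv (rr j) = (1 / x * y - 1) / (y - 1 / x)"
      unfolding rr_def x_def y_def by (simp only: hom_simps[OF coord_hom_field_hom[OF coord_hom_rv]] rv_AA A rv_ff[OF j])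
    also have "\<dots> = (y - x) / (x * y - 1)"
    proof -
      have "1 / x * y - 1 = (y - x) / x" "y - 1 / x = (x * y - 1) / x" using nz by (simp_all add: field_simps)
      then show ?thesis using nz by simp
    qed
    finally show ?thesis by (simp add: rr_def x_def y_def)
  qed
  fix i assume i: "i \<in> {1..2*N}"
  then have i': "2 * N + 1 - i \<in> {1..2*N}" by auto
  have "2 * N + 1 - i + 1 = ?j \<longleftrightarrow> i = j + 1" "2 * N + 1 - i = ?j + 1 \<longleftrightarrow> i + 1 = j"
    using i j by auto
  then show "rv (rf j (ff i)) = rf ?j (rv (ff i))"
    unfolding rv_ff[OF i] rf_ff[OF j i] rf_ff[OF j' i'] by (simp add: hom_simps rr rv_ff[OF i])
qed

end

context
  notes One_nat_def [simp del]
begin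

section \<open>The reflection \<open>\<mu>\<^sub>0\<close>\<close>

definition ph :: "nat \<Rightarrow> ratfun" where
  "ph i = (if even i then ff i else 1 / ff i)"

definition tt :: "nat \<Rightarrow> ratfun" where
  "tt i = (\<Prod>k=1..<i. - ph k / AA (int k))"

text \<open>Equal to \<open>(c_par\<^sup>2 * q_par ^ (2 * N + 1)) ^ (2 * N - 1)\<close>, so that
  sending \<open>c_par\<close> to \<open>1 / (c_par * q_par ^ (2 * N + 1))\<close> inverts
  it.\<close>

definition rho :: ratfun where
  "rho = c_par ^ (2 * (2 * N - 1)) * q_par ^ ((2 * N - 1) * (2 * N + 1))"

text \<open>
  \<open>HH i / (1 - rho)\<close> is the sequence with differences \<open>tt i\<close> that is multiplied by \<open>rho\<close> over a period;
  \<open>\<mu>\<^sub>0\<close> inverts it up to a common factor.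
\<close>

definition HH :: "nat \<Rightarrow> ratfun" where
  "HH i = (\<Sum>j=i..2*N+1. tt j) + rho * (\<Sum>j=1..<i. tt j)"

text \<open>In terms of \<open>ph\<close> both parities follow one rule: \<open>ph i\<close> goes to
  \<open>ph i * HH i / HH (i + 2)\<close>. It sends the increment \<open>tt i\<close> to a constant
  multiple of \<open>tt i / (HH i * HH (i + 1))\<close>, which is proportional to the increment of
  \<open>1 / HH\<close>.\<close>

definition mu_map :: "nat \<Rightarrow> ratfun" where
  "mu_map = coord_map indet b_par (1 / (c_par * q_par ^ (2 * N + 1))) q_par a_par
     (\<lambda>i. if even i then ff i * HH i / HH (i + 2) else ff i * HH (i + 2) / HH i)"

lemma tt_1 [simp]: "tt 1 = 1"
  by (simp add: tt_def)

lemma tt_Suc: "1 \<le> i \<Longrightarrow> tt (Suc i) = tt i * (- ph i / AA (int i))"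
  by (simp add: tt_def)

lemma ph_nonzero [simp]: "ph i \<noteq> 0"
  by (simp add: ph_def)

lemma tt_nonzero [simp]: "tt i \<noteq> 0"
  by (simp add: tt_def)

lemma rho_nonzero [simp]: "rho \<noteq> 0"
  by (simp add: rho_def)

lemma HH_Suc: "i \<in> {1..2*N+1} \<Longrightarrow> HH (Suc i) = HH i - (1 - rho) * tt i"
proof -
  assume i: "i \<in> {1..2*N+1}"
  then have "(\<Sum>j=i..2*N+1. tt j) = tt i + (\<Sum>j=Suc i..2*N+1. tt j)"
    by (intro sum.atLeast_Suc_atMost) simp
  with i show ?thesis by (simp add: HH_def algebra_simps)
qed

lemma HH_last: "HH (2 * N + 2) = rho * HH 1"
proof -
  have "{1..<2*N+2} = {1..2*N+1}" by auto
  then show ?thesis by (simp add: HH_def)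
qed

lemma HH_nonzero: "i \<in> {1..2*N+2} \<Longrightarrow> HH i \<noteq> 0"
proof -
  assume i: "i \<in> {1..2*N+2}"
  \<comment> \<open>At this point every factor \<open>- ph k / AA (int k)\<close> takes the value 1,
    and so does \<open>rho\<close>; each of the 2N+1 summands is then 1.\<close>
  let ?v = "coord_map (\<lambda>_. 1) 1 1 1 (\<lambda>_. 1) (\<lambda>_. - 1)"
  note e = eval_coord_map[where D = "\<lambda>_. 1" and B = 1 and C = 1 and Q = 1 and A = "\<lambda>_. 1" and G = "\<lambda>_. - 1"]
  have "rat_eval ?v (- ph k / AA (int k)) 1" if "k \<in> {1..2*N}" for k
  proof -
    have f: "rat_eval ?v (ff k) (- 1)" using e(5) that by simp
    have "rat_eval ?v (1 / ff k) (1 / - 1)"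
      by (intro rat_eval_divide rat_eval_1 f) simp
    with f have p: "rat_eval ?v (ph k) (- 1)" by (simp add: ph_def)
    have "rat_eval ?v (aa (int k)) 1" using e(4)[OF that] that by (simp add: aa_a_par)
    then have a: "rat_eval ?v (AA (int k)) (1 ^ (2 * N + 1))"
      unfolding AA_def by (rule rat_eval_power)
    have "rat_eval ?v (- ph k / AA (int k)) (- (- 1) / 1 ^ (2 * N + 1))"
      by (intro rat_eval_divide rat_eval_uminus p a) simp
    then show ?thesis by simp
  qed
  then have "rat_eval ?v (tt j) (\<Prod>k=1..<j. 1)" if "j \<le> 2 * N + 1" for j
    unfolding tt_def using that by (intro rat_eval_prod) simp
  then have t: "rat_eval ?v (tt j) 1" if "j \<le> 2 * N + 1" for j
    using that by simp
  have "rat_eval ?v rho (1 ^ (2 * (2 * N - 1)) * 1 ^ ((2 * N - 1) * (2 * N + 1)))"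
    unfolding rho_def by (intro rat_eval_mult rat_eval_power e)
  then have r: "rat_eval ?v rho 1" by simp
  have "rat_eval ?v (HH i) ((\<Sum>j=i..2*N+1. 1) + 1 * (\<Sum>j=1..<i. 1))"
    unfolding HH_def using i by (intro rat_eval_add rat_eval_mult rat_eval_sum r t) auto
  moreover have "(\<Sum>j=i..2*N+1. 1) + 1 * (\<Sum>j=1..<i. 1) = (of_nat (2 * N + 1) :: ratfun)"
    using i by (simp add: of_nat_diff)
  ultimately show ?thesis
    using rat_eval_nonzero[of ?v "HH i" "of_nat (2 * N + 1)"] ratfun_of_nat_eq_0_iff[of "2 * N + 1"] by simp
qed

lemma one_minus_rho: "1 - rho \<noteq> 0"
proof -
  \<comment> \<open>With \<open>c_par\<close> equal to 2 and all else 1, \<open>rho\<close> becomes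
    a power of 2 with positive exponent.\<close>
  let ?v = "coord_map (\<lambda>_. 1) 1 2 1 (\<lambda>_. 1) (\<lambda>_. 1)"
  note e = eval_coord_map[where D = "\<lambda>_. 1" and B = 1 and C = 2 and Q = 1 and A = "\<lambda>_. 1" and G = "\<lambda>_. 1"]
  let ?k = "2 * (2 * N - 1)"
  have "rat_eval ?v (1 - rho) (1 - 2 ^ ?k * 1 ^ ((2 * N - 1) * (2 * N + 1)))"
    unfolding rho_def by (intro rat_eval_mult rat_eval_power rat_eval_diff rat_eval_1 e)
  moreover have "1 - 2 ^ ?k * 1 ^ ((2 * N - 1) * (2 * N + 1)) = - (of_nat (2 ^ ?k - 1) :: ratfun)"
    by (simp add: of_nat_diff)
  moreover have "(2::nat) ^ ?k - 1 \<noteq> 0"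
  proof -
    have "1 < (2::nat) ^ ?k" by (rule one_less_power) (use N_pos in auto)
    then show ?thesis by simp
  qed
  ultimately show ?thesis
    using rat_eval_nonzero[of ?v "1 - rho"] ratfun_of_nat_eq_0_iff[of "2 ^ ?k - 1"] by (metis neg_equal_0_iff_equal)
qed

text \<open>By \<open>HH_Suc\<close>, each summand multiplied by \<open>1 - rho\<close> is a
  difference of consecutive reciprocals of \<open>HH\<close>.\<close>

lemma sum_tt_telescope:
  "n \<le> 2 * N + 1 \<Longrightarrow> (1 - rho) * (\<Sum>j=1..n. tt j / (HH j * HH (Suc j))) = 1 / HH (Suc n) - 1 / HH 1"
proof (induction n)
  case (Suc n)
  have nz: "HH (Suc n) \<noteq> 0" "HH (Suc (Suc n)) \<noteq> 0"
    using Suc.prems by (auto intro!: HH_nonzero)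
  have "(1 - rho) * tt (Suc n) = HH (Suc n) - HH (Suc (Suc n))"
    using HH_Suc[of "Suc n"] Suc.prems by simp
  then have "(1 - rho) * (tt (Suc n) / (HH (Suc n) * HH (Suc (Suc n)))) = 1 / HH (Suc (Suc n)) - 1 / HH (Suc n)"
    using nz by (simp add: field_simps)
  moreover have "(\<Sum>j=1..Suc n. tt j / (HH j * HH (Suc j))) =
      (\<Sum>j=1..n. tt j / (HH j * HH (Suc j))) + tt (Suc n) / (HH (Suc n) * HH (Suc (Suc n)))"
    by simp
  ultimately show ?case
    using Suc by (simp only: distrib_left) simp
qed (simp add: One_nat_def)

lemma eval_mu_map:
  "rat_eval mu_map b_par b_par" "rat_eval mu_map c_par (1 / (c_par * q_par ^ (2 * N + 1)))"
  "rat_eval mu_map q_par q_par" "rat_eval mu_map (aa k) (aa k)"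
  "i \<in> {1..2*N} \<Longrightarrow> rat_eval mu_map (ff i)
     (if even i then ff i * HH i / HH (i + 2) else ff i * HH (i + 2) / HH i)"
  "rat_eval mu_map rho (1 / rho)"
  "i \<in> {1..2*N+2} \<Longrightarrow> rat_eval mu_map (HH i) (HH 1 * HH 2 / (rho * HH i))"
proof -
  note e = eval_coord_map[where D = indet and B = b_par and C = "1 / (c_par * q_par ^ (2 * N + 1))"
    and Q = q_par and A = a_par
    and G = "\<lambda>i. if even i then ff i * HH i / HH (i + 2) else ff i * HH (i + 2) / HH i", folded mu_map_def]
  show "rat_eval mu_map b_par b_par" and c: "rat_eval mu_map c_par (1 / (c_par * q_par ^ (2 * N + 1)))"
    and q: "rat_eval mu_map q_par q_par"
    using e by simp_all
  show f: "rat_eval mu_map (ff i) (if even i then ff i * HH i / HH (i + 2) else ff i * HH (i + 2) / HH i)"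
    if "i \<in> {1..2*N}" for i
    using e(5) that by simp
  show a: "rat_eval mu_map (aa k) (aa k)" for k
    by (rule eval_aa[where T = aa]) (use q e(4) aa_prod[of 0] in \<open>auto simp: aa_a_par aa_mod\<close>)
  have "rat_eval mu_map rho ((1 / (c_par * q_par ^ (2 * N + 1))) ^ (2 * (2 * N - 1)) * q_par ^ ((2 * N - 1) * (2 * N + 1)))"
    unfolding rho_def by (intro rat_eval_mult rat_eval_power c q)
  moreover have "(1 / (c_par * q_par ^ (2 * N + 1))) ^ (2 * (2 * N - 1)) * q_par ^ ((2 * N - 1) * (2 * N + 1)) = 1 / rho"
  proof -
    define x where "x = q_par ^ ((2 * N - 1) * (2 * N + 1))"
    have "(q_par ^ (2 * N + 1)) ^ (2 * (2 * N - 1)) = x * x"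
    proof -
      have "(q_par ^ (2 * N + 1)) ^ (2 * l) = q_par ^ (l * (2 * N + 1)) * q_par ^ (l * (2 * N + 1))" for l
        by (simp add: algebra_simps flip: power_mult power_add)
      then show ?thesis unfolding x_def .
    qed
    moreover have "x \<noteq> 0" by (simp add: x_def)
    ultimately show ?thesis
      unfolding rho_def x_def[symmetric] by (simp add: power_divide power_mult_distrib)
  qed
  ultimately show r: "rat_eval mu_map rho (1 / rho)" by simp
  have nz: "HH i \<noteq> 0" "HH (Suc i) \<noteq> 0" "HH (i + 2) \<noteq> 0" if "i \<in> {1..2*N}" for i
    using that by (auto intro!: HH_nonzero)
  have nz1: "HH 1 \<noteq> 0" "HH 2 \<noteq> 0" by (auto intro!: HH_nonzero)
  have p: "rat_eval mu_map (ph i) (ph i * HH i / HH (i + 2))" if "i \<in> {1..2*N}" for i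
  proof (cases "even i")
    case False
    have "rat_eval mu_map (1 / ff i) (1 / (if even i then ff i * HH i / HH (i + 2) else ff i * HH (i + 2) / HH i))"
      using nz[OF that] by (intro rat_eval_divide rat_eval_1 f that) auto
    then show ?thesis using False by (simp add: ph_def)
  qed (use f[OF that] in \<open>simp add: ph_def\<close>)
  have A: "rat_eval mu_map (AA k) (AA k)" for k
    unfolding AA_def by (intro rat_eval_power a)
  have t: "rat_eval mu_map (tt i) (tt i * HH 1 * HH 2 / (HH i * HH (Suc i)))" if "1 \<le> i" "i \<le> 2 * N + 1" for i
    using that
  proof (induction i rule: dec_induct)
    case base
    have "Suc 1 = 2" by simp
    then show ?case using nz1 rat_eval_1 by simp
  next
    case (step i)
    then have i: "i \<in> {1..2*N}" by simp
    have "rat_eval mu_map (tt (Suc i)) (tt i * HH 1 * HH 2 / (HH i * HH (Suc i)) * (- (ph i * HH i / HH (i + 2)) / AA (int i)))"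
      unfolding tt_Suc[OF step(1)] using step i by (intro rat_eval_mult rat_eval_divide rat_eval_uminus p A) auto
    then show ?case
      using nz[OF i] by (simp add: tt_Suc[OF step(1)] ac_simps)
  qed
  \<comment> \<open>The new increments telescope over the period; the end values \<open>HH 1\<close>
    and \<open>rho * HH 1\<close> leave a factor \<open>1 - rho\<close>, which cancels.\<close>
  have H1: "rat_eval mu_map (HH 1) (HH 1 * HH 2 / (rho * HH 1))"
  proof -
    have "HH 1 = (\<Sum>j=1..2*N+1. tt j)" by (simp add: HH_def)
    moreover have "rat_eval mu_map (\<Sum>j=1..2*N+1. tt j) (\<Sum>j=1..2*N+1. tt j * HH 1 * HH 2 / (HH j * HH (Suc j)))"
      by (intro rat_eval_sum t) auto
    moreover have "(\<Sum>j=1..2*N+1. tt j * HH 1 * HH 2 / (HH j * HH (Suc j))) =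
        HH 1 * HH 2 * (\<Sum>j=1..2*N+1. tt j / (HH j * HH (Suc j)))"
      by (simp add: sum_distrib_left ac_simps)
    moreover have "(\<Sum>j=1..2*N+1. tt j / (HH j * HH (Suc j))) = 1 / (rho * HH 1)"
    proof -
      have "Suc (2 * N + 1) = 2 * N + 2" by simp
      then have "HH (Suc (2 * N + 1)) = rho * HH 1" by (simp only: HH_last)
      then have "(1 - rho) * (\<Sum>j=1..2*N+1. tt j / (HH j * HH (Suc j))) = 1 / (rho * HH 1) - 1 / HH 1"
        using sum_tt_telescope[of "2 * N + 1"] by (simp only: order_refl simp_thms)
      also have "\<dots> = (1 - rho) * (1 / (rho * HH 1))" using nz1 by (simp add: field_simps)
      finally show ?thesis unfolding mult_cancel_left using one_minus_rho by blast
    qed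
    ultimately show ?thesis by simp
  qed
  show "rat_eval mu_map (HH i) (HH 1 * HH 2 / (rho * HH i))" if "i \<in> {1..2*N+2}"
  proof -
    have "1 \<le> i" "i \<le> 2 * N + 2" using that by simp_all
    then show ?thesis
    proof (induction i rule: dec_induct)
      case base show ?case by (rule H1)
    next
      case (step i)
      then have i: "i \<in> {1..2*N+1}" by simp
      have nz: "HH i \<noteq> 0" "HH (Suc i) \<noteq> 0" using i by (auto intro!: HH_nonzero)
      have "rat_eval mu_map (HH i - (1 - rho) * tt i) (HH 1 * HH 2 / (rho * HH i) -
          (1 - 1 / rho) * (tt i * HH 1 * HH 2 / (HH i * HH (Suc i))))"
        using step i by (intro rat_eval_diff rat_eval_mult rat_eval_1 r t) auto
      then have "rat_eval mu_map (HH (Suc i)) (HH 1 * HH 2 / (rho * HH i) -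
          (1 - 1 / rho) * (tt i * HH 1 * HH 2 / (HH i * HH (Suc i))))"
        by (simp only: HH_Suc[OF i])
      moreover have "HH 1 * HH 2 / (rho * HH i) - (1 - 1 / rho) * (tt i * HH 1 * HH 2 / (HH i * HH (Suc i))) =
          HH 1 * HH 2 * (HH (Suc i) + (1 - rho) * tt i) / (rho * HH i * HH (Suc i))"
        using nz by (simp add: field_simps)
      moreover have "HH (Suc i) + (1 - rho) * tt i = HH i" using HH_Suc[OF i] by simp
      ultimately show ?case using nz by simp
    qed
  qed
qed

lemma mu_mu_map: "rat_eval mu_map (mu_map n) (indet n)"
proof -
  note e = eval_mu_map
  have "rat_eval mu_map (coord_map indet b_par (1 / (c_par * q_par ^ (2 * N + 1))) q_par a_par
     (\<lambda>i. if even i then ff i * HH i / HH (i + 2) else ff i * HH (i + 2) / HH i) n) (indet n)"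
  proof (rule coord_map_inverse)
    have "rat_eval mu_map (1 / (c_par * q_par ^ (2 * N + 1))) (1 / (1 / (c_par * q_par ^ (2 * N + 1)) * q_par ^ (2 * N + 1)))"
      by (intro rat_eval_divide rat_eval_1 rat_eval_mult rat_eval_power e) simp
    then show "rat_eval mu_map (1 / (c_par * q_par ^ (2 * N + 1))) c_par" by simp
    fix i assume i: "i \<in> {1..2*N}"
    show "rat_eval mu_map (a_par i) (a_par i)"
      using e(4)[of "int i"] i by (simp add: aa_a_par)
    have i': "i \<in> {1..2*N+2}" "i + 2 \<in> {1..2*N+2}" using i by auto
    have nz: "HH i \<noteq> 0" "HH (i + 2) \<noteq> 0" "HH 1 \<noteq> 0" "HH 2 \<noteq> 0" using i' by (auto intro!: HH_nonzero)
    show "rat_eval mu_map (if even i then ff i * HH i / HH (i + 2) else ff i * HH (i + 2) / HH i) (ff i)"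
    proof (cases "even i")
      case True
      have "rat_eval mu_map (ff i * HH i / HH (i + 2))
         ((ff i * HH i / HH (i + 2)) * (HH 1 * HH 2 / (rho * HH i)) / (HH 1 * HH 2 / (rho * HH (i + 2))))"
        using e(5)[OF i] True nz by (intro rat_eval_divide rat_eval_mult e(7) i') auto
      then show ?thesis using True nz by simp
    next
      case False
      have "rat_eval mu_map (ff i * HH (i + 2) / HH i)
         ((ff i * HH (i + 2) / HH i) * (HH 1 * HH 2 / (rho * HH (i + 2))) / (HH 1 * HH 2 / (rho * HH i)))"
        using e(5)[OF i] False nz by (intro rat_eval_divide rat_eval_mult e(7) i') auto
      then show ?thesis using False nz by simp
    qed
  qed (use e in \<open>simp_all add: mu_map_def coord_map_simps\<close>)
  then show ?thesis by (simp add: mu_map_def)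
qed

definition mu :: "ratfun \<Rightarrow> ratfun" where "mu = subst mu_map"

lemma mu_mu [simp]: "mu (mu x) = x"
  unfolding mu_def by (rule subst_inverse, rule mu_mu_map, rule mu_mu_map)

lemma coord_hom_mu [simp]: "coord_hom mu"
  using coord_hom_subst[OF mu_mu_map[unfolded mu_map_def]] by (simp add: mu_def mu_map_def)

lemmas mu_simps = eval_mu_map(1-4,6)[THEN subst_eval[OF mu_mu_map], folded mu_def]
lemmas mu_ff = eval_mu_map(5)[THEN subst_eval[OF mu_mu_map], folded mu_def]

lemma mu_AA: "mu (AA k) = AA k"
  by (simp only: AA_def hom_power[OF coord_hom_field_hom] coord_hom_mu mu_simps)

lemma mu_KK: "mu KK = KK"
  by (simp add: KK_eq hom_simps mu_simps)

lemma mu_c_power: "(1 / (c_par * q_par ^ (2 * N + 1))) ^ (2 * N - 1) = c_par ^ (2 * N - 1) / rho"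
proof -
  define x y where "x = c_par ^ (2 * N - 1)" and "y = q_par ^ ((2 * N - 1) * (2 * N + 1))"
  have "(q_par ^ (2 * N + 1)) ^ (2 * N - 1) = y" unfolding y_def by (simp add: ac_simps flip: power_mult)
  moreover have "c_par ^ (2 * (2 * N - 1)) = x * x"
    unfolding x_def by (simp flip: power_add add: mult_2)
  moreover have "x \<noteq> 0" "y \<noteq> 0" by (simp_all add: x_def y_def)
  ultimately show ?thesis
    unfolding rho_def x_def[symmetric] y_def[symmetric]
    by (simp add: power_divide power_mult_distrib x_def[symmetric])
qed

text \<open>Over the odd indices the quotients of \<open>HH\<close> telescope from 1 to 2N+1; the
  \<open>rho\<close> comes from the power of \<open>c_par\<close>.\<close>

lemma mu_XX: "mu XX = XX * HH (2 * N + 1) / (HH 1 * rho)"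
proof -
  have "(\<Prod>k=1..N. mu (ff (2 * k - 1))) = (\<Prod>k=1..N. ff (2 * k - 1) * (HH (2 * (k + 1) - 1) / HH (2 * k - 1)))"
  proof (rule prod.cong)
    fix k assume k: "k \<in> {1..N}"
    then have "2 * k - 1 + 2 = 2 * (k + 1) - 1" "odd (2 * k - 1)" by auto
    then show "mu (ff (2 * k - 1)) = ff (2 * k - 1) * (HH (2 * (k + 1) - 1) / HH (2 * k - 1))"
      using mu_ff[OF odd_in_range[OF k]] by simp
  qed simp
  also have "\<dots> = (\<Prod>k=1..N. ff (2 * k - 1)) * (\<Prod>k=1..N. HH (2 * (k + 1) - 1) / HH (2 * k - 1))"
    by (rule prod.distrib)
  also have "(\<Prod>k=1..N. HH (2 * (k + 1) - 1) / HH (2 * k - 1)) = HH (2 * (N + 1) - 1) / HH (2 * 1 - 1)"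
    by (rule prod_telescope[of N "\<lambda>k. HH (2 * k - 1)"]) (auto intro!: HH_nonzero)
  finally have O: "(\<Prod>k=1..N. mu (ff (2 * k - 1))) = (\<Prod>k=1..N. ff (2 * k - 1)) * (HH (2 * N + 1) / HH 1)"
    by (simp add: One_nat_def)
  have "mu XX = (1 / (c_par * q_par ^ (2 * N + 1))) ^ (2 * N - 1) * (\<Prod>k=1..N. mu (ff (2 * k - 1))) / (b_par * KK)"
    unfolding XX_def by (simp add: hom_simps mu_simps mu_KK)
  then show ?thesis unfolding O mu_c_power by (simp add: XX_def ac_simps)
qed

text \<open>Over the even indices the quotients telescope from 2 to 2N+2, and the \<open>rho\<close>
  supplied by \<open>HH_last\<close> cancels the one from the power of \<open>c_par\<close>.\<close>

lemma mu_YY: "mu YY = YY * HH 2 / HH 1"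
proof -
  have nz: "HH 1 \<noteq> 0" by (auto intro!: HH_nonzero)
  have "(\<Prod>k=1..N. mu (ff (2 * k))) = (\<Prod>k=1..N. ff (2 * k) / (HH (2 * (k + 1)) / HH (2 * k)))"
  proof (rule prod.cong)
    fix k assume k: "k \<in> {1..N}"
    then have "2 * k \<in> {1..2*N}" "HH (2 * k) \<noteq> 0" by (auto intro!: HH_nonzero)
    then show "mu (ff (2 * k)) = ff (2 * k) / (HH (2 * (k + 1)) / HH (2 * k))"
      using mu_ff[of "2 * k"] by simp
  qed simp
  also have "\<dots> = (\<Prod>k=1..N. ff (2 * k)) / (\<Prod>k=1..N. HH (2 * (k + 1)) / HH (2 * k))"
    by (rule prod_dividef)
  also have "(\<Prod>k=1..N. HH (2 * (k + 1)) / HH (2 * k)) = HH (2 * (N + 1)) / HH (2 * 1)"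
    by (rule prod_telescope[of N "\<lambda>k. HH (2 * k)"]) (auto intro!: HH_nonzero)
  also have "2 * (N + 1) = 2 * N + 2" by simp
  finally have E: "(\<Prod>k=1..N. mu (ff (2 * k))) = (\<Prod>k=1..N. ff (2 * k)) * HH 2 / (rho * HH 1)"
    unfolding HH_last by simp
  have "mu YY = (\<Prod>k=1..N. mu (ff (2 * k))) / ((1 / (c_par * q_par ^ (2 * N + 1))) ^ (2 * N - 1) * AA 0 * b_par * KK)"
    unfolding YY_def by (simp add: hom_simps mu_simps mu_KK mu_AA)
  then show ?thesis unfolding E mu_c_power using nz by (simp add: YY_def)
qed

end

context
  notes One_nat_def [simp del]
begin

section \<open>Commutation of \<mu>_0 with the reversal, with s_1 and with the square of the
  shift\<close>

lemma tt_2: "tt 2 = - 1 / (AA 1 * ff 1)"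
  using tt_Suc[of 1] by (simp add: ph_def mult.commute)

lemma HH_2: "HH 2 = HH 1 - (1 - rho)"
  using HH_Suc[of 1] by simp

lemma HH_3: "HH 3 = HH 1 - (1 - rho) * (1 + tt 2)"
  using HH_Suc[of 2] N_pos by (simp add: HH_2 algebra_simps)

text \<open>Read backwards, the increments and hence \<open>HH\<close> reproduce themselves up to
  common factors, which cancel in the quotients defining \<open>mu\<close>. The exchange of
  \<open>HH i\<close> with \<open>HH (i + 2)\<close> matches the change of parity of the
  index.\<close>

lemma mu_rv: "mu (rv x) = rv (mu x)"
proof (rule rf_eqI[of "\<lambda>x. mu (rv x)" "\<lambda>x. rv (mu x)"])
  note hs = hom_simps[OF coord_hom_field_hom[OF coord_hom_mu]] hom_simps[OF coord_hom_field_hom[OF coord_hom_rv]]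
    mu_simps rv_simps
  show "coord_hom (\<lambda>x. mu (rv x))" "coord_hom (\<lambda>x. rv (mu x))"
    by (rule coord_hom_comp[OF coord_hom_mu coord_hom_rv], rule coord_hom_comp[OF coord_hom_rv coord_hom_mu])
  show "mu (rv b_par) = rv (mu b_par)" "mu (rv c_par) = rv (mu c_par)" "mu (rv q_par) = rv (mu q_par)"
    "mu (rv (aa k)) = rv (mu (aa k))" for k
    by (simp_all add: hs power_one_over)
  have AA_neg: "AA (- int i) = AA (int (2 * N + 1 - i))" if "i \<in> {1..2*N}" for i
    using that AA_add_period[of "- int i"] by (simp add: of_nat_diff algebra_simps)
  have p: "- rv (ph i) / rv (AA (int i)) = - AA (int (2 * N + 1 - i)) / ph (2 * N + 1 - i)"
    if i: "i \<in> {1..2*N}" for i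
  proof -
    have "even (2 * N + 1 - i) \<longleftrightarrow> odd i" using i by auto
    then show ?thesis by (simp add: ph_def hs rv_ff[OF i] rv_AA AA_neg[OF i])
  qed
  have t: "rv (tt i) = tt (2 * N + 2 - i) / tt (2 * N + 1)" if "1 \<le> i" "i \<le> 2 * N + 1" for i
    using that
  proof (induction i rule: dec_induct)
    case base
    have "2 * N + 2 - 1 = 2 * N + 1" by simp
    then show ?case by (simp only: tt_1 hs) simp
  next
    case (step i)
    then have i: "i \<in> {1..2*N}" by simp
    define j where "j = 2 * N + 1 - i"
    have j: "2 * N + 2 - i = Suc j" "2 * N + 2 - Suc i = j" "1 \<le> j" using i by (auto simp: j_def)
    have IH: "rv (tt i) = tt (Suc j) / tt (2 * N + 1)" using step i unfolding j(1) by simp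
    have "rv (tt (Suc i)) = rv (tt i) * (- rv (ph i) / rv (AA (int i)))"
      unfolding tt_Suc[OF step(1)] by (simp only: hs)
    also have "\<dots> = tt j * (- ph j / AA (int j)) / tt (2 * N + 1) * (- AA (int j) / ph j)"
      unfolding IH p[OF i] j_def[symmetric] tt_Suc[OF j(3)] ..
    also have "\<dots> = tt j / tt (2 * N + 1)" by simp
    finally show ?case unfolding j .
  qed
  have r: "rv rho = 1 / rho"
    unfolding rho_def by (simp add: hs power_one_over)
  have H: "rv (HH i) = HH (2 * N + 3 - i) / (rho * tt (2 * N + 1))" if "1 \<le> i" "i \<le> 2 * N + 2" for i
    using that
  proof (induction i rule: dec_induct)
    case base
    have "rv (HH 1) = (\<Sum>j=1..2*N+1. tt (2 * N + 2 - j)) / tt (2 * N + 1)"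
      by (simp add: HH_def hs t sum_divide_distrib)
    also have "(\<Sum>j=1..2*N+1. tt (2 * N + 2 - j)) = HH 1"
      using sum.atLeastAtMost_rev[of tt 1 "2 * N + 1"] by (simp add: HH_def)
    finally have "rv (HH 1) = HH 1 / tt (2 * N + 1)" .
    moreover have "2 * N + 3 - 1 = 2 * N + 2" by simp
    ultimately show ?case by (simp only: HH_last) simp
  next
    case (step i)
    then have i: "i \<in> {1..2*N+1}" by simp
    define j where "j = 2 * N + 2 - i"
    have j: "2 * N + 3 - i = Suc j" "2 * N + 3 - Suc i = j" "j \<in> {1..2*N+1}" using i by (auto simp: j_def)
    have "rv (HH (Suc i)) = HH (Suc j) / (rho * tt (2 * N + 1)) - (1 - 1 / rho) * (tt j / tt (2 * N + 1))"
    proof -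
      have "rv (HH i) = HH (Suc j) / (rho * tt (2 * N + 1))" using step unfolding j(1) by simp
      moreover have "rv (tt i) = tt j / tt (2 * N + 1)" using t[of i] i by (simp add: j_def)
      ultimately show ?thesis by (simp only: HH_Suc[OF i] hs r)
    qed
    also have "\<dots> = HH j / (rho * tt (2 * N + 1))"
      unfolding HH_Suc[OF j(3)] by (simp add: field_simps)
    finally show ?case by (simp add: j)
  qed
  fix i assume i: "i \<in> {1..2*N}"
  define j where "j = 2 * N + 1 - i"
  have j: "j \<in> {1..2*N}" "2 * N + 3 - i = j + 2" "2 * N + 3 - (i + 2) = j" "even j \<longleftrightarrow> odd i"
    using i by (auto simp: j_def)
  have "rv (HH i) = HH (j + 2) / (rho * tt (2 * N + 1))" "rv (HH (i + 2)) = HH j / (rho * tt (2 * N + 1))"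
    using H[of i] H[of "i + 2"] i j by simp_all
  then show "mu (rv (ff i)) = rv (mu (ff i))"
    unfolding rv_ff[OF i] mu_ff[OF i] j_def[symmetric] mu_ff[OF j(1)]
    using j(4) by (simp add: hs rv_ff[OF i] flip: j_def)
qed

text \<open>\<open>rf 1\<close> multiplies every \<open>HH i\<close> except \<open>HH 2\<close> by
  one factor \<open>la\<close>. The substantial case is therefore \<open>ff 2\<close>, whose image
  under \<open>mu\<close> involves \<open>HH 2\<close>.\<close>

lemma mu_rf1: "mu (rf 1 x) = rf 1 (mu x)"
proof (rule rf_eqI[of "\<lambda>x. mu (rf 1 x)" "\<lambda>x. rf 1 (mu x)"])
  note j1 = one_in_range
  note h = coord_hom_rf[OF j1]
  note hs = hom_simps[OF coord_hom_field_hom[OF coord_hom_mu]] hom_simps[OF coord_hom_field_hom[OF h]]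
    mu_simps rf_simps[OF j1]
  show "coord_hom (\<lambda>x. mu (rf 1 x))" "coord_hom (\<lambda>x. rf 1 (mu x))"
    by (rule coord_hom_comp[OF coord_hom_mu h], rule coord_hom_comp[OF h coord_hom_mu])
  have mu_par: "mu (refl_par j k) = refl_par j k" for j k
    by (auto simp: refl_par_def hs)
  show "mu (rf 1 b_par) = rf 1 (mu b_par)" "mu (rf 1 c_par) = rf 1 (mu c_par)" "mu (rf 1 q_par) = rf 1 (mu q_par)"
    "mu (rf 1 (aa k)) = rf 1 (mu (aa k))" for k
    by (simp_all add: hs mu_par)
  define A x la where "A = AA 1" and "x = ff 1" and "la = A * (x - A) / (A * x - 1)"
  have nz: "A \<noteq> 0" "x \<noteq> 0" "A * x - 1 \<noteq> 0" "x - A \<noteq> 0" "la \<noteq> 0"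
    using AA_ff1_minus_1 by (simp_all add: A_def x_def la_def)
  have im: "rf 1 A = 1 / A" "rf 1 x = x"
    using rf_AA[OF j1, of 1] refl_par_self[of 1] rf_ff[OF j1 j1]
    by (simp_all add: A_def x_def AA_def power_one_over)
  have rr1: "rr 1 = (A * x - 1) / (x - A)" by (simp add: rr_def A_def x_def)
  have tt2: "tt 2 = - 1 / (A * x)"
    by (simp add: tt_2 A_def x_def)
  have tt3: "tt 3 = tt 2 * (- ff 2 / AA 2)"
    using tt_Suc[of 2] by (simp add: ph_def)
  have two: "2 \<in> {1..2*N}" using N_pos by simp
  have A2: "rf 1 (AA 2) = AA 2 * A"
    using rf_AA[OF j1, of 2] refl_par_neighbour[of 2 1] by (simp add: cong_def AA_def A_def power_mult_distrib)
  have rf_tt2: "rf 1 (tt 2) = - A / x" unfolding tt2 by (simp add: hs im)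
  have "rf 1 (tt 3) = - A / x * (- (ff 2 * (x - A) / (A * x - 1)) / (AA 2 * A))"
    unfolding tt3 by (simp add: hs rf_tt2 A2 rf_ff[OF j1 two] rr1)
  also have "\<dots> = la * tt 3"
    unfolding tt3 tt2 la_def using nz by (simp add: ac_simps)
  finally have rf_tt3: "rf 1 (tt 3) = la * tt 3" .
  have t: "rf 1 (tt i) = la * tt i" if "3 \<le> i" "i \<le> 2 * N + 1" for i
    using that
  proof (induction i rule: dec_induct)
    case base show ?case by (rule rf_tt3)
  next
    case (step i)
    then have i: "i \<in> {1..2*N}" and i3: "3 \<le> i" by simp_all
    have n: "\<not> cong_M (int i) 1" "\<not> cong_M (int i) (1 + 1)" "\<not> cong_M (int i) (1 - 1)"
      using i i3 cong_M_eq[of "int i" 1] cong_M_eq[of "int i" "1 + 1"] cong_M_eq[of "int i" "1 - 1"] by auto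
    have "refl_par 1 (int i) = aa (int i)" by (rule refl_par_far; rule n)
    then have "rf 1 (AA (int i)) = AA (int i)" using rf_AA[OF j1, of "int i"] by (simp add: AA_def)
    moreover have "rf 1 (ff i) = ff i" using i3 rf_ff[OF j1 i] by simp
    then have "rf 1 (ph i) = ph i" by (simp add: ph_def hs)
    moreover have "1 \<le> i" using i3 by simp
    ultimately show ?case using step by (simp add: tt_Suc hs)
  qed
  have rho: "rf 1 rho = rho" by (simp add: rho_def hs)
  have H1: "HH 1 = 1 + tt 2 + (\<Sum>j=3..2*N+1. tt j)"
  proof -
    have "(\<Sum>j=1..2*N+1. tt j) = tt 1 + (tt 2 + (\<Sum>j=3..2*N+1. tt j))"
      using sum.atLeast_Suc_atMost[of 1 "2 * N + 1" tt] sum.atLeast_Suc_atMost[of 2 "2 * N + 1" tt] N_pos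
      by (simp add: eval_nat_numeral One_nat_def)
    then show ?thesis by (simp add: HH_def)
  qed
  \<comment> \<open>The sum of the first two increments scales like the later increments although
    the first one stays 1; hence \<open>HH 1\<close> and \<open>HH 3\<close> scale and
    \<open>HH 2\<close> does not.\<close>
  have s12: "1 + rf 1 (tt 2) = la * (1 + tt 2)"
    unfolding rf_tt2 unfolding tt2 la_def using nz
  proof -
    have "1 + - A / x = (x - A) / x" "1 + - 1 / (A * x) = (A * x - 1) / (A * x)" using nz by (simp_all add: field_simps)
    then show "1 + - A / x = A * (x - A) / (A * x - 1) * (1 + - 1 / (A * x))" using nz by simp
  qed
  have "rf 1 (HH 1) = (1 + rf 1 (tt 2)) + (\<Sum>j=3..2*N+1. rf 1 (tt j))"
    unfolding H1 by (simp add: hs)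
  also have "(\<Sum>j=3..2*N+1. rf 1 (tt j)) = la * (\<Sum>j=3..2*N+1. tt j)"
    by (simp add: sum_distrib_left t)
  finally have rH1: "rf 1 (HH 1) = la * HH 1"
    unfolding s12 H1 by (simp add: algebra_simps)
  define d where "d = 1 - rho"
  have rd: "rf 1 d = d" by (simp add: d_def hs rho)
  have H2: "HH 2 = HH 1 - d" and H3: "HH 3 = HH 1 - d * (1 + tt 2)"
    by (simp_all add: d_def HH_2 HH_3)
  have rH: "rf 1 (HH i) = la * HH i" if "3 \<le> i" "i \<le> 2 * N + 2" for i
    using that
  proof (induction i rule: dec_induct)
    case base
    have "rf 1 (HH 3) = la * HH 1 - d * (1 + rf 1 (tt 2))" unfolding H3 by (simp add: hs rH1 rd)
    then show ?case unfolding s12 H3 by (simp add: algebra_simps)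
  next
    case (step i)
    then have i: "i \<in> {1..2*N+1}" by simp
    show ?case using step i by (simp add: HH_Suc hs t rho algebra_simps)
  qed
  have rH2: "rf 1 (HH 2) = la * HH 1 - d" unfolding H2 by (simp add: hs rH1 rd)
  have H3nz: "HH 1 \<noteq> 0" "HH 2 \<noteq> 0" "HH 3 \<noteq> 0" "HH 4 \<noteq> 0" using N_pos by (auto intro!: HH_nonzero)
  fix i assume i: "i \<in> {1..2*N}"
  consider "i = 1" | "i = 2" | "3 \<le> i" using i by force
  then show "mu (rf 1 (ff i)) = rf 1 (mu (ff i))"
  proof cases
    case 1
    have e: "rf 1 (ff 1) = ff 1" using rf_ff[OF j1 j1] by simp
    have "mu (ff 1) = ff 1 * HH 3 / HH 1" using mu_ff[OF j1] by simp
    moreover have "rf 1 (ff 1 * HH 3 / HH 1) = ff 1 * HH 3 / HH 1"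
      using rH[of 3] N_pos nz by (simp add: hs rH1 e)
    ultimately show ?thesis using 1 by (simp add: e)
  next
    case 3
    then have e: "rf 1 (ff i) = ff i" using rf_ff[OF j1 i] by simp
    have "rf 1 (HH i) = la * HH i" "rf 1 (HH (i + 2)) = la * HH (i + 2)" using rH 3 i by auto
    then show ?thesis using mu_ff[OF i] nz(5) by (simp add: e hs)
  next
    case 2
    have e: "rf 1 (ff 2) = ff 2 * ((x - A) / (A * x - 1))" using rf_ff[OF j1 two] by (simp add: rr1)
    have m2: "mu (ff 2) = ff 2 * HH 2 / HH 4" using mu_ff[OF two] by simp
    have mx: "mu x = x * HH 3 / HH 1" using mu_ff[OF j1] by (simp add: x_def)
    have mA: "mu A = A" by (simp add: A_def mu_AA)
    define z where "z = A * x - 1"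
    have z: "z \<noteq> 0" "A * x = z + 1" using nz by (simp_all add: z_def)
    have e1: "A * (x * HH 3 / HH 1) - 1 = z * HH 2 / HH 1"
    proof -
      have "A * x * HH 3 = (A * x) * HH 1 - d * (A * x - 1)"
        unfolding H3 tt2 using nz by (simp add: field_simps)
      then have "A * x * HH 3 - HH 1 = z * HH 2" unfolding H2 z_def by (simp add: algebra_simps)
      then show ?thesis using H3nz by (simp add: field_simps)
    qed
    have e2: "x * HH 3 / HH 1 - A = ((x - A) * HH 1 - d * (x - 1 / A)) / HH 1"
      unfolding H3 tt2 using nz H3nz by (simp add: field_simps)
    have e3: "la * HH 1 - d = A * ((x - A) * HH 1 - d * (x - 1 / A)) / z"
    proof -
      have *: "A * (x - 1 / A) = z" using nz by (simp add: z_def field_simps)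
      have "A * ((x - A) * HH 1 - d * w) = A * (x - A) * HH 1 - d * (A * w)" for w
        by (simp add: algebra_simps)
      from this[of "x - 1 / A", unfolded *] show ?thesis unfolding la_def z_def[symmetric] using z(1) by (simp add: diff_divide_distrib)
    qed
    \<comment> \<open>Both \<open>mu (x - A)\<close> and the image of \<open>HH 2\<close> under
      \<open>rf 1\<close> are multiples of this expression, by \<open>e2\<close> and
      \<open>e3\<close>; that makes the two sides agree.\<close>
    define P where "P = (x - A) * HH 1 - d * (x - 1 / A)"
    have "mu (rf 1 (ff 2)) = ff 2 * HH 2 / HH 4 * ((P / HH 1) / (z * HH 2 / HH 1))"
      unfolding e by (simp only: hs m2 mx mA e1 e2 P_def)
    also have "\<dots> = ff 2 * P / (HH 4 * z)"
      using H3nz z by simp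
    finally have L: "mu (rf 1 (ff 2)) = ff 2 * P / (HH 4 * z)" .
    have "rf 1 (HH 4) = la * HH 4" using rH[of 4] N_pos by simp
    then have "rf 1 (mu (ff 2)) = ff 2 * ((x - A) / (A * x - 1)) * (la * HH 1 - d) / (la * HH 4)"
      unfolding m2 by (simp only: hs e rH2)
    also have "\<dots> = ff 2 * ((x - A) / z) * (A * P / z) / (A * (x - A) / z * HH 4)"
      unfolding e3 P_def[symmetric] unfolding la_def z_def[symmetric] ..
    also have "\<dots> = ff 2 * P / (HH 4 * z)" using nz z H3nz by simp
    finally show ?thesis using L 2 by simp
  qed
qed

text \<open>The product of all step factors compares the even with the odd product of
  \<open>ff\<close>, hence \<open>YY\<close> with \<open>XX\<close>; the parameters left over are
  collected in \<open>rho\<close>.\<close>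

lemma tt_last: "tt (2 * N + 1) * XX = rho * (AA 0)\<^sup>2 * YY"
proof -
  have "tt (2 * N + 1) = (\<Prod>k=1..2*N. - ph k / AA (int k))"
    unfolding tt_def by (intro prod.cong) auto
  also have "\<dots> = (\<Prod>k=1..2*N. - ph k) / (\<Prod>k=1..2*N. AA (int k))"
    by (rule prod_dividef)
  also have "(\<Prod>k=1..2*N. - ph k) = (\<Prod>k=1..N. ff (2 * k)) / (\<Prod>k=1..N. ff (2 * k - 1))"
  proof -
    have "(\<Prod>k=1..2*n. - ph k) = (\<Prod>k=1..n. ff (2 * k)) / (\<Prod>k=1..n. ff (2 * k - 1))" for n
      by (induction n) (simp_all add: ph_def One_nat_def)
    then show ?thesis .
  qed
  also have "(\<Prod>k=1..2*N. AA (int k)) = 1 / (q_par ^ ((2 * N - 1) * (2 * N + 1)) * AA 0)"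
  proof -
    have "(\<Prod>i=1..2*N. aa (int i)) = 1 / (q_par ^ (2 * N - 1) * aa 0)"
      using aa_prod[of 0] by (simp add: field_simps)
    then have "(\<Prod>i=1..2*N. aa (int i)) ^ (2 * N + 1) = 1 / (q_par ^ (2 * N - 1) * aa 0) ^ (2 * N + 1)"
      by (simp add: power_one_over)
    then show ?thesis
      unfolding AA_def prod_power_distrib[symmetric] by (simp add: power_mult_distrib flip: power_mult)
  qed
  finally have t: "tt (2 * N + 1) = (\<Prod>k=1..N. ff (2 * k)) / (\<Prod>k=1..N. ff (2 * k - 1)) *
      (q_par ^ ((2 * N - 1) * (2 * N + 1)) * AA 0)" by simp
  define x where "x = c_par ^ (2 * N - 1)"
  have c: "c_par ^ (2 * (2 * N - 1)) = x * x" "x \<noteq> 0"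
    unfolding x_def by (simp_all flip: power_add add: mult_2)
  show ?thesis
    unfolding t XX_def YY_def rho_def c x_def[symmetric] using c(2) by (simp add: power2_eq_square)
qed

text \<open>A single shift would interchange \<open>ff\<close> and its inverse in \<open>ph\<close>,
  so two are taken. Up to the factor \<open>tt 3\<close> the double shift moves \<open>HH\<close> by
  two places, and beyond the period the increments are \<open>tM1\<close> and
  \<open>tM2\<close>.\<close>

lemma mu_sh_sh: "mu (sh (sh x)) = sh (sh (mu x))"
proof (rule rf_eqI[of "\<lambda>x. mu (sh (sh x))" "\<lambda>x. sh (sh (mu x))"])
  note hs = hom_simps[OF coord_hom_field_hom[OF coord_hom_mu]] hom_simps[OF coord_hom_field_hom[OF coord_hom_sh]]
    mu_simps sh_simps
  show "coord_hom (\<lambda>x. mu (sh (sh x)))" "coord_hom (\<lambda>x. sh (sh (mu x)))"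
    by (rule coord_hom_comp[OF coord_hom_mu coord_hom_comp[OF coord_hom_sh coord_hom_sh]],
        rule coord_hom_comp[OF coord_hom_sh coord_hom_comp[OF coord_hom_sh coord_hom_mu]])
  show "mu (sh (sh b_par)) = sh (sh (mu b_par))" "mu (sh (sh c_par)) = sh (sh (mu c_par))"
    "mu (sh (sh q_par)) = sh (sh (mu q_par))" "mu (sh (sh (aa k))) = sh (sh (mu (aa k)))" for k
    by (simp_all add: hs)
  define M where "M = 2 * N + 1"
  define d where "d = 1 - rho"
  have rho: "sh (sh rho) = rho" by (simp add: rho_def hs)
  have rd: "sh (sh d) = d" by (simp add: d_def hs rho)
  have ff2: "sh (sh (ff i)) = fx (i + 2)" if "i \<in> {1..2*N-1}" for i
  proof -
    have "i \<in> {1..2*N}" "i + 1 \<le> 2 * N" using that by auto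
    then show ?thesis using sh_ff[of i] sh_fx[of "i + 1"] by (simp add: add.assoc)
  qed
  have t: "sh (sh (tt i)) = tt (i + 2) / tt 3" if "1 \<le> i" "i \<le> 2 * N - 1" for i
    using that
  proof (induction i rule: dec_induct)
    case base
    have "1 + 2 = (3::nat)" by simp
    then show ?case by (simp add: hs)
  next
    case (step i)
    then have i: "i \<in> {1..2*N-1}" "i + 2 \<in> {1..2*N}" by auto
    have "sh (sh (ph i)) = ph (i + 2)"
      using ff2[OF i(1)] fx_simps(3)[OF i(2)] by (simp add: ph_def hs)
    moreover have "sh (sh (AA (int i))) = AA (int (i + 2))" by (simp add: sh_AA add.commute)
    ultimately have "sh (sh (tt (Suc i))) = tt (i + 2) / tt 3 * (- ph (i + 2) / AA (int (i + 2)))"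
      using step by (simp add: tt_Suc hs)
    also have "\<dots> = tt (Suc i + 2) / tt 3"
      using tt_Suc[of "i + 2"] by simp
    finally show ?case .
  qed
  \<comment> \<open>The increment of index 2N+2, continued with the term \<open>fx M\<close> and the
    parameter \<open>AA 0\<close>; \<open>tM2\<close> below is the next one.\<close>
  define tM1 where "tM1 = - tt M / (fx M * AA 0)"
  have tM1: "tM1 = rho * YY / (1 + YY)"
  proof -
    have "tM1 = tt M * XX / ((AA 0)\<^sup>2 * (1 + YY))"
      unfolding tM1_def M_def fx_simps(2) using one_plus_YY by (simp add: power2_eq_square)
    then show ?thesis using tt_last by (simp add: M_def)
  qed
  have t2N: "sh (sh (tt (2 * N))) = tM1 / tt 3"
  proof -
    have r: "2 * N - 1 \<in> {1..2*N-1}" and s: "2 * N = Suc (2 * N - 1)" "2 * N - 1 + 2 = M" "1 \<le> 2 * N - 1"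
      using N_pos by (auto simp: M_def)
    have AAM: "sh (sh (AA (int (2 * N - 1)))) = AA 0"
      using AA_M N_pos by (simp add: sh_AA of_nat_diff)
    have "odd (2 * N - 1)" using N_pos by simp
    then have "sh (sh (ph (2 * N - 1))) = 1 / fx M" using ff2[OF r] s N_pos by (simp add: ph_def hs)
    moreover have "sh (sh (tt (2 * N - 1))) = tt M / tt 3"
      using t[OF s(3) order_refl] unfolding s(2) .
    ultimately have "sh (sh (tt (Suc (2 * N - 1)))) = tt M / tt 3 * (- (1 / fx M) / AA 0)"
      by (simp only: tt_Suc[OF s(3)] hs AAM)
    then show ?thesis unfolding s(1)[symmetric] by (simp add: tM1_def)
  qed
  define tM2 where "tM2 = - tM1 * fx1 / AA 1"
  have tM: "sh (sh (tt M)) = tM2 / tt 3"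
  proof -
    have s: "M = Suc (2 * N)" "1 \<le> 2 * N" "2 * N \<in> {1..2*N}" using N_pos by (auto simp: M_def)
    have "sh (sh (ph (2 * N))) = fx1"
      using sh_ff[OF s(3)] sh_fx_M by (simp add: ph_def)
    moreover have "sh (sh (AA (int (2 * N)))) = AA 1"
      using AA_add_period[of 1] by (simp add: sh_AA add.commute)
    ultimately show ?thesis
      unfolding s(1) tt_Suc[OF s(2)] by (simp add: hs t2N tM2_def)
  qed
  \<comment> \<open>The multiplier \<open>rho\<close> appears for the sum of the two increments
    only: \<open>tM1\<close> alone is \<open>rho * YY / (1 + YY)\<close>, whereas
    \<open>tt 1\<close> is 1.\<close>
  have sum_tM: "tM1 + tM2 = rho * (1 + tt 2)"
  proof -
    define u where "u = 1 + YY"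
    have u: "u \<noteq> 0" "YY = u - 1" by (simp_all add: u_def)
    have nz: "u - 1 \<noteq> 0" using u by (metis YY_nonzero)
    show ?thesis
      unfolding tM2_def tM1 fx1_def tt_2 unfolding u_def[symmetric] unfolding u(2) using u(1) nz
      by (simp add: field_simps)
  qed
  have split: "(\<Sum>j=1..M. g j) = g 1 + (g 2 + (\<Sum>j=3..M. g j))" for g :: "nat \<Rightarrow> ratfun"
    using sum.atLeast_Suc_atMost[of 1 M g] sum.atLeast_Suc_atMost[of 2 M g] N_pos
    by (simp add: eval_nat_numeral One_nat_def M_def)
  have H1: "HH 1 = 1 + tt 2 + (\<Sum>j=3..M. tt j)"
    using split[of tt] by (simp add: HH_def M_def)
  have H2: "HH 2 = HH 1 - d" and H3: "HH 3 = HH 1 - d * (1 + tt 2)"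
    by (simp_all add: d_def HH_2 HH_3)
  have sH1: "sh (sh (HH 1)) = HH 3 / tt 3"
  proof -
    have "HH 1 = (\<Sum>j=1..M. tt j)" by (simp add: HH_def M_def)
    also have "\<dots> = (\<Sum>j=1..2*N-1. tt j) + tt (2 * N) + tt M"
    proof -
      define n where "n = 2 * N - 1"
      have "M = Suc (Suc n)" "2 * N = Suc n" using N_pos by (auto simp: M_def n_def)
      then show ?thesis by (simp flip: n_def)
    qed
    finally have "sh (sh (HH 1)) = (\<Sum>j=1..2*N-1. tt (j + 2)) / tt 3 + tM1 / tt 3 + tM2 / tt 3"
      by (simp add: hs t t2N tM sum_divide_distrib)
    also have "(\<Sum>j=1..2*N-1. tt (j + 2)) = (\<Sum>j=3..M. tt j)"
    proof -
      have "2 * N - 1 + 2 = M" "1 + 2 = (3::nat)" using N_pos by (simp_all add: M_def)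
      then show ?thesis using sum.shift_bounds_cl_nat_ivl[of tt 1 2 "2 * N - 1"] by simp
    qed
    also have "(\<Sum>j=3..M. tt j) / tt 3 + tM1 / tt 3 + tM2 / tt 3 = ((\<Sum>j=3..M. tt j) + (tM1 + tM2)) / tt 3"
      by (simp add: add_divide_distrib)
    also have "\<dots> = HH 3 / tt 3"
      unfolding sum_tM H3 H1 d_def by (simp add: algebra_simps)
    finally show ?thesis .
  qed
  have sH: "sh (sh (HH i)) = HH (i + 2) / tt 3" if "1 \<le> i" "i \<le> 2 * N" for i
    using that
  proof (induction i rule: dec_induct)
    case base
    have "1 + 2 = (3::nat)" by simp
    then show ?case by (simp add: sH1)
  next
    case (step i)
    then have i: "i \<in> {1..2*N+1}" "i + 2 \<in> {1..2*N+1}" by auto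
    have "sh (sh (HH (Suc i))) = HH (i + 2) / tt 3 - d * (tt (i + 2) / tt 3)"
      using step i(1) by (simp add: HH_Suc hs t rd flip: d_def)
    also have "\<dots> = HH (Suc (i + 2)) / tt 3"
      unfolding HH_Suc[OF i(2)] by (simp add: d_def diff_divide_distrib)
    finally show ?case by simp
  qed
  \<comment> \<open>Up to \<open>tt 3\<close> this is the continued \<open>HH\<close> at index 2N+3;
    it differs from \<open>rho * HH 2\<close>, since \<open>tM1\<close> is not
    \<open>rho\<close>.\<close>
  have sHM: "sh (sh (HH M)) = (rho * HH 1 - d * tM1) / tt 3"
  proof -
    have "M = Suc (2 * N)" "2 * N \<in> {1..2*N+1}" "1 \<le> 2 * N" using N_pos by (auto simp: M_def)
    then have "sh (sh (HH M)) = HH (2 * N + 2) / tt 3 - d * (tM1 / tt 3)"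
      using sH[of "2 * N"] by (simp add: HH_Suc hs t2N rd flip: d_def)
    then show ?thesis unfolding HH_last by (simp add: diff_divide_distrib)
  qed
  have nz: "HH 1 \<noteq> 0" "HH 2 \<noteq> 0" "HH 3 \<noteq> 0" "HH M \<noteq> 0" using N_pos by (auto simp: M_def intro!: HH_nonzero)
  fix i assume i: "i \<in> {1..2*N}"
  consider "i = 2 * N" | "i = 2 * N - 1" | "i < 2 * N - 1" using i by force
  then show "mu (sh (sh (ff i))) = sh (sh (mu (ff i)))"
  proof cases
    case 3
    then have i': "i \<in> {1..2*N-1}" "i + 2 \<in> {1..2*N}" using i by auto
    have s: "sh (sh (ff i)) = ff (i + 2)" using ff2[OF i'(1)] fx_simps(3)[OF i'(2)] by simp
    have "sh (sh (HH i)) = HH (i + 2) / tt 3" "sh (sh (HH (i + 2))) = HH (i + 2 + 2) / tt 3"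
      using sH[of i] sH[of "i + 2"] i' by auto
    then show ?thesis unfolding s mu_ff[OF i] mu_ff[OF i'(2)] by (simp add: hs s)
  next
    case 2
    then have i': "i \<in> {1..2*N-1}" "i + 2 = M" "odd i" "1 \<le> i" using i N_pos by (auto simp: M_def)
    have s: "sh (sh (ff i)) = fx M" using ff2[OF i'(1)] i' by simp
    have "sh (sh (mu (ff i))) = fx M * ((rho * HH 1 - d * tM1) / tt 3) / (HH M / tt 3)"
      unfolding mu_ff[OF i] using i' sH[of i] i by (simp add: hs s sHM)
    then have R: "sh (sh (mu (ff i))) = fx M * (rho * HH 1 - d * tM1) / HH M" by simp
    have "mu (fx M) = - AA 0 * (1 + YY * HH 2 / HH 1) / (XX * HH M / (HH 1 * rho))"
      unfolding M_def fx_simps(2) by (simp only: hs mu_AA mu_XX mu_YY)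
    also have "\<dots> = - AA 0 * rho * (HH 1 + YY * HH 2) / (XX * HH M)"
    proof -
      have "1 + YY * HH 2 / HH 1 = (HH 1 + YY * HH 2) / HH 1" using nz by (simp add: field_simps)
      then show ?thesis using nz by simp
    qed
    also have "\<dots> = fx M * (rho * HH 1 - d * tM1) / HH M"
    proof -
      have "(1 + YY) * (rho * HH 1 - d * (rho * YY / (1 + YY))) = (1 + YY) * (rho * HH 1) - d * rho * YY"
        using one_plus_YY by (simp add: right_diff_distrib del: minus_1_neq)
      also have "\<dots> = rho * (HH 1 + YY * HH 2)" unfolding H2 by (simp add: algebra_simps)
      finally have e: "rho * (HH 1 + YY * HH 2) = (1 + YY) * (rho * HH 1 - d * tM1)" by (simp add: tM1)
      show ?thesis unfolding mult.assoc[of "- AA 0"] e by (simp add: M_def fx_simps(2))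
    qed
    finally show ?thesis using R s by simp
  next
    case 1
    have s: "sh (sh (ff i)) = fx1" using 1 sh_ff[OF i] sh_fx_M by simp
    have "sh (sh (HH (2 * N + 2))) = rho * (HH 3 / tt 3)" unfolding HH_last by (simp add: hs rho sH1)
    moreover have "sh (sh (HH (2 * N))) = rho * HH 1 / tt 3" using sH[of "2 * N"] N_pos HH_last by simp
    ultimately have R: "sh (sh (mu (ff i))) = fx1 * HH 1 / HH 3"
      unfolding mu_ff[OF i] using 1 s by (simp add: hs)
    have f1: "mu (ff 1) = ff 1 * HH 3 / HH 1" using mu_ff[OF one_in_range] by simp
    have "mu fx1 = (1 + YY * HH 2 / HH 1 - AA 1 * (ff 1 * HH 3 / HH 1)) / (YY * HH 2 / HH 1 * (ff 1 * HH 3 / HH 1))"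
      unfolding fx1_def by (simp only: hs f1 mu_AA mu_YY)
    also have "1 + YY * HH 2 / HH 1 - AA 1 * (ff 1 * HH 3 / HH 1) = (HH 2 / HH 1) * (1 + YY - AA 1 * ff 1)"
    proof -
      define z where "z = AA 1 * ff 1"
      have "z \<noteq> 0" by (simp add: z_def)
      then have "z * HH 3 = z * HH 1 - d * (z - 1)" unfolding H3 tt_2 z_def[symmetric] by (simp add: field_simps)
      moreover have "HH 1 = HH 2 + d" by (simp add: H2)
      ultimately have "HH 1 + YY * HH 2 - z * HH 3 = HH 2 * (1 + YY - z)" by (simp add: algebra_simps)
      moreover have "1 + YY * HH 2 / HH 1 - AA 1 * (ff 1 * HH 3 / HH 1) = (HH 1 + YY * HH 2 - z * HH 3) / HH 1"
        using nz by (simp add: z_def field_simps)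
      ultimately show ?thesis by (simp add: z_def)
    qed
    also have "(HH 2 / HH 1) * (1 + YY - AA 1 * ff 1) / (YY * HH 2 / HH 1 * (ff 1 * HH 3 / HH 1)) = fx1 * HH 1 / HH 3"
      unfolding fx1_def using nz by simp
    finally show ?thesis using R s by simp
  qed
qed

end

section \<open>The group action\<close>

definition sS :: "int \<Rightarrow> ratfun \<Rightarrow> ratfun" where
  "sS j = (let i = nat (j mod (2 * int N + 1)) in
     if i = 0 then (\<lambda>x. sh (rf (2 * N) (ush x))) else rf i)"

text \<open>With \<pi> = \<open>ush\<close> = r w_0 = w_1 r, the relations leave r = w_1 \<pi>, w_0
  = r \<pi> and \<mu>_1 = r \<mu>_0 r as the only choices.\<close>

primrec act :: "gen \<Rightarrow> ratfun \<Rightarrow> ratfun" where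
  "act (S i) x = sS i x"
| "act W0 x = rv (ush (ush x))"
| "act W1 x = rv x"
| "act R x = rv (ush x)"
| "act M0 x = mu x"
| "act M1 x = rv (ush (mu (rv (ush x))))"

lemma residue_cases:
  obtains "cong_M j 0" | i where "i \<in> {1..2*N}" "cong_M j (int i)"
proof -
  define i where "i = nat (j mod (2 * int N + 1))"
  have i: "int i = j mod (2 * int N + 1)" "i \<le> 2 * N"
    using pos_mod_bound[of "2 * int N + 1" j] by (auto simp: i_def)
  then have "cong_M j (int i)" by (simp add: cong_def)
  with that(1) that(2)[of i] i(2) show thesis by (cases "i = 0") simp_all
qed

lemma cong_M_period: "l = k + (2 * int N + 1) \<Longrightarrow> cong_M k l"
  by (simp add: cong_def)

lemma sS_cong: "cong_M i j \<Longrightarrow> sS i = sS j"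
  by (simp add: sS_def cong_def)

lemma sS_0: "cong_M j 0 \<Longrightarrow> sS j x = sh (rf (2 * N) (ush x))"
  by (simp add: sS_def cong_def)

lemma sS_rf: "i \<in> {1..2*N} \<Longrightarrow> cong_M j (int i) \<Longrightarrow> sS j x = rf i x"
  by (simp add: sS_def cong_def)

lemma sh_sS: "sh (sS j x) = sS (j + 1) (sh x)"
proof (cases j rule: residue_cases)
  case 1
  then have "cong_M (j + 1) (int 1)" using cong_add[OF 1, of 1 1] by simp
  then show ?thesis using 1 rf1_sh_sh[of "ush x"] sS_rf[of 1 "j + 1"] N_pos by (simp add: sS_0)
next
  case (2 i)
  then have "cong_M (j + 1) (int (i + 1))" using cong_add[OF 2(2), of 1 1] by (simp add: ac_simps)
  show ?thesis
  proof (cases "i = 2 * N")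
    case True
    have "cong_M 0 (int (i + 1))" by (rule cong_M_period) (simp add: True)
    then have "cong_M (j + 1) 0" using \<open>cong_M (j + 1) (int (i + 1))\<close> cong_sym cong_trans by blast
    then show ?thesis using sS_rf[OF 2] True by (simp add: sS_0)
  next
    case False
    then show ?thesis
      using 2 \<open>cong_M (j + 1) (int (i + 1))\<close> sh_rf[of i x] sS_rf[of i j] sS_rf[of "i + 1" "j + 1"] by auto
  qed
qed

lemma ush_sS: "ush (sS j x) = sS (j - 1) (ush x)"
  using arg_cong[OF sh_sS[of "j - 1" "ush x"], of ush] by simp

lemma sS_involution: "sS j (sS j x) = x"
  by (cases j rule: residue_cases) (use N_pos in \<open>simp_all add: sS_0 sS_rf rf_rf\<close>)

lemma rv_sh: "rv (sh x) = ush (rv x)"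
  using rv_sh_rv[of "rv x"] by simp

lemma rv_ush: "rv (ush x) = sh (rv x)"
  using arg_cong[OF rv_sh[of "ush x"], of sh] by simp

lemma sh_sS_ush: "sh (sS j (ush x)) = sS (j + 1) x"
  by (simp add: sh_sS)

lemma rv_sS: "rv (sS j x) = sS (- j) (rv x)"
proof (cases j rule: residue_cases)
  case 1
  then have m: "cong_M (- j) 0" using cong_minus_minus_iff[of j 0] by simp
  have "rv (sS j x) = ush (rf 1 (sh (rv x)))"
    using 1 N_pos rv_rf[of "2 * N"] by (simp add: sS_0 rv_sh rv_ush)
  also have "rf 1 (sh (rv x)) = sS 1 (sh (rv x))"
    using sS_rf[of 1 1] N_pos by simp
  also have "ush \<dots> = sS 0 (rv x)" by (simp add: ush_sS)
  finally show ?thesis using sS_cong[OF m] by simp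
next
  case (2 i)
  then have i': "2 * N + 1 - i \<in> {1..2*N}" by auto
  have "cong_M (- j) (- int i)" using 2(2) cong_minus_minus_iff by blast
  moreover have "int (2 * N + 1 - i) = - int i + (2 * int N + 1)" using 2(1) by (simp add: of_nat_diff)
  ultimately have "cong_M (- j) (int (2 * N + 1 - i))" by (simp add: cong_def)
  then show ?thesis using 2 i' rv_rf[OF 2(1)] sS_rf[OF i'] by (simp add: sS_rf)
qed

lemma sh_sh_conj:
  assumes "\<And>x. \<phi> (sh (sh x)) = sh (sh (\<phi> x))"
  shows "\<phi> (ush (ush x)) = ush (ush (\<phi> x))"
  using assms[of "ush (ush x)"] by simp

lemma mu_ush_ush: "mu (ush (ush x)) = ush (ush (mu x))"
  using sh_sh_conj[of mu] mu_sh_sh by blast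

lemma sh_mu_ush: "sh (mu (ush x)) = ush (mu (sh x))"
  using arg_cong[OF mu_sh_sh[of "ush x"], of ush] by simp

text \<open>\<open>mu\<close> commutes with the double shift, so the case of s_1 spreads to all odd
  indices; an even index becomes odd on adding the odd period.\<close>

lemma mu_sS: "mu (sS j x) = sS j (mu x)"
proof -
  have up: "\<forall>x. mu (sS (j + 2) x) = sS (j + 2) (mu x)" if "\<forall>x. mu (sS j x) = sS j (mu x)" for j
  proof
    fix x
    have s: "sS (j + 2) y = sh (sh (sS j (ush (ush y))))" for y
      by (simp add: sh_sS ac_simps)
    show "mu (sS (j + 2) x) = sS (j + 2) (mu x)"
      unfolding s by (simp add: mu_sh_sh that mu_ush_ush)
  qed
  have down: "\<forall>x. mu (sS (j - 2) x) = sS (j - 2) (mu x)" if "\<forall>x. mu (sS j x) = sS j (mu x)" for j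
  proof
    fix x
    have s: "sS (j - 2) y = ush (ush (sS j (sh (sh y))))" for y
      by (simp add: ush_sS)
    show "mu (sS (j - 2) x) = sS (j - 2) (mu x)"
      unfolding s by (simp add: mu_sh_sh that mu_ush_ush)
  qed
  have odd: "\<forall>x. mu (sS (1 + 2 * k) x) = sS (1 + 2 * k) (mu x)" for k
  proof (induction k rule: int_induct[of _ 0])
    case base
    show ?case using mu_rf1 sS_rf[of 1 1] N_pos by simp
  next
    case (step1 i)
    then show ?case using up[of "1 + 2 * i"] by (simp add: algebra_simps)
  next
    case (step2 i)
    then show ?case using down[of "1 + 2 * i"] by (simp add: algebra_simps)
  qed
  show ?thesis
  proof (cases "even j")
    case True
    then obtain l where "j = 2 * l" by (elim evenE)
    then have "cong_M j (1 + 2 * (l + int N))" by (intro cong_M_period) simp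
    then have "sS j = sS (1 + 2 * (l + int N))" by (rule sS_cong)
    then show ?thesis using odd[of "l + int N"] by simp
  next
    case False
    then obtain l where "j = 1 + 2 * l" by (auto elim!: oddE)
    then show ?thesis using odd by simp
  qed
qed

text \<open>Conjugation by the shift carries the one computed case, s_1 and s_2, to all indices,
  including those that involve s_0.\<close>

lemma sS_braid: "sS j (sS (j + 1) (sS j x)) = sS (j + 1) (sS j (sS (j + 1) x))"
proof -
  have "\<forall>x. sS j (sS (j + 1) (sS j x)) = sS (j + 1) (sS j (sS (j + 1) x))"
  proof (induction j rule: int_induct[of _ 1])
    case base
    show ?case using rf_braid sS_rf[of 1 1] sS_rf[of 2 2] N_pos by simp
  next
    case (step1 i)
    have s: "sS (i + 1) y = sh (sS i (ush y))" "sS (i + 1 + 1) y = sh (sS (i + 1) (ush y))" for y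
      by (simp_all only: sh_sS_ush)
    show ?case using step1(2) unfolding s(2) unfolding s(1)[of "sh _"] unfolding s(1) by simp
  next
    case (step2 i)
    have s: "sS (i - 1) y = ush (sS i (sh y))" "sS (i - 1 + 1) y = ush (sS (i + 1) (sh y))" for y
      by (simp_all add: ush_sS)
    show ?case using step2(2) unfolding s by simp
  qed
  then show ?thesis by blast
qed

lemma sS_commute:
  assumes "\<not> cong_M j (i + 1)" "\<not> cong_M j (i - 1)"
  shows "sS i (sS j x) = sS j (sS i x)"
proof -
  have "\<forall>j x. \<not> cong_M j (i + 1) \<longrightarrow> \<not> cong_M j (i - 1) \<longrightarrow> sS i (sS j x) = sS j (sS i x)"
  proof (induction i rule: int_induct[of _ 1])
    case base
    show ?case
    proof (intro allI impI)
      fix j x assume j: "\<not> cong_M j (1 + 1)" "\<not> cong_M j (1 - 1)"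
      show "sS 1 (sS j x) = sS j (sS 1 x)"
      proof (cases j rule: residue_cases)
        case (2 k)
        then have "k \<noteq> 2" using j by auto
        with 2 consider "k = 1" | "k \<in> {3..2*N}" by force
        then show ?thesis
        proof cases
          case 1
          then show ?thesis using sS_cong 2 by simp
        next
          case 2
          then show ?thesis using rf_commute[OF 2] sS_rf[of 1 1] sS_rf[of k j] \<open>cong_M j (int k)\<close> by simp
        qed
      qed (use j in simp)
    qed
  next
    case (step1 i)
    show ?case
    proof (intro allI impI)
      fix j x assume j: "\<not> cong_M j (i + 1 + 1)" "\<not> cong_M j (i + 1 - 1)"
      then have "\<not> cong_M (j - 1) (i + 1)" "\<not> cong_M (j - 1) (i - 1)"
        using cong_add_rcancel[of "j - 1" 1 "i + 1"] cong_add_rcancel[of "j - 1" 1 "i - 1"] by auto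
      then have "sS i (sS (j - 1) (ush x)) = sS (j - 1) (sS i (ush x))" using step1 by blast
      from arg_cong[OF this, of sh] show "sS (i + 1) (sS j x) = sS j (sS (i + 1) x)" by (simp add: sh_sS)
    qed
  next
    case (step2 i)
    show ?case
    proof (intro allI impI)
      fix j x assume j: "\<not> cong_M j (i - 1 + 1)" "\<not> cong_M j (i - 1 - 1)"
      then have "\<not> cong_M (j + 1) (i + 1)" "\<not> cong_M (j + 1) (i - 1)"
        using cong_add_rcancel[of j 1 i] cong_add_rcancel[of j 1 "i - 1 - 1"] by auto
      then have "sS i (sS (j + 1) (sh x)) = sS (j + 1) (sS i (sh x))" using step2 by blast
      from arg_cong[OF this, of ush] show "sS (i - 1) (sS j x) = sS j (sS (i - 1) x)" by (simp add: ush_sS)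
    qed
  qed
  with assms show ?thesis by blast
qed

lemma act_rel: "fund_rel N u v \<Longrightarrow> foldr act u x = foldr act v x"
proof (induction arbitrary: x rule: fund_rel.induct)
  case (index i j)
  then show ?case using sS_cong by simp
next
  case (s_braid_succ i)
  then show ?case
    by (simp add: numeral_3_eq_3 sS_braid[of i] sS_involution)
next
  case (s_braid_pred i)
  have "sS (i - 1) (sS i (sS (i - 1) y)) = sS i (sS (i - 1) (sS i y))" for y
    using sS_braid[of "i - 1" y] by simp
  then show ?case
    by (simp add: numeral_3_eq_3 sS_involution)
next
  case (s_comm j i)
  then show ?case
    using sS_commute[of j i] by (simp add: numeral_2_eq_2 sS_involution)
next
  case (w0_s i)
  have "cong_M (- (i - 1 - 1)) (2 * int N - i + 3)"
    by (rule cong_M_period) simp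
  then show ?case using sS_cong by (simp add: ush_sS rv_sS)
next
  case (w1_s i)
  have "cong_M (- i) (2 * int N - i + 1)"
    by (rule cong_M_period) simp
  then show ?case using sS_cong by (simp add: rv_sS)
next
  case (r_s i)
  have "cong_M (- (i - 1)) (2 * int N - i + 2)"
    by (rule cong_M_period) simp
  then show ?case using sS_cong by (simp add: ush_sS rv_sS)
next
  case (m_s m i)
  then show ?case by (auto simp: mu_sS ush_sS rv_sS)
next
  case (m_w m w)
  then show ?case
    by (auto simp: mu_ush_ush mu_rv[symmetric] rv_ush rv_sh mu_sh_sh sh_mu_ush)
qed (auto simp: sS_involution rv_ush rv_sh mu_rv mu_ush_ush mu_sh_sh)

lemma act_cong: "word_cong (fund_rel N) u v \<Longrightarrow> foldr act u = foldr act v"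
  by (rule fold_word_cong[of "fund_rel N"]) (auto simp: fun_eq_iff act_rel)

lemma coord_hom_sS [simp]: "coord_hom (sS j)"
proof (cases j rule: residue_cases)
  case 1
  have "coord_hom (\<lambda>x. sh (rf (2 * N) (ush x)))"
    by (rule coord_hom_comp[OF coord_hom_sh coord_hom_comp[OF coord_hom_rf coord_hom_ush]]) (use N_pos in simp)
  moreover have "sS j = (\<lambda>x. sh (rf (2 * N) (ush x)))" using sS_0[OF 1] by blast
  ultimately show ?thesis by simp
next
  case (2 i)
  then have "sS j = rf i" using sS_rf[OF 2] by blast
  then show ?thesis using coord_hom_rf[OF 2(1)] by simp
qed

lemma coord_hom_act: "coord_hom (act g)"
proof -
  have RM: "coord_hom (\<lambda>x. rv (ush x))" by (rule coord_hom_comp[OF coord_hom_rv coord_hom_ush])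
  show ?thesis
  proof (cases g)
    case W0
    then have "act g = (\<lambda>x. rv (ush (ush x)))" by auto
    then show ?thesis using coord_hom_comp[OF RM coord_hom_ush] by simp
  next
    case M1
    then have "act g = (\<lambda>x. rv (ush (mu (rv (ush x)))))" by auto
    then show ?thesis using coord_hom_comp[OF RM coord_hom_comp[OF coord_hom_mu RM]] by simp
  next
    case R
    then have "act g = (\<lambda>x. rv (ush x))" by auto
    then show ?thesis using RM by simp
  next
    case (S i)
    then have "act g = sS i" by auto
    then show ?thesis by simp
  next
    case W1
    then have "act g = rv" by auto
    then show ?thesis by simp
  next
    case M0
    then have "act g = mu" by auto
    then show ?thesis by simp
  qed
qed

lemma coord_hom_word: "coord_hom (foldr act u)"
proof (induction u)
  case Nil
  then show ?case using coord_hom_id by (simp add: id_def)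
next
  case (Cons g u)
  then show ?case using coord_hom_comp[OF coord_hom_act Cons] by (simp add: comp_def)
qed

section \<open>Faithfulness\<close>

abbreviation weq :: "gen list \<Rightarrow> gen list \<Rightarrow> bool" (infix "\<sim>" 50) where
  "u \<sim> v \<equiv> word_cong (fund_rel N) u v"

text \<open>A derivation between two words in the s_i may pass through the other generators, so the
  affine permutations have to be extended to all of them. The map x to C - x conjugates
  \<open>perm i\<close> to \<open>perm (C - 1 - i)\<close>, which fixes C modulo the period as 3, 1,
  2 for w_0, w_1, r.\<close>

primrec pact :: "gen \<Rightarrow> int \<Rightarrow> int" where
  "pact (S i) x = perm i x"
| "pact W0 x = 3 - x" | "pact W1 x = 1 - x" | "pact R x = 2 - x"
| "pact M0 x = x" | "pact M1 x = x"

lemma perm_cong: "cong_M i j \<Longrightarrow> perm i = perm j"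
proof -
  assume ij: "cong_M i j"
  then have ij1: "cong_M (i + 1) (j + 1)" by (intro cong_add) simp_all
  have "cong_M x i \<longleftrightarrow> cong_M x j" "cong_M x (i + 1) \<longleftrightarrow> cong_M x (j + 1)" for x
    using ij ij1 cong_sym cong_trans by blast+
  then show ?thesis by (simp add: perm_def fun_eq_iff)
qed

lemma perm_reverse: "c - perm i x = perm (c - 1 - i) (c - x)"
proof -
  have r: "cong_M (c - x) (c - y) \<longleftrightarrow> cong_M x y" for x y
    by (simp add: cong_iff_dvd_diff dvd_diff_commute)
  have "cong_M (c - x) (c - 1 - i) \<longleftrightarrow> cong_M x (i + 1)" "cong_M (c - x) (c - 1 - i + 1) \<longleftrightarrow> cong_M x i"
    using r[of x "i + 1"] r[of x i] by (simp_all add: algebra_simps)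
  then show ?thesis
    using cong_M_offset[of x i 0 1] N_pos by (auto simp: perm_def)
qed

lemma pact_rel: "fund_rel N u v \<Longrightarrow> foldr pact u x = foldr pact v x"
proof (induction arbitrary: x rule: fund_rel.induct)
  case (index i j)
  then show ?case using perm_cong by simp
next
  case (s_braid_succ i)
  then show ?case by (simp add: numeral_3_eq_3 perm_braid[of i] perm_perm)
next
  case (s_braid_pred i)
  have "perm (i - 1) (perm i (perm (i - 1) y)) = perm i (perm (i - 1) (perm i y))" for y
    using perm_braid[of "i - 1" y] by simp
  then show ?case by (simp add: numeral_3_eq_3 perm_perm)
next
  case (s_comm j i)
  have "perm i (perm j y) = perm j (perm i y)" for y
  proof (cases "cong_M i j")
    case True
    then show ?thesis using perm_cong by metis
  next
    case False
    have "\<not> cong_M i (j + 1)"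
      using s_comm(2) cong_add_rcancel[of j 1 "i - 1"] by (metis cong_sym diff_add_cancel)
    with False s_comm(1) show ?thesis by (intro perm_commute)
  qed
  then show ?case by (simp add: numeral_2_eq_2 perm_perm)
next
  case (w0_s i)
  have "perm (3 - 1 - i) = perm (2 * int N - i + 3)"
    by (intro perm_cong cong_M_period) simp
  then show ?case using perm_reverse[of 3 i x] by simp
next
  case (w1_s i)
  have "perm (1 - 1 - i) = perm (2 * int N - i + 1)"
    by (intro perm_cong cong_M_period) simp
  then show ?case using perm_reverse[of 1 i x] by simp
next
  case (r_s i)
  have "perm (2 - 1 - i) = perm (2 * int N - i + 2)"
    by (intro perm_cong cong_M_period) simp
  then show ?case using perm_reverse[of 2 i x] by simp
qed (auto simp: perm_perm)

definition om :: "int list \<Rightarrow> int \<Rightarrow> int" where "om xs = foldr perm xs"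

lemma om_simps: "om [] x = x" "om (xs @ ys) x = om xs (om ys x)" "om [i] x = perm i x"
  by (simp_all add: om_def)

text \<open>Equality in the full extended group, not in a separately presented group generated by
  the s_i.\<close>

definition seq :: "int list \<Rightarrow> int list \<Rightarrow> bool" where
  "seq xs ys \<longleftrightarrow> map S xs \<sim> map S ys"

lemma seq_refl: "seq xs xs" and seq_sym: "seq xs ys \<Longrightarrow> seq ys xs"
  and seq_trans: "seq xs ys \<Longrightarrow> seq ys zs \<Longrightarrow> seq xs zs"
  by (auto simp: seq_def intro: word_cong.intros)

lemma seq_app: "seq xs ys \<Longrightarrow> seq (us @ xs @ vs) (us @ ys @ vs)"
  using word_cong_app[of "fund_rel N" "map S xs" "map S ys" "map S us" "map S vs"] by (simp add: seq_def)

lemma seq_snoc: "seq xs ys \<Longrightarrow> seq (xs @ vs) (ys @ vs)"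
  using seq_app[of xs ys "[]" vs] by simp

lemma seq_rel: "fund_rel N (map S xs) (map S ys) \<Longrightarrow> seq (us @ xs) (us @ ys)"
  using word_cong.rel[of "fund_rel N" "map S xs" "map S ys" "map S us" "[]"] by (simp add: seq_def)

lemma seq_om: "seq xs ys \<Longrightarrow> om xs = om ys"
proof -
  assume "seq xs ys"
  then have "foldr pact (map S xs) = foldr pact (map S ys)"
    unfolding seq_def by (rule fold_word_cong[of "fund_rel N"]) (auto simp: fun_eq_iff pact_rel)
  moreover have "foldr pact (map S zs) = om zs" for zs
    by (induction zs) (auto simp: om_def fun_eq_iff)
  ultimately show ?thesis by simp
qed

lemma seq_square: "seq (us @ [i, i]) us"
  using seq_rel[of "[i, i]" "[]" us] by (simp add: fund_rel.intros)

lemma seq_index: "cong_M i j \<Longrightarrow> seq (us @ [i]) (us @ [j])"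
  using seq_rel[of "[i]" "[j]" us] by (simp add: fund_rel.intros)

text \<open>The generators are involutions, so \<open>rev ws\<close> inverts \<open>ws\<close>; this
  turns a relation stating that a product is 1 into an equation between two words.\<close>

lemma seq_move:
  assumes "seq (us @ vs @ rev ws) us"
  shows "seq (us @ vs) (us @ ws)"
proof -
  have inv: "seq (xs @ rev ys @ ys) xs" for xs ys
  proof (induction ys)
    case (Cons y ys)
    have "seq (xs @ rev ys @ [y, y] @ ys) (xs @ rev ys @ ys)"
      using seq_snoc[OF seq_square[of "xs @ rev ys" y], of ys] by simp
    with Cons show ?case using seq_trans by auto
  qed (simp add: seq_refl)
  have "seq (us @ vs @ rev ws @ ws) (us @ ws)"
    using seq_snoc[OF assms, of ws] by simp
  moreover have "seq (us @ vs @ rev ws @ ws) (us @ vs)"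
    using inv[of "us @ vs" ws] by simp
  ultimately show ?thesis using seq_sym seq_trans by blast
qed

lemma seq_commute:
  assumes "\<not> cong_M j (i + 1)" "\<not> cong_M j (i - 1)"
  shows "seq (us @ [i, j]) (us @ [j, i])"
proof -
  have "fund_rel N (map S [i, j, i, j]) (map S [])"
    using fund_rel.s_comm[OF assms] by (simp add: numeral_2_eq_2)
  from seq_rel[OF this, of us] show ?thesis by (intro seq_move) simp
qed

lemma seq_braid: "seq (us @ [i, i + 1, i]) (us @ [i + 1, i, i + 1])"
proof -
  have "fund_rel N (map S [i, i + 1, i, i + 1, i, i + 1]) (map S [])"
    using fund_rel.s_braid_succ[of N i] by (simp add: numeral_3_eq_3)
  from seq_rel[OF this, of us] show ?thesis by (intro seq_move) simp
qed

definition len :: "int list \<Rightarrow> nat" where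
  "len xs = (LEAST n. \<exists>ys. seq xs ys \<and> length ys = n)"

lemma len_ex: "\<exists>ys. seq xs ys \<and> length ys = len xs"
  unfolding len_def by (rule LeastI[of _ "length xs"]) (use seq_refl in blast)

lemma len_le: "seq xs ys \<Longrightarrow> len xs \<le> length ys"
  unfolding len_def by (rule Least_le) blast

lemma len_seq: "seq xs ys \<Longrightarrow> len xs = len ys"
  using len_ex[of xs] len_ex[of ys] len_le seq_sym seq_trans by (metis le_antisym)

lemma len_append: "len (xs @ vs) \<le> len xs + length vs"
proof -
  obtain ys where "seq xs ys" "length ys = len xs" using len_ex by blast
  then show ?thesis using len_le[OF seq_snoc, of xs ys vs] by simp
qed

text \<open>
  A reflection that does not shorten \<open>w\<close> on the right is sent by \<open>w\<close> to a positive root; the induction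
  peels off the last letter of a reduced word, within the rank two subgroup it generates with \<open>j\<close>.
\<close>

lemma om_positive: "\<not> len (w @ [j]) < len w \<Longrightarrow> om w j < om w (j + 1)"
proof (induction "len w" arbitrary: w j rule: less_induct)
  case less
  show ?case
  proof (cases "len w = 0")
    case True
    then have "seq w []" using len_ex[of w] by auto
    then show ?thesis using seq_om[of w "[]"] by (simp add: om_simps)
  next
    case False
    obtain ys where ys: "seq w ys" "length ys = len w" using len_ex by blast
    with False obtain w' i where w': "ys = w' @ [i]" by (cases ys rule: rev_cases) auto
    have w: "seq w (w' @ [i])" using ys w' by simp
    have "len w' \<le> length w'" by (rule len_le, rule seq_refl)
    moreover have "len w \<le> len w' + 1" using len_seq[OF w] len_append[of w' "[i]"] by simp
    ultimately have lw': "Suc (len w') = len w" using ys w' by simp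
    have omw: "om w x = om w' (perm i x)" for x
      using seq_om[OF w] by (simp add: om_simps)
    have wj: "seq (w @ [j]) (w' @ [i, j])" using seq_snoc[OF w, of "[j]"] by simp
    have not_shorter: "\<not> len v < len w" if "seq (w' @ [i, j]) v" for v
      using less.prems len_seq[OF seq_trans[OF wj that]] by simp
    have up: "om w' k < om w' (k + 1)" if "cong_M k i" for k
    proof -
      have "len (w' @ [k]) = len w"
        using len_seq[OF w] len_seq[OF seq_index[OF that, of w']] by simp
      then show ?thesis using less.hyps[of w' k] lw' by simp
    qed
    have "\<not> cong_M i j"
    proof
      assume ij: "cong_M i j"
      have "seq (w' @ [i, j]) (w' @ [i, i])"
        using seq_index[OF cong_sym[OF ij], of "w' @ [i]"] by simp
      then have "seq (w' @ [i, j]) w'" using seq_square seq_trans by blast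
      then show False using not_shorter[of w'] lw' by simp
    qed
    then have nji: "\<not> cong_M j i" using cong_sym by blast
    consider (above) "cong_M j (i + 1)" | (below) "cong_M j (i - 1)"
      | (far) "\<not> cong_M j (i + 1)" "\<not> cong_M j (i - 1)" by blast
    then show ?thesis
    proof cases
      case far
      have "\<not> len (w' @ [j]) < len w'"
      proof
        assume "len (w' @ [j]) < len w'"
        then have "len ((w' @ [j]) @ [i]) < len w"
          using len_append[of "w' @ [j]" "[i]"] lw' by simp
        then show False using not_shorter[OF seq_commute[OF far]] by simp
      qed
      then have "om w' j < om w' (j + 1)" using less.hyps[of w' j] lw' by simp
      moreover have "perm i j = j"
        using far nji by (intro perm_far)
      moreover have "perm i (j + 1) = j + 1"
        using far cong_add_rcancel[of j 1 i] cong_add_rcancel[of j 1 "i - 1"] nji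
        by (intro perm_far) auto
      ultimately show ?thesis by (simp add: omw)
    next
      case above
      have ji: "cong_M (j - 1) i" using cong_M_offset[OF above, of "- 1" "- 1"] by simp
      have p: "perm i j = j - 1" "perm i (j + 1) = j + 1"
        using perm_above[OF above] cong_M_offset[OF above, of 1 "- 1"] cong_M_offset[OF above, of 1 0] N_pos
        by (auto intro: perm_far)
      have less1: "om w' (j - 1) < om w' j" using up[OF ji] by simp
      show ?thesis
      proof (cases "len (w' @ [j]) < len w'")
        case False
        then have "om w' j < om w' (j + 1)" using less.hyps[of w' j] lw' by simp
        with less1 show ?thesis by (simp add: omw p)
      next
        case True
        \<comment> \<open>Here \<open>w\<close> equals \<open>w'' @ [j, i]\<close> with i congruent
          to \<open>j - 1\<close>. If \<open>j - 1\<close> shortened \<open>w''\<close>, the braid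
          relation would give a word for \<open>w @ [j]\<close> shorter than \<open>w\<close>; so
          the induction hypothesis applies to \<open>w''\<close> at \<open>j - 1\<close>.\<close>
        define w'' where "w'' = w' @ [j]"
        have s: "seq w' (w'' @ [j])" using seq_sym[OF seq_square[of w' j]] by (simp add: w''_def)
        have "\<not> len (w'' @ [j - 1]) < len w''"
        proof
          assume *: "len (w'' @ [j - 1]) < len w''"
          have "seq (w' @ [i, j]) ((w'' @ [j]) @ [i, j])" using seq_snoc[OF s] .
          moreover have "seq ((w'' @ [j]) @ [i, j]) (((w'' @ [j]) @ [j - 1]) @ [j])"
            using seq_snoc[OF seq_index[OF cong_sym[OF ji], of "w'' @ [j]"], of "[j]"] by simp
          moreover have "seq (((w'' @ [j]) @ [j - 1]) @ [j]) ((w'' @ [j - 1]) @ [j, j - 1])"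
            using seq_sym[OF seq_braid[of w'' "j - 1"]] by simp
          ultimately have "\<not> len ((w'' @ [j - 1]) @ [j, j - 1]) < len w"
            using not_shorter seq_trans by blast
          then show False using * len_append[of "w'' @ [j - 1]" "[j, j - 1]"] True lw' by (simp add: w''_def)
        qed
        moreover have "len w'' < len w" using True lw' by (simp add: w''_def)
        ultimately have "om w'' (j - 1) < om w'' j" using less.hyps[of w'' "j - 1"] by simp
        moreover have "perm j (j - 1) = j - 1" "perm j (j + 1) = j"
          using perm_above[of "j + 1" j] cong_M_eq[of "j - 1" j] cong_M_eq[of "j - 1" "j + 1"] N_pos
          by (auto intro: perm_far)
        ultimately show ?thesis
          using seq_om[OF s] by (simp add: omw p om_simps)
      qed
    next
      case below
      have ji: "cong_M (j + 1) i" using cong_M_offset[OF below, of 1 1] by simp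
      have p: "perm i j = j" "perm i (j + 1) = j + 2"
        using perm_at[OF ji] cong_M_offset[OF below, of 0 1] cong_M_offset[OF below, of 0 2] N_pos
        by (auto intro!: perm_far simp: add.commute)
      have less1: "om w' (j + 1) < om w' (j + 2)" using up[OF ji] by (simp add: add.assoc)
      show ?thesis
      proof (cases "len (w' @ [j]) < len w'")
        case False
        then have "om w' j < om w' (j + 1)" using less.hyps[of w' j] lw' by simp
        with less1 show ?thesis by (simp add: omw p)
      next
        case True
        define w'' where "w'' = w' @ [j]"
        have s: "seq w' (w'' @ [j])" using seq_sym[OF seq_square[of w' j]] by (simp add: w''_def)
        have "\<not> len (w'' @ [j + 1]) < len w''"
        proof
          assume *: "len (w'' @ [j + 1]) < len w''"
          have "seq (w' @ [i, j]) ((w'' @ [j]) @ [i, j])" using seq_snoc[OF s] .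
          moreover have "seq ((w'' @ [j]) @ [i, j]) (((w'' @ [j]) @ [j + 1]) @ [j])"
            using seq_snoc[OF seq_index[OF cong_sym[OF ji], of "w'' @ [j]"], of "[j]"] by simp
          moreover have "seq (((w'' @ [j]) @ [j + 1]) @ [j]) ((w'' @ [j + 1]) @ [j, j + 1])"
            using seq_braid[of w'' j] by simp
          ultimately have "\<not> len ((w'' @ [j + 1]) @ [j, j + 1]) < len w"
            using not_shorter seq_trans by blast
          then show False using * len_append[of "w'' @ [j + 1]" "[j, j + 1]"] True lw' by (simp add: w''_def)
        qed
        moreover have "len w'' < len w" using True lw' by (simp add: w''_def)
        ultimately have "om w'' (j + 1) < om w'' (j + 1 + 1)" using less.hyps[of w'' "j + 1"] by simp
        moreover have "perm j j = j + 1" "perm j (j + 2) = j + 2"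
          using perm_at[of j j] cong_M_eq[of "j + 2" j] cong_M_eq[of "j + 2" "j + 1"] N_pos
          by (auto intro: perm_far)
        ultimately show ?thesis
          using seq_om[OF s] by (simp add: omw p om_simps add.assoc)
      qed
    qed
  qed
qed

text \<open>The last letter of a nonempty reduced word is a descent of its permutation, by
  \<open>om_positive\<close> applied to the rest of the word.\<close>

lemma seq_Nil_or_descent: "seq xs [] \<or> (\<exists>i. om xs (i + 1) < om xs i)"
proof (cases "len xs = 0")
  case True
  then show ?thesis using len_ex[of xs] by auto
next
  case False
  obtain ys where ys: "seq xs ys" "length ys = len xs" using len_ex by blast
  with False obtain w i where w: "ys = w @ [i]" by (cases ys rule: rev_cases) auto
  have "len w \<le> length w" by (rule len_le, rule seq_refl)
  then have "len w < len (w @ [i])" using ys w len_seq[OF ys(1)] by simp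
  then have "om w i < om w (i + 1)" using om_positive[of w i] by simp
  moreover have "perm i i = i + 1" "perm i (i + 1) = i"
    using perm_at[of i i] perm_above[of "i + 1" i] by simp_all
  ultimately have "om xs (i + 1) < om xs i"
    using seq_om[OF ys(1)] w by (simp add: om_simps)
  then show ?thesis by blast
qed

lemma sS_aa: "sS j (aa k) = refl_par j k"
proof (cases j rule: residue_cases)
  case 1
  have "sS j (aa k) = refl_par (int (2 * N) + 1) (k - 1 + 1)"
    using 1 N_pos by (simp add: sS_0 ush_simps rf_simps sh_refl_par)
  also have "\<dots> = refl_par j k"
  proof (rule refl_par_cong)
    have "cong_M 0 (int (2 * N) + 1)" by (rule cong_M_period) simp
    then show "cong_M (int (2 * N) + 1) j" using 1 cong_sym cong_trans by blast
  qed simp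
  finally show ?thesis .
next
  case (2 i)
  then show ?thesis
    using refl_par_cong[OF cong_sym[OF 2(2)], of k k] by (simp add: sS_rf rf_simps)
qed

lemma word_al: "foldr act (map S xs) (al m / al n) = al (om xs m) / al (om xs n)"
proof (induction xs)
  case (Cons j xs)
  have "sS j (al m / al n) = al (perm j m) / al (perm j n)" for m n
    by (rule hom_al) (simp_all add: sS_aa refl_par_al)
  with Cons show ?case by (simp add: om_def)
qed (simp add: om_def)

lemma al_descent: "n < m \<Longrightarrow> al m / al n \<noteq> aa k"
proof
  assume "n < m" and eq: "al m / al n = aa k"
  \<comment> \<open>A point where all \<open>aa k\<close> take the same value t; the value of
    \<open>q_par\<close> is dictated by the product over a period. There \<open>al m / al n\<close>
    is a negative power of t, which cannot equal t.\<close>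
  let ?t = "2 ^ (2 * N - 1) :: ratfun"
  let ?v = "coord_map (\<lambda>_. 1) 1 1 (1 / 2 ^ (2 * N + 1)) (\<lambda>_. ?t) (\<lambda>_. 1)"
  note e = eval_coord_map[where D = "\<lambda>_. 1" and B = 1 and C = 1 and Q = "1 / 2 ^ (2 * N + 1)" and A = "\<lambda>_. ?t" and G = "\<lambda>_. 1"]
  have two: "(2::ratfun) \<noteq> 0" by (rule ratfun_two_nonzero)
  have aa: "rat_eval ?v (aa k) ?t" for k
  proof (rule eval_aa[where T = "\<lambda>_. ?t"])
    show "(\<Prod>i=1..2*N. ?t) * ?t = 1 / (1 / 2 ^ (2 * N + 1)) ^ (2 * N - 1)"
      by (simp add: power_one_over power_add flip: power_mult) (simp add: mult.commute)
  qed (use e two in auto)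
  have "rat_eval ?v (al n / al (n + int d)) (?t ^ d)" for d
  proof (induction d)
    case 0
    then show ?case using rat_eval_1 by simp
  next
    case (Suc d)
    have "al n / al (n + int (Suc d)) = al n / al (n + int d) * aa (n + int d)"
      using al_step[of "n + int d"] by (simp add: ac_simps)
    then show ?case using rat_eval_mult[OF Suc aa[of "n + int d"]] by (simp add: mult.commute)
  qed
  from this[of "nat (m - n)"] have "rat_eval ?v (al n / al m * aa k) (?t ^ nat (m - n) * ?t)"
    using \<open>n < m\<close> by (intro rat_eval_mult aa) simp
  moreover have "al n / al m * aa k = 1" using eq by (simp add: field_simps)
  ultimately have "?t ^ nat (m - n) * ?t = 1"
    using rat_eval_1 rat_eval_unique by metis
  then have "(2::ratfun) ^ ((2 * N - 1) * Suc (nat (m - n))) = 1"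
    unfolding power_mult power_Suc by (simp only: mult.commute)
  then have "(of_nat (2 ^ ((2 * N - 1) * Suc (nat (m - n))) - 1) :: ratfun) = 0"
    by (simp add: of_nat_diff)
  moreover have "1 < (2::nat) ^ ((2 * N - 1) * Suc (nat (m - n)))"
    by (rule one_less_power) (use N_pos in auto)
  ultimately show False unfolding ratfun_of_nat_eq_0_iff by simp
qed

text \<open>A word that is not trivial has a descent i, and its image of \<open>aa i\<close> is then
  a ratio of values of \<open>al\<close> in the wrong order, which is never
  \<open>aa i\<close>.\<close>

lemma s_word_faithful:
  assumes "\<And>k. foldr act (map S xs) (aa k) = aa k"
  shows "map S xs \<sim> []"
proof (rule ccontr)
  assume "\<not> map S xs \<sim> []"
  then obtain i where i: "om xs (i + 1) < om xs i"
    using seq_Nil_or_descent[of xs] by (auto simp: seq_def)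
  have "al (om xs i) / al (om xs (i + 1)) = aa i"
    using word_al[of xs i "i + 1"] assms[of i] by (simp add: al_ratio)
  then show False using al_descent[OF i] by blast
qed

section \<open>The action on the field of coordinates\<close>

lemma params_subset_coords: "params N \<subseteq> coords N"
  by (simp add: coords_def)

lemma in_gen_field:
  assumes "params N \<subseteq> V"
  shows "b_par \<in> gen_field V" "c_par \<in> gen_field V" "q_par \<in> gen_field V" "aa k \<in> gen_field V" "AA k \<in> gen_field V"
proof -
  show b: "b_par \<in> gen_field V" "c_par \<in> gen_field V" and q: "q_par \<in> gen_field V"
    using assms by (auto simp: params_def intro: gen_field.var)
  have a: "a_par i \<in> gen_field V" if "i \<in> {1..2*N}" for i
  proof (rule gen_field.var)
    have "a_par i \<in> params N" using that unfolding params_def by blast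
    then show "a_par i \<in> V" using assms by blast
  qed
  have "aa (int i) \<in> gen_field V" if "i \<le> 2 * N" for i
  proof (cases "i = 0")
    case True
    then show ?thesis by (auto simp: aa_0 intro!: gen_field_intros q a)
  next
    case False
    then show ?thesis using that a[of i] by (simp add: aa_a_par)
  qed
  moreover have "aa k = aa (int (nat (k mod (2 * int N + 1))))" by (simp add: aa_mod)
  moreover have "nat (k mod (2 * int N + 1)) \<le> 2 * N"
    using pos_mod_bound[of "2 * int N + 1" k] by linarith
  ultimately show "aa k \<in> gen_field V" by metis
  then show "AA k \<in> gen_field V" by (simp only: AA_def gen_field_power)
qed

lemma ff_in: "i \<in> {1..2*N} \<Longrightarrow> ff i \<in> gen_field (coords N)"
  using in_gen_field[OF params_subset_coords] gen_field.var[of "F_var i" "coords N"]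
  by (auto simp: ff_def coords_def intro!: gen_field_intros)

lemmas par_in = in_gen_field[OF order_refl] in_gen_field[OF params_subset_coords]

lemma refl_par_in: "params N \<subseteq> V \<Longrightarrow> refl_par j k \<in> gen_field V"
  using in_gen_field by (auto simp: refl_par_def intro!: gen_field_intros)

lemma fx_in: "i \<le> 2 * N + 1 \<Longrightarrow> fx i \<in> gen_field (coords N)"
proof -
  have r: "2 * k \<in> {1..2*N}" if "k \<in> {1..N}" for k using that by auto
  have K: "KK \<in> gen_field (coords N)"
    unfolding KK_eq by (intro gen_field_intros par_in)
  have X: "XX \<in> gen_field (coords N)"
    unfolding XX_def by (intro gen_field_intros par_in K ff_in odd_in_range)
  have Y: "YY \<in> gen_field (coords N)"
    unfolding YY_def by (intro gen_field_intros par_in K ff_in r)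
  assume "i \<le> 2 * N + 1"
  then consider "i = 0" | "i = 2 * N + 1" | "i \<in> {1..2*N}" by force
  then show ?thesis
  proof cases
    case 1
    show ?thesis unfolding 1 fx_simps by (intro gen_field_intros par_in X Y)
  next
    case 2
    show ?thesis unfolding 2 fx_simps by (intro gen_field_intros par_in X Y)
  qed (simp add: fx_simps ff_in)
qed

lemma rr_in: "j \<in> {1..2*N} \<Longrightarrow> rr j \<in> gen_field (coords N)"
  unfolding rr_def by (intro gen_field_intros par_in ff_in)

lemma HH_in: "i \<le> 2 * N + 2 \<Longrightarrow> HH i \<in> gen_field (coords N)"
proof -
  have t: "tt j \<in> gen_field (coords N)" if "j \<le> 2 * N + 1" for j
    unfolding tt_def ph_def using that
    by (auto intro!: gen_field_intros par_in ff_in)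
  show "i \<le> 2 * N + 2 \<Longrightarrow> HH i \<in> gen_field (coords N)"
    unfolding HH_def rho_def by (intro gen_field_intros par_in t) auto
qed

definition stable :: "(ratfun \<Rightarrow> ratfun) \<Rightarrow> bool" where
  "stable \<phi> \<longleftrightarrow> (\<forall>x\<in>gen_field (coords N). \<phi> x \<in> gen_field (coords N)) \<and>
     (\<forall>x\<in>gen_field (params N). \<phi> x \<in> gen_field (params N))"

lemma stableI:
  assumes h: "coord_hom \<phi>"
    and p: "\<phi> b_par \<in> gen_field (params N)" "\<phi> c_par \<in> gen_field (params N)" "\<phi> q_par \<in> gen_field (params N)"
      "\<And>i. i \<in> {1..2*N} \<Longrightarrow> \<phi> (aa (int i)) \<in> gen_field (params N)"
    and f: "\<And>i. i \<in> {1..2*N} \<Longrightarrow> \<phi> (ff i) \<in> gen_field (coords N)"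
  shows "stable \<phi>"
proof -
  have mono: "gen_field (params N) \<subseteq> gen_field (coords N)"
  proof
    show "x \<in> gen_field (coords N)" if "x \<in> gen_field (params N)" for x
      by (rule gen_field_hom[OF field_hom_id _ that]) (use params_subset_coords in \<open>auto intro: gen_field.var\<close>)
  qed
  have P: "\<phi> x \<in> gen_field (params N)" if "x \<in> params N" for x
    using that p by (auto simp: params_def aa_a_par)
  have "\<phi> (F_var i) \<in> gen_field (coords N)" if "i \<in> {1..2*N}" for i
  proof -
    have "F_var i = (if even i then ff i / c_par\<^sup>2 else ff i * c_par\<^sup>2)" by (simp add: ff_def)
    then have "\<phi> (F_var i) = (if even i then \<phi> (ff i) / (\<phi> c_par)\<^sup>2 else \<phi> (ff i) * (\<phi> c_par)\<^sup>2)"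
      by (simp add: hom_simps[OF coord_hom_field_hom[OF h]])
    then show ?thesis using f[OF that] p(2) mono by (auto intro!: gen_field_intros)
  qed
  then have "\<phi> x \<in> gen_field (coords N)" if "x \<in> coords N" for x
    using that P mono by (auto simp: coords_def)
  with P show ?thesis
    unfolding stable_def using gen_field_hom[OF coord_hom_field_hom[OF h]] by blast
qed

lemma stable_comp: "stable \<phi> \<Longrightarrow> stable \<psi> \<Longrightarrow> stable (\<lambda>x. \<phi> (\<psi> x))"
  by (simp add: stable_def)

lemma stable_basic:
  shows stable_sh: "stable sh" and stable_ush: "stable ush" and stable_rv: "stable rv"
    and stable_mu: "stable mu" and stable_rf: "j \<in> {1..2*N} \<Longrightarrow> stable (rf j)"
proof -
  show "stable sh"
  proof (rule stableI)
    show "sh (ff i) \<in> gen_field (coords N)" if "i \<in> {1..2*N}" for i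
      using that fx_in[of "i + 1"] by (simp add: sh_ff)
  qed (simp only: coord_hom_sh, (simp only: sh_simps, intro gen_field_intros par_in)+)
  show "stable ush"
  proof (rule stableI)
    show "ush (ff i) \<in> gen_field (coords N)" if "i \<in> {1..2*N}" for i
    proof -
      have "i - 1 \<le> 2 * N + 1" using that by auto
      then show ?thesis using that ush_fx[of i] fx_in[of "i - 1"] by (simp add: fx_simps(3))
    qed
  qed (simp only: coord_hom_ush, (simp only: ush_simps, intro gen_field_intros par_in)+)
  show "stable rv"
  proof (rule stableI)
    show "rv (ff i) \<in> gen_field (coords N)" if "i \<in> {1..2*N}" for i
    proof -
      have "2 * N + 1 - i \<in> {1..2*N}" using that by auto
      then show ?thesis using that ff_in[of "2 * N + 1 - i"] by (simp only: rv_ff)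
    qed
  qed (simp only: coord_hom_rv, (simp only: rv_simps, intro gen_field_intros par_in)+)
  show "stable mu"
  proof (rule stableI)
    show "mu (ff i) \<in> gen_field (coords N)" if "i \<in> {1..2*N}" for i
    proof -
      have "ff i \<in> gen_field (coords N)" "HH i \<in> gen_field (coords N)" "HH (i + 2) \<in> gen_field (coords N)"
        using that by (auto intro!: ff_in HH_in)
      then show ?thesis
        unfolding mu_ff[OF that] by (cases "even i") (simp_all add: gen_field_divide gen_field.mult)
    qed
  qed (simp only: coord_hom_mu, (simp only: mu_simps, intro gen_field_intros par_in)+)
  show "stable (rf j)" if j: "j \<in> {1..2*N}"
  proof (rule stableI[OF coord_hom_rf[OF j]])
    show "rf j (ff i) \<in> gen_field (coords N)" if "i \<in> {1..2*N}" for i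
      unfolding rf_ff[OF j that] using ff_in[OF that] rr_in[OF j]
      by (simp add: gen_field_divide gen_field.mult gen_field_1)
    show "rf j (aa (int i)) \<in> gen_field (params N)" for i
      using refl_par_in by (simp add: rf_simps[OF j])
  qed (simp only: rf_simps[OF j], rule par_in)+
qed

lemma stable_act: "stable (act g)"
proof -
  have R: "stable (\<lambda>x. rv (ush x))" by (rule stable_comp[OF stable_rv stable_ush])
  show ?thesis
  proof (cases g)
    case (S j)
    have "stable (sS j)"
    proof (cases j rule: residue_cases)
      case 1
      have "stable (\<lambda>x. sh (rf (2 * N) (ush x)))"
        by (rule stable_comp[OF stable_sh stable_comp[OF stable_rf stable_ush]]) (use N_pos in simp)
      moreover have "sS j = (\<lambda>x. sh (rf (2 * N) (ush x)))" using sS_0[OF 1] by blast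
      ultimately show ?thesis by simp
    next
      case (2 i)
      then have "sS j = rf i" using sS_rf[OF 2] by blast
      then show ?thesis using stable_rf[OF 2(1)] by simp
    qed
    moreover have "act g = sS j" using S by auto
    ultimately show ?thesis by simp
  next
    case W0
    then have "act g = (\<lambda>x. rv (ush (ush x)))" by auto
    then show ?thesis using stable_comp[OF R stable_ush] by simp
  next
    case M1
    then have "act g = (\<lambda>x. rv (ush (mu (rv (ush x)))))" by auto
    then show ?thesis using stable_comp[OF R stable_comp[OF stable_mu R]] by simp
  next
    case R
    then have "act g = (\<lambda>x. rv (ush x))" by auto
    then show ?thesis using \<open>stable (\<lambda>x. rv (ush x))\<close> by simp
  next
    case W1
    then have "act g = rv" by auto
    then show ?thesis using stable_rv by simp
  next
    case M0
    then have "act g = mu" by auto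
    then show ?thesis using stable_mu by simp
  qed
qed

lemma stable_word: "stable (foldr act u)"
proof (induction u)
  case Nil
  then show ?case by (simp add: stable_def)
next
  case (Cons g u)
  then show ?case using stable_comp[OF stable_act Cons] by (simp add: comp_def)
qed

section \<open>Normal form of words and the kernel\<close>

lemma weq_rel: "fund_rel N u v \<Longrightarrow> x @ u @ y \<sim> x @ v @ y"
  by (rule word_cong.rel)

lemma weq_trans [trans]: "u \<sim> v \<Longrightarrow> v \<sim> w \<Longrightarrow> u \<sim> w"
  by (rule word_cong.trans)

lemma weq_Cons: "u \<sim> v \<Longrightarrow> g # u \<sim> g # v"
  using word_cong_app[of "fund_rel N" u v "[g]" "[]"] by simp

lemma weq_append: "u \<sim> v \<Longrightarrow> u' \<sim> v' \<Longrightarrow> u @ u' \<sim> v @ v'"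
  by (rule word_cong_append)

lemma weq_move:
  assumes "\<And>h. h \<in> H \<Longrightarrow> \<exists>h'\<in>H. fund_rel N [g, h] [h', g]" "set u \<subseteq> H"
  shows "\<exists>u'. set u' \<subseteq> H \<and> g # u \<sim> u' @ [g]"
  using assms(2)
proof (induction u)
  case Nil
  then show ?case using word_cong.refl[of "fund_rel N" "[g]"] by (intro exI[of _ "[]"]) simp
next
  case (Cons h u)
  then have hu: "h \<in> H" "set u \<subseteq> H" by auto
  obtain h' where h': "h' \<in> H" "fund_rel N [g, h] [h', g]" using assms(1)[OF hu(1)] by blast
  obtain u' where u': "set u' \<subseteq> H" "g # u \<sim> u' @ [g]" using Cons.IH[OF hu(2)] by blast
  have "g # h # u \<sim> h' # g # u" using weq_rel[OF h'(2), of "[]" u] by simp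
  also have "h' # g # u \<sim> h' # u' @ [g]" by (rule weq_Cons[OF u'(2)])
  finally show ?case using h' u' by (intro exI[of _ "h' # u'"]) simp
qed

lemma fund_rel_S_move: "g \<notin> range S \<Longrightarrow> \<exists>h'\<in>range S. fund_rel N [g, S i] [h', g]"
  by (cases g) (auto intro: fund_rel.intros)

lemma fund_rel_commutes:
  assumes "m \<in> {M0, M1}" "w \<in> {W0, W1}"
  shows "\<exists>w'\<in>{W0, W1}. fund_rel N [m, w] [w', m]"
  using assms by (intro bexI[of _ w] fund_rel.m_w) auto

lemma fund_rel_R_move:
  "w \<in> {W0, W1} \<Longrightarrow> \<exists>w'\<in>{W0, W1}. fund_rel N [R, w] [w', R]"
  "m \<in> {M0, M1} \<Longrightarrow> \<exists>m'\<in>{M0, M1}. fund_rel N [R, m] [m', R]"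
  using fund_rel.r_w0[of N] fund_rel.r_w1[of N] fund_rel.r_m0[of N] fund_rel.r_m1[of N] by auto

text \<open>Induction on the letter put in front: the relations let it pass each earlier block, at
  most permuting the letters of that block, until it reaches its own.\<close>

lemma weq_normal_form:
  "\<exists>xs ds ms rs. u \<sim> map S xs @ ds @ ms @ rs \<and> set ds \<subseteq> {W0, W1} \<and> set ms \<subseteq> {M0, M1} \<and> rs \<in> {[], [R]}"
proof (induction u)
  case Nil
  show ?case using word_cong.refl[of "fund_rel N" "[]"]
    by (intro exI[of _ "[]"]) simp
next
  case (Cons g u)
  then obtain xs ds ms rs where *: "u \<sim> map S xs @ ds @ ms @ rs"
    "set ds \<subseteq> {W0, W1}" "set ms \<subseteq> {M0, M1}" "rs \<in> {[], [R]}" by blast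
  show ?case
  proof (cases "g \<in> range S")
    case True
    then obtain i where "g = S i" by blast
    then show ?thesis using * weq_Cons[OF *(1), of g] by (intro exI[of _ "i # xs"] exI) auto
  next
    case False
    have "set (map S xs) \<subseteq> range S" by auto
    then obtain u' where u': "set u' \<subseteq> range S" "g # map S xs \<sim> u' @ [g]"
      using weq_move[of "range S" g "map S xs"] fund_rel_S_move[OF False] by blast
    then obtain ys where ys: "u' = map S ys"
      by (metis ex_map_conv image_iff subset_eq)
    have gu: "g # u \<sim> map S ys @ g # ds @ ms @ rs"
      using weq_trans[OF weq_Cons[OF *(1), of g]] weq_append[OF u'(2) word_cong.refl[of _ "ds @ ms @ rs"]] ys by simp
    consider "g \<in> {W0, W1}" | "g \<in> {M0, M1}" | "g = R" using False by (cases g) auto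
    then show ?thesis
    proof cases
      case 1
      then show ?thesis using gu * by (intro exI[of _ ys] exI[of _ "g # ds"] exI[of _ ms] exI[of _ rs]) simp
    next
      case 2
      then obtain ds' where "set ds' \<subseteq> {W0, W1}" "g # ds \<sim> ds' @ [g]"
        using weq_move[of "{W0, W1}" g ds] fund_rel_commutes *(2) by blast
      moreover from this have "g # u \<sim> map S ys @ ds' @ (g # ms) @ rs"
        using weq_trans[OF gu] weq_append[OF word_cong.refl[of _ "map S ys"] weq_append[OF _ word_cong.refl[of _ "ms @ rs"]]] by force
      ultimately show ?thesis
        using 2 * by (intro exI[of _ ys] exI[of _ ds'] exI[of _ "g # ms"] exI[of _ rs]) simp
    next
      case 3
      obtain ds' where d: "set ds' \<subseteq> {W0, W1}" "R # ds \<sim> ds' @ [R]"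
        using weq_move[of "{W0, W1}" R ds] fund_rel_R_move(1) *(2) by blast
      obtain ms' where m: "set ms' \<subseteq> {M0, M1}" "R # ms \<sim> ms' @ [R]"
        using weq_move[of "{M0, M1}" R ms] fund_rel_R_move(2) *(3) by blast
      obtain rs' where r: "rs' \<in> {[], [R]}" "R # rs \<sim> rs'"
        using *(4) weq_rel[OF fund_rel.r_sq[of N], of "[]" "[]"] word_cong.refl[of "fund_rel N" "[R]"]
        by (cases "rs = []") auto
      have "(R # ds) @ ms @ rs \<sim> ds' @ (R # ms) @ rs"
        using weq_append[OF d(2) word_cong.refl[of _ "ms @ rs"]] by simp
      also have "ds' @ (R # ms) @ rs \<sim> ds' @ ms' @ R # rs"
        using weq_append[OF word_cong.refl[of _ ds'] weq_append[OF m(2) word_cong.refl[of _ rs]]] by simp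
      also have "ds' @ ms' @ R # rs \<sim> ds' @ ms' @ rs'"
        using weq_append[OF word_cong.refl[of _ "ds' @ ms'"] r(2)] by simp
      finally have "g # u \<sim> map S ys @ ds' @ ms' @ rs'"
        using weq_trans[OF gu] weq_append[OF word_cong.refl[of _ "map S ys"]] 3 by auto
      with d m r show ?thesis by blast
    qed
  qed
qed

section \<open>Reading off the remaining factors from b, c and q\<close>

fun alt :: "gen \<Rightarrow> gen \<Rightarrow> nat \<Rightarrow> gen list" where
  "alt g h 0 = []"
| "alt g h (Suc k) = g # alt h g k"

lemma weq_alt:
  assumes "set u \<subseteq> {g, h}"
  shows "\<exists>k. u \<sim> alt g h k \<or> u \<sim> alt h g k"
  using assms
proof (induction u)
  case Nil
  then show ?case using word_cong.refl[of "fund_rel N" "[]"] by (intro exI[of _ 0]) simp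
next
  case (Cons a u)
  have prepend: "\<exists>k. x # u \<sim> alt x y k \<or> x # u \<sim> alt y x k" if u: "u \<sim> alt x y k \<or> u \<sim> alt y x k" for x y k
  proof (cases "u \<sim> alt y x k")
    case True
    then have "x # u \<sim> alt x y (Suc k)" using weq_Cons by simp
    then show ?thesis by blast
  next
    case False
    with u have xu: "u \<sim> alt x y k" by simp
    show ?thesis
    proof (cases k)
      case 0
      then have "x # u \<sim> alt x y 1" using weq_Cons[OF xu, of x] by simp
      then show ?thesis by blast
    next
      case (Suc l)
      have "x # u \<sim> x # x # alt y x l" using weq_Cons[OF xu, of x] Suc by simp
      moreover have "x # x # alt y x l \<sim> alt y x l"
        using weq_rel[OF fund_rel_involution[of N x], of "[]" "alt y x l"] by simp
      ultimately show ?thesis using weq_trans by blast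
    qed
  qed
  from Cons obtain k where "u \<sim> alt g h k \<or> u \<sim> alt h g k" by auto
  moreover have "a = g \<or> a = h" using Cons.prems by auto
  ultimately show ?case using prepend[of g h k] prepend[of h g k] by blast
qed

lemma q_power_eq_1: "q_par ^ n = 1 \<Longrightarrow> n = 0"
proof (rule ccontr)
  assume eq: "q_par ^ n = 1" and "n \<noteq> 0"
  let ?v = "coord_map (\<lambda>_. 1) 1 1 2 (\<lambda>_. 1) (\<lambda>_. 1)"
  note e = eval_coord_map[where D = "\<lambda>_. 1" and B = 1 and C = 1 and Q = 2 and A = "\<lambda>_. 1" and G = "\<lambda>_. 1"]
  have "rat_eval ?v (q_par ^ n) (2 ^ n)" by (intro rat_eval_power e)
  then have "(2::ratfun) ^ n = 1" using eq rat_eval_1 rat_eval_unique by metis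
  then have "(of_nat (2 ^ n - 1) :: ratfun) = 0" by (simp add: of_nat_diff)
  moreover have "1 < (2::nat) ^ n" by (rule one_less_power) (use \<open>n \<noteq> 0\<close> in auto)
  ultimately show False unfolding ratfun_of_nat_eq_0_iff by simp
qed

lemma q_powi_eq_1: "q_par powi z = 1 \<Longrightarrow> z = 0"
proof (cases "z \<ge> 0")
  case True
  then obtain n where "z = int n" using nonneg_int_cases by blast
  then show "q_par powi z = 1 \<Longrightarrow> z = 0" using q_power_eq_1[of n] by simp
next
  case False
  then obtain n where "z = - int n" by (metis int_cases2 le_cases of_nat_0_le_iff)
  then show "q_par powi z = 1 \<Longrightarrow> z = 0" using q_power_eq_1[of n] by (simp add: power_int_minus)
qed

lemma hom_powi: "field_hom \<phi> \<Longrightarrow> \<phi> (x powi z) = \<phi> x powi z"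
  by (simp add: power_int_def hom_simps)

text \<open>The exponent of \<open>q\<^bsup>2N-1\<^esup>\<close> in the image of \<open>b\<close>.\<close>

primrec bexp :: "gen \<Rightarrow> int \<Rightarrow> int" where
  "bexp (S i) z = z"
| "bexp W0 z = - (2 * int N + 3) - z" | "bexp W1 z = - (2 * int N + 1) - z" | "bexp R z = - (2 * int N + 2) - z"
| "bexp M0 z = z" | "bexp M1 z = z"

lemma sS_bcq: "sS j b_par = b_par" "sS j c_par = c_par" "sS j q_par = q_par"
proof -
  have "sS j b_par = b_par \<and> sS j c_par = c_par \<and> sS j q_par = q_par"
  proof (cases j rule: residue_cases)
    case 1
    then show ?thesis using N_pos by (simp add: sS_0 ush_simps rf_simps sh_simps hom_simps coord_hom_rf)
  next
    case (2 i)
    then show ?thesis by (simp add: sS_rf rf_simps)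
  qed
  then show "sS j b_par = b_par" "sS j c_par = c_par" "sS j q_par = q_par" by simp_all
qed

definition qL :: ratfun where "qL = q_par ^ (2 * N - 1)"

lemma qL_nonzero [simp]: "qL \<noteq> 0" by (simp add: qL_def)

lemma act_bexp: "act g (b_par * qL powi z) = b_par * qL powi bexp g z"
proof -
  have q: "rv qL = inverse qL" "ush qL = qL" "mu qL = qL" "sS i qL = qL" for i
    by (simp_all add: qL_def hom_simps rv_simps ush_simps mu_simps sS_bcq power_one_over inverse_eq_divide)
  have "q_par ^ ((2 * N - 1) * (2 * N + 1)) = qL powi (2 * int N + 1)"
    using power_int_of_nat[of qL "2 * N + 1"] unfolding qL_def power_mult by (simp add: add.commute)
  then have b: "rv b_par = b_par * qL powi (- (2 * int N + 1))"
    by (simp only: rv_simps divide_inverse power_int_minus)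
  have b': "ush b_par = b_par * qL powi 1"
    by (simp add: ush_simps qL_def)
  have p: "qL powi x * (qL powi y * w) = qL powi (x + y) * w" "qL powi x * qL powi y = qL powi (x + y)" for x y w
    by (simp_all add: power_int_add)
  have inv: "inverse qL powi x = qL powi (- x)" for x
    by (simp add: power_int_inverse power_int_minus)
  have W1: "rv (b_par * qL powi x) = b_par * qL powi (- (2 * int N + 1) - x)" for x
    by (simp only: hom_mult[OF coord_hom_field_hom[OF coord_hom_rv]] hom_powi[OF coord_hom_field_hom[OF coord_hom_rv]]
        b b' q inv mult.assoc p) simp
  have U: "ush (b_par * qL powi x) = b_par * qL powi (1 + x)" for x
    by (simp only: hom_mult[OF coord_hom_field_hom[OF coord_hom_ush]] hom_powi[OF coord_hom_field_hom[OF coord_hom_ush]]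
        b b' q inv mult.assoc p)
  have M: "mu (b_par * qL powi x) = b_par * qL powi x" for x
    by (simp add: hom_mult hom_powi mu_simps q)
  have s: "sS i (b_par * qL powi x) = b_par * qL powi x" for x i
    by (simp add: hom_mult hom_powi sS_bcq q)
  have e: "- (2 * int N + 1) - (1 + (1 + z)) = - (2 * int N + 3) - z" "- (2 * int N + 1) - (1 + z) = - (2 * int N + 2) - z"
    by simp_all
  show ?thesis
  proof (cases g)
    case M1
    have "1 + (- (2 * int N + 1) - (1 + z)) = - (2 * int N + 1) - z" by simp
    then show ?thesis using M1 by (simp only: act.simps bexp.simps W1 U M) simp
  qed (simp_all only: act.simps bexp.simps W1 U M s e)
qed

lemma word_bexp: "foldr act u (b_par * qL powi z) = b_par * qL powi foldr bexp u z"
  by (induction u) (simp_all add: act_bexp)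

text \<open>Up to inversion, \<open>M0\<close> and \<open>M1\<close> act on the monomials \<open>c q\<^bsup>(2N+1)z\<^esup>\<close> by the reflections \<open>cexp\<close> in the exponent.\<close>

definition cexp :: "gen \<Rightarrow> int \<Rightarrow> int" where
  "cexp g z = (if g = M0 then 1 - z else - 1 - z)"

definition cmon :: "int \<Rightarrow> ratfun" where
  "cmon z = c_par * (q_par ^ (2 * N + 1)) powi z"

lemma act_cexp:
  assumes "g \<in> {M0, M1}"
  shows "act g (cmon z) = inverse (cmon (cexp g z))"
proof -
  define w where "w = q_par ^ (2 * N + 1)"
  have w: "w \<noteq> 0" "mu w = w" "ush w = w" "rv w = inverse w"
    by (simp_all only: w_def hom_power[OF coord_hom_field_hom] coord_hom_mu coord_hom_ush coord_hom_rv
        mu_simps ush_simps rv_simps) (simp_all add: power_one_over inverse_eq_divide)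
  have m: "mu c_par = inverse c_par * inverse w" by (simp add: mu_simps w_def divide_inverse)
  have inv: "inverse w powi x = w powi (- x)" for x by (simp add: power_int_inverse power_int_minus)
  have mu: "mu (c_par * w powi x) = inverse (c_par * w powi (1 - x))" for x
    using w by (simp add: hom_mult hom_powi m power_int_diff field_simps)
  have rr: "rv (ush (c_par * w powi x)) = c_par * w powi (- x)" for x
    by (simp add: hom_mult hom_powi hom_divide hom_1 ush_simps rv_simps w inv)
  have inj: "rv (ush (inverse y)) = inverse (rv (ush y))" for y by (simp add: hom_inverse)
  show ?thesis
    using assms
  proof (elim insertE)
    assume "g = M1"
    moreover have "rv (ush (mu (rv (ush (c_par * w powi z))))) = inverse (c_par * w powi (- 1 - z))"
      by (simp only: rr mu inj) simp
    ultimately show ?thesis unfolding cmon_def w_def[symmetric] by (simp only: act.simps cexp_def) simp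
  qed (simp_all only: cmon_def w_def[symmetric] act.simps cexp_def mu simp_thms if_True empty_iff)
qed

lemma word_cexp:
  assumes "set u \<subseteq> {M0, M1}"
  shows "foldr act u (cmon z) = (if even (length u) then cmon (foldr cexp u z) else inverse (cmon (foldr cexp u z)))"
  using assms
proof (induction u)
  case (Cons g u)
  have "act g (inverse x) = inverse (act g x)" for x
    using coord_hom_act[of g] by (simp add: hom_inverse)
  with Cons show ?case using act_cexp[of g] by simp
qed simp

lemma foldr_alt_bexp:
  "foldr bexp (alt W0 W1 (2 * k)) z = z - 2 * int k" "foldr bexp (alt W1 W0 (2 * k)) z = z + 2 * int k"
  by (induction k arbitrary: z) simp_all

lemma foldr_alt_cexp:
  "foldr cexp (alt M0 M1 (2 * k)) z = z + 2 * int k" "foldr cexp (alt M1 M0 (2 * k)) z = z - 2 * int k"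
  by (induction k arbitrary: z) (simp_all add: cexp_def)

text \<open>The constants of \<open>W0\<close> and \<open>W1\<close> in \<open>bexp\<close> are odd,
  so each of these letters changes the parity; the constant of \<open>R\<close> is even.\<close>

lemma parity_bexp: "set u \<subseteq> {W0, W1} \<Longrightarrow> even (foldr bexp u z) \<longleftrightarrow> even (z + int (length u))"
  by (induction u) auto

lemma length_alt [simp]: "length (alt g h k) = k"
  by (induction k arbitrary: g h) simp_all

lemma set_alt: "set (alt g h k) \<subseteq> {g, h}"
  by (induction k arbitrary: g h) auto

lemma word_q: "foldr act u q_par =
    (if even (length (filter (\<lambda>g. g \<in> {W0, W1, R}) u)) then q_par else inverse q_par)"
proof (induction u)
  case (Cons g u)
  have "act g q_par = (if g \<in> {W0, W1, R} then inverse q_par else q_par)"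
    by (cases g) (simp_all add: sS_bcq rv_simps ush_simps mu_simps hom_inverse inverse_eq_divide hom_divide hom_1)
  moreover have "act g (inverse x) = inverse (act g x)" for x
    using coord_hom_act[of g] by (simp add: hom_inverse)
  ultimately show ?case using Cons by simp
qed simp

lemma rat_eval_powi: "rat_eval v x y \<Longrightarrow> y \<noteq> 0 \<Longrightarrow> rat_eval v (x powi z) (y powi z)"
  unfolding power_int_def by (simp add: rat_eval_power rat_eval_inverse)

text \<open>The order in which the parameters are used matters: w_0 and w_1 invert c, and r inverts
  q, so the word in \<mu>_0, \<mu>_1 can be read off from c only after b and q have eliminated these
  factors.\<close>

lemma word_kernel:
  assumes "foldr act u b_par = b_par" "foldr act u c_par = c_par" "\<And>k. foldr act u (aa k) = aa k"
    and "foldr act u q_par = q_par"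
  shows "u \<sim> []"
proof -
  obtain xs ds ms rs where nf: "u \<sim> map S xs @ ds @ ms @ rs"
    "set ds \<subseteq> {W0, W1}" "set ms \<subseteq> {M0, M1}" "rs \<in> {[], [R]}" using weq_normal_form by blast
  obtain k where k: "ds \<sim> alt W0 W1 k \<or> ds \<sim> alt W1 W0 k" using weq_alt[OF nf(2)] by blast
  then obtain d where d: "d = alt W0 W1 k \<or> d = alt W1 W0 k" "ds \<sim> d" by blast
  have dset: "set d \<subseteq> {W0, W1}" using d(1) set_alt[of W0 W1 k] set_alt[of W1 W0 k] by auto
  obtain l where "ms \<sim> alt M0 M1 l \<or> ms \<sim> alt M1 M0 l" using weq_alt[OF nf(3)] by blast
  then obtain m where m: "m = alt M0 M1 l \<or> m = alt M1 M0 l" "ms \<sim> m" by blast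
  have mset: "set m \<subseteq> {M0, M1}" using m(1) set_alt[of M0 M1 l] set_alt[of M1 M0 l] by auto
  have u: "u \<sim> map S xs @ d @ m @ rs"
    using nf(1) weq_append[OF word_cong.refl[of _ "map S xs"] weq_append[OF d(2) weq_append[OF m(2) word_cong.refl[of _ rs]]]]
    by (rule weq_trans)
  have fS: "foldr bexp (map S xs) z = z" for z by (induction xs) simp_all
  have fM: "foldr bexp m z = z" for z
    using mset by (induction m) auto
  have L: "(2::nat) * N - 1 > 0" using N_pos by simp
  have b0: "foldr bexp (d @ rs) 0 = 0"
  proof -
    have "foldr act u b_par = b_par * qL powi foldr bexp (map S xs @ d @ m @ rs) 0"
      using word_bexp[of "map S xs @ d @ m @ rs" 0] act_cong[OF u] by simp
    then have "qL powi foldr bexp (d @ rs) 0 = 1" using assms(1) by (simp add: fS fM)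
    then have "q_par powi (int (2 * N - 1) * foldr bexp (d @ rs) 0) = 1"
      by (simp add: qL_def power_int_mult)
    then show ?thesis using q_powi_eq_1 L by fastforce
  qed
  have "d = [] \<and> rs = []"
  proof (cases "rs = []")
    case True
    then have "even k" using b0 parity_bexp[OF dset, of 0] d(1) by auto
    then obtain k' where "k = 2 * k'" by (elim evenE)
    then show ?thesis using b0 d(1) True foldr_alt_bexp[of k' 0] by auto
  next
    \<comment> \<open>The constant of \<open>R\<close> and the total exponent 0 are even, so the
      number of letters \<open>W0\<close>, \<open>W1\<close> is even. Together with
      \<open>R\<close>, an odd number of letters inverts q, which contradicts that q is
      fixed.\<close>
    case False
    then have "rs = [R]" using nf(4) by simp
    then have "even (foldr bexp d (- (2 * int N + 2)))" using b0 by simp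
    then have "even k" using parity_bexp[OF dset] d(1) by auto
    then have odd: "odd (length (filter (\<lambda>g. g \<in> {W0, W1, R}) (map S xs @ d @ m @ rs)))"
    proof -
      have "filter (\<lambda>g. g \<in> {W0, W1, R}) (map S xs) = []" by (induction xs) simp_all
      moreover have "filter (\<lambda>g. g \<in> {W0, W1, R}) d = d" using dset by (intro filter_True) auto
      moreover have "filter (\<lambda>g. g \<in> {W0, W1, R}) m = []" using mset by (intro filter_False) auto
      moreover have "length d = k" using d(1) by auto
      ultimately show ?thesis using \<open>rs = [R]\<close> \<open>even k\<close> by simp
    qed
    have "foldr act (map S xs @ d @ m @ rs) q_par = inverse q_par"
      unfolding word_q using odd by (simp only: if_False)
    then have "inverse q_par = q_par"
      using act_cong[OF u] assms(4) by (simp only:)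
    then have "q_par * q_par = 1" using coordinates_nonzero(3) by (metis right_inverse)
    then have "q_par ^ 2 = 1" by (simp add: power2_eq_square)
    then show ?thesis using q_power_eq_1[of 2] by simp
  qed
  then have u: "u \<sim> map S xs @ m" using u by simp
  have actS: "foldr act (map S xs) c_par = c_par" "foldr act (map S xs) q_par = q_par"
    by (induction xs) (simp_all add: sS_bcq)
  have "foldr act u c_par = foldr act (map S xs) (foldr act m (cmon 0))"
    using act_cong[OF u] by (simp add: cmon_def)
  moreover have S_cmon: "foldr act (map S xs) (cmon z) = cmon z" for z
    using actS coord_hom_word[of "map S xs"] by (simp add: cmon_def hom_mult hom_powi hom_power)
  moreover have "foldr act (map S xs) (inverse (cmon z)) = inverse (cmon z)" for z
    using S_cmon coord_hom_word[of "map S xs"] by (simp add: hom_inverse)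
  ultimately have c: "c_par = (if even l then cmon (foldr cexp m 0) else inverse (cmon (foldr cexp m 0)))"
    using assms(2) word_cexp[OF mset, of 0] m(1) by (auto split: if_splits)
  have "even l"
  proof (rule ccontr)
    assume "odd l"
    then have "c_par = inverse (cmon (foldr cexp m 0))" using c by (simp only: if_False)
    moreover have "cmon (foldr cexp m 0) \<noteq> 0" by (simp add: cmon_def)
    ultimately have one: "c_par * cmon (foldr cexp m 0) = 1" by (metis left_inverse)
    \<comment> \<open>With \<open>c_par\<close> equal to 2 and \<open>q_par\<close> equal to 1,
      \<open>c_par * cmon z\<close> takes the value 4 for every z.\<close>
    let ?v = "coord_map (\<lambda>_. 1) 1 2 1 (\<lambda>_. 1) (\<lambda>_. 1)"
    note e = eval_coord_map[where D = "\<lambda>_. 1" and B = 1 and C = 2 and Q = 1 and A = "\<lambda>_. 1" and G = "\<lambda>_. 1"]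
    have "rat_eval ?v (c_par * cmon z) (2 * (2 * (1 ^ (2 * N + 1)) powi z))" for z
      unfolding cmon_def by (intro rat_eval_mult rat_eval_powi rat_eval_power e) simp
    from this[of "foldr cexp m 0"] have "rat_eval ?v 1 4" unfolding one by simp
    then have "(4::ratfun) = 1" using rat_eval_1 rat_eval_unique by blast
    moreover have "(of_nat 3 :: ratfun) = 4 - 1" by simp
    ultimately have "(of_nat 3 :: ratfun) = 0" by simp
    then show False unfolding ratfun_of_nat_eq_0_iff by simp
  qed
  then obtain l' where l': "l = 2 * l'" by (elim evenE)
  have "cmon (foldr cexp m 0) = c_par" using c \<open>even l\<close> by simp
  then have "q_par powi (int (2 * N + 1) * foldr cexp m 0) = 1"
    by (simp only: cmon_def power_int_mult power_int_of_nat) simp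
  then have "foldr cexp m 0 = 0" using q_powi_eq_1[of "int (2 * N + 1) * foldr cexp m 0"] by simp
  then have "l' = 0" using m(1) l' foldr_alt_cexp[of l' 0] by auto
  then have "m = []" using m(1) l' by auto
  then have u: "u \<sim> map S xs" using u by simp
  have "map S xs \<sim> []"
    by (rule s_word_faithful) (use assms(3) act_cong[OF u] in simp)
  then show ?thesis using u weq_trans by blast
qed

section \<open>The representation and the time evolution\<close>

definition cls :: "gen list \<Rightarrow> gen list set" where
  "cls u = word_rel (fund_rel N) `` {u}"

lemma cls_eq_iff: "cls u = cls v \<longleftrightarrow> u \<sim> v"
  using eq_equiv_class_iff[OF equiv_word_rel[of "fund_rel N"], of u v]
  by (simp add: cls_def word_rel_def)

lemma in_cls: "v \<in> cls u \<longleftrightarrow> u \<sim> v"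
  by (simp add: cls_def word_rel_def)

lemma carrier_cases:
  assumes "w \<in> carrier (ext_affine_weyl N)"
  obtains u where "w = cls u"
  using assms by (auto simp: ext_affine_weyl_def presented_def quotient_def cls_def)

lemma cls_carrier: "cls u \<in> carrier (ext_affine_weyl N)"
  by (auto simp: ext_affine_weyl_def presented_def quotient_def cls_def)

lemma cls_mult: "cls u \<otimes>\<^bsub>ext_affine_weyl N\<^esub> cls v = cls (u @ v)"
  by (simp add: ext_affine_weyl_def cls_def presented_mult)

lemma cls_one: "\<one>\<^bsub>ext_affine_weyl N\<^esub> = cls []"
  by (simp add: ext_affine_weyl_def presented_def cls_def)

definition rep :: "gen list set \<Rightarrow> ratfun \<Rightarrow> ratfun" where
  "rep w = restrict (foldr act (SOME u. u \<in> w)) (gen_field (coords N))"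

lemma rep_cls: "rep (cls u) = restrict (foldr act u) (gen_field (coords N))"
proof -
  have "(SOME v. v \<in> cls u) \<in> cls u"
    by (rule someI[of _ u]) (simp add: in_cls word_cong.refl)
  then have "foldr act u = foldr act (SOME v. v \<in> cls u)"
    by (intro act_cong) (simp add: in_cls)
  then show ?thesis by (simp add: rep_def)
qed

lemma weq_rev: "rev u @ u \<sim> []"
proof (induction u)
  case (Cons g u)
  have "rev (g # u) @ g # u \<sim> rev u @ u"
    using weq_rel[OF fund_rel_involution[of N g], of "rev u" u] by simp
  then show ?case using Cons weq_trans by blast
qed (simp add: word_cong.refl)

lemma act_rev: "foldr act (rev u) (foldr act u x) = x" "foldr act u (foldr act (rev u) x) = x"
  using fun_cong[OF act_cong[OF weq_rev[of u]], of x] fun_cong[OF act_cong[OF weq_rev[of "rev u"]], of x]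
  by simp_all

lemma word_stable: "x \<in> gen_field (coords N) \<Longrightarrow> foldr act u x \<in> gen_field (coords N)"
  using stable_word[of u] by (simp add: stable_def)

lemma rep_birational: "rep (cls u) \<in> birational (coords N)"
proof -
  let ?K = "gen_field (coords N)"
  have "bij_betw (foldr act u) ?K ?K"
    by (rule bij_betw_byWitness[where f' = "foldr act (rev u)"]) (auto simp: act_rev word_stable)
  then have "restrict (foldr act u) ?K \<in> Bij ?K"
    by (simp add: Bij_def)
  moreover have "field_hom (foldr act u)" using coord_hom_word by simp
  ultimately show ?thesis
    unfolding rep_cls birational_def
    by (auto simp: hom_simps gen_field.intros)
qed

lemma rep_mult:
  "rep (cls (u @ v)) = rep (cls u) \<otimes>\<^bsub>birational_group (coords N)\<^esub> rep (cls v)"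
proof -
  let ?K = "gen_field (coords N)"
  have B: "rep (cls w) \<in> Bij ?K" for w using rep_birational[of w] by (simp add: birational_def)
  have "rep (cls u) \<otimes>\<^bsub>birational_group (coords N)\<^esub> rep (cls v) = compose ?K (rep (cls u)) (rep (cls v))"
    using B by (simp add: birational_group_def BijGroup_def)
  also have "\<dots> = rep (cls (u @ v))"
    unfolding rep_cls compose_def by (auto simp: word_stable)
  finally show ?thesis by simp
qed

lemma rep_is_birational_representation: "birational_representation N rep"
  unfolding birational_representation_def
proof (intro conjI ballI)
  show "rep \<in> hom (ext_affine_weyl N) (birational_group (coords N))"
  proof (rule homI)
    show "rep w \<in> carrier (birational_group (coords N))" if "w \<in> carrier (ext_affine_weyl N)" for w
      using that rep_birational by (auto simp: birational_group_def elim!: carrier_cases)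
    show "rep (w \<otimes>\<^bsub>ext_affine_weyl N\<^esub> w') = rep w \<otimes>\<^bsub>birational_group (coords N)\<^esub> rep w'"
      if "w \<in> carrier (ext_affine_weyl N)" "w' \<in> carrier (ext_affine_weyl N)" for w w'
      using that by (auto simp: cls_mult rep_mult elim!: carrier_cases)
  qed
  show "inj_on rep (carrier (ext_affine_weyl N))"
  proof (rule inj_onI)
    fix w w' assume "w \<in> carrier (ext_affine_weyl N)" "w' \<in> carrier (ext_affine_weyl N)" and eq: "rep w = rep w'"
    then obtain u v where uv: "w = cls u" "w' = cls v" by (elim carrier_cases)
    have "foldr act u x = foldr act v x" if "x \<in> gen_field (coords N)" for x
      using fun_cong[OF eq, of x] that by (simp add: uv rep_cls)
    then have "foldr act (rev v @ u) x = x" if "x \<in> gen_field (coords N)" for x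
      using that by (simp add: act_rev)
    then have "rev v @ u \<sim> []"
      by (intro word_kernel) (auto intro: par_in)
    from weq_append[OF word_cong.refl[of _ v] this] have "v @ rev v @ u \<sim> v" by simp
    moreover have "v @ rev v @ u \<sim> u"
      using weq_append[OF weq_rev[of "rev v"] word_cong.refl[of _ u]] by simp
    ultimately have "u \<sim> v" using word_cong.sym weq_trans by blast
    then show "w = w'" by (simp add: uv cls_eq_iff)
  qed
  show "rep w ` gen_field (params N) \<subseteq> gen_field (params N)" if w: "w \<in> carrier (ext_affine_weyl N)" for w
  proof -
    obtain u where u: "w = cls u" using w by (rule carrier_cases)
    have sub: "x \<in> gen_field (coords N)" if "x \<in> gen_field (params N)" for x
      by (rule gen_field_hom[OF field_hom_id _ that]) (use params_subset_coords in \<open>auto intro: gen_field.var\<close>)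
    show ?thesis
      using stable_word[of u] sub by (auto simp: u rep_cls stable_def)
  qed
qed

section \<open>The time evolution\<close>

definition time_word :: "gen list" where
  "time_word = concat (replicate (2 * N + 1) [R, W0])"

lemma act_time_word: "foldr act time_word x = (ush ^^ (2 * N + 1)) x"
proof -
  have "foldr act (concat (replicate n [R, W0])) x = (ush ^^ n) x" for n
    by (induction n) (simp_all add: rv_ush rv_sh)
  from this[of "2 * N + 1"] show ?thesis unfolding time_word_def .
qed

lemma time_word_infinite:
  fixes k :: nat
  assumes "k > 0"
  shows "cls time_word [^]\<^bsub>ext_affine_weyl N\<^esub> k \<noteq> \<one>\<^bsub>ext_affine_weyl N\<^esub>"
proof
  have pow: "cls time_word [^]\<^bsub>ext_affine_weyl N\<^esub> k = cls (concat (replicate k time_word))" for k :: nat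
  proof (induction k)
    case 0
    then show ?case by (simp add: cls_one)
  next
    case (Suc k)
    have "concat (replicate k time_word) @ time_word = concat (replicate (Suc k) time_word)"
      by (induction k) simp_all
    then show ?case using Suc by (simp add: cls_mult)
  qed
  \<comment> \<open>In the action \<open>act_w\<close> on the integers, r w_0 is the translation by
    1, so no positive power of the time word acts trivially.\<close>
  have act1: "foldr act_w (concat (replicate n [R, W0])) x = x + int n" for n x
    by (induction n) simp_all
  have "foldr act_w (concat (replicate n time_word)) x = x + int n * (2 * int N + 1)" for n x
    by (induction n) (simp_all add: time_word_def act1 algebra_simps)
  moreover assume "cls time_word [^]\<^bsub>ext_affine_weyl N\<^esub> k = \<one>\<^bsub>ext_affine_weyl N\<^esub>"
  then have "concat (replicate k time_word) \<sim> []" by (simp add: pow cls_one cls_eq_iff)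
  from fold_word_cong[OF this act_w_rel]
  have "foldr act_w (concat (replicate k time_word)) 0 = 0" by simp
  ultimately have "int k * (2 * int N + 1) = 0" by simp
  then show False using assms by simp
qed

lemma ush_power:
  "(ush ^^ n) (aa k) = aa (k - int n)" "(ush ^^ n) b_par = b_par * q_par ^ ((2 * N - 1) * n)"
  "(ush ^^ n) c_par = (if even n then c_par else 1 / c_par)" "(ush ^^ n) (q_par ^ l) = q_par ^ l"
proof -
  show "(ush ^^ n) (aa k) = aa (k - int n)"
    by (induction n) (simp_all add: ush_simps algebra_simps)
  show "(ush ^^ n) (q_par ^ l) = q_par ^ l" for l
    by (induction n) (simp_all add: hom_power ush_simps)
  show "(ush ^^ n) b_par = b_par * q_par ^ ((2 * N - 1) * n)"
    by (induction n) (simp_all add: hom_mult hom_power ush_simps power_add mult.assoc)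
  show "(ush ^^ n) c_par = (if even n then c_par else 1 / c_par)"
    by (induction n) (simp_all add: hom_divide hom_1 ush_simps)
qed

lemma coord_hom_ush_power: "coord_hom (ush ^^ n)"
proof (induction n)
  case 0
  then show ?case using coord_hom_id by (simp add: id_def)
next
  case (Suc n)
  then show ?case using coord_hom_comp[OF coord_hom_ush Suc] by (simp add: comp_def)
qed

lemma ush_power_fx: "n \<le> i \<Longrightarrow> i \<le> 2 * N + 1 \<Longrightarrow> (ush ^^ n) (fx i) = fx (i - n)"
proof (induction n)
  case (Suc n)
  have "i - n \<in> {1..2 * N + 1}" using Suc.prems by auto
  from ush_fx[OF this] show ?case using Suc by simp
qed simp

text \<open>\<open>zz n\<close> is the reciprocal of the common value of both sides of the \<open>(2N+1-n)\<close>-th equation of the system.\<close>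

definition zz :: "nat \<Rightarrow> ratfun" where "zz n = (ush ^^ n) YY"

lemma zz_simps: "zz 0 = YY" "zz 1 = XX" "zz n \<noteq> 0"
  using hom_nonzero[OF coord_hom_field_hom[OF coord_hom_ush_power[of n]]]
  by (simp_all add: zz_def ush_YY)

text \<open>The two ends \<open>fx (2 * N + 1)\<close> and \<open>fx 0\<close> are expressed by
  \<open>XX\<close> and \<open>YY\<close>. The back shift by \<open>2 * N + 1 - i\<close> carries
  the former to \<open>ff i\<close> and the latter to the evolved value of
  \<open>ff i\<close>.\<close>

lemma ff_zz:
  assumes "i \<in> {1..2*N}"
  shows "ff i = - AA (int i) * (1 + zz (2 * N + 1 - i)) / zz (2 * N + 2 - i)"
    and "(ush ^^ (2 * N + 1)) (ff i) = - (1 + zz (2 * N + 2 - i)) / (AA (int i) * zz (2 * N + 1 - i))"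
proof -
  define n where "n = 2 * N + 1 - i"
  have n: "n \<le> 2 * N + 1" "i = 2 * N + 1 - n" "2 * N + 2 - i = n + 1" "2 * N + 1 = i + n"
    using assms by (auto simp: n_def)
  note h = hom_simps[OF coord_hom_field_hom[OF coord_hom_ush_power[of n]]]
  have X: "(ush ^^ n) XX = zz (n + 1)"
    by (simp add: zz_def ush_YY funpow_swap1)
  have A: "(ush ^^ n) (AA 0) = AA (int i)"
    using AA_add_period[of "- int n"] n
    by (simp add: AA_def ush_power hom_power[OF coord_hom_field_hom[OF coord_hom_ush_power[of n]]] of_nat_diff algebra_simps
        del: power_Suc)
  have "ff i = (ush ^^ n) (fx (2 * N + 1))"
    using ush_power_fx[of n "2 * N + 1"] n fx_simps(3)[OF assms] by simp
  also have "\<dots> = - AA (int i) * (1 + zz n) / zz (n + 1)"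
    unfolding fx_simps(2) by (simp only: h X A zz_def)
  finally show "ff i = - AA (int i) * (1 + zz (2 * N + 1 - i)) / zz (2 * N + 2 - i)"
    unfolding n(3) n_def .
  have "(ush ^^ (n + i)) (ff i) = (ush ^^ n) (fx 0)"
    using ush_power_fx[of i i] assms fx_simps(3)[OF assms] by (simp add: funpow_add)
  also have "\<dots> = - (1 + zz (n + 1)) / (AA (int i) * zz n)"
    unfolding fx_simps(1) by (simp only: h X A zz_def)
  finally show "(ush ^^ (2 * N + 1)) (ff i) = - (1 + zz (2 * N + 2 - i)) / (AA (int i) * zz (2 * N + 1 - i))"
    unfolding n(3) using n(4) by (simp add: n_def add.commute)
qed

text \<open>For the neighbouring values U and V of \<open>zz\<close>, the numerator and both
  denominators contain the factor 1 + U + V, which cancels; it is nonzero because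
  \<open>AA (int i) - ff i\<close> is.\<close>

lemma time_step:
  fixes f' :: "nat \<Rightarrow> ratfun"
  defines "f' \<equiv> \<lambda>i. (ush ^^ (2 * N + 1)) (ff i)"
  assumes i: "i \<in> {1..2*N}"
  shows "AA (int i) * (f' i * ff i - 1) / (AA (int i) - ff i) = 1 / zz (2 * N + 1 - i)"
    and "(f' i * ff i - 1) / (1 - AA (int i) * f' i) = 1 / zz (2 * N + 2 - i)"
    and "1 - AA (int i) * f' i \<noteq> 0"
proof -
  define A U V where "A = AA (int i)" and "U = zz (2 * N + 1 - i)" and "V = zz (2 * N + 2 - i)"
  have nz: "A \<noteq> 0" "U \<noteq> 0" "V \<noteq> 0" by (simp_all add: A_def U_def V_def zz_simps)
  have e: "ff i = - A * (1 + U) / V" "f' i = - (1 + V) / (A * U)"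
    using ff_zz[OF i] by (simp_all only: f'_def A_def U_def V_def)
  have p: "f' i * ff i - 1 = (1 + U + V) / (U * V)"
    unfolding e using nz by (simp add: field_simps)
  have l: "A - ff i = A * (1 + U + V) / V" and r: "1 - A * f' i = (1 + U + V) / U"
    unfolding e using nz by (simp_all add: field_simps)
  have s: "1 + U + V \<noteq> 0"
    using l ff_minus_AA[OF i] by (auto simp: A_def)
  show "A * (f' i * ff i - 1) / (A - ff i) = 1 / U"
    "(f' i * ff i - 1) / (1 - A * f' i) = 1 / V" "1 - A * f' i \<noteq> 0"
    unfolding p l r using nz s by simp_all
qed

lemma time_evolution_time_word: "time_evolution N (q_par ^ ((2 * N - 1) * (2 * N + 1))) (rep (cls time_word))"
proof -
  define \<sigma> where "\<sigma> = rep (cls time_word)"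
  define \<tau> where "\<tau> = ush ^^ (2 * N + 1)"
  define P where "P = q_par ^ ((2 * N - 1) * (2 * N + 1))"
  have \<sigma>: "\<sigma> x = \<tau> x" if "x \<in> gen_field (coords N)" for x
    using that by (simp add: \<sigma>_def \<tau>_def rep_cls act_time_word)
  have hom: "field_hom \<tau>" unfolding \<tau>_def by (rule coord_hom_field_hom[OF coord_hom_ush_power])
  have a: "\<sigma> (a_par i) = a_par i" if "i \<in> {1..2*N}" for i
  proof -
    have "\<tau> (aa (int i)) = aa (int i - (2 * int N + 1))"
      by (simp add: \<tau>_def ush_power add.commute del: funpow.simps)
    also have "\<dots> = aa (int i)"
      using aa_add_period[of "int i - (2 * int N + 1)"] by simp
    finally have "\<tau> (aa (int i)) = aa (int i)" .
    moreover have "aa (int i) \<in> gen_field (coords N)" by (rule par_in)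
    ultimately show ?thesis using \<sigma>[of "aa (int i)"] aa_a_par[OF that] by simp
  qed
  have b: "\<sigma> b_par = P * b_par"
    using \<sigma>[OF par_in(6)] by (simp add: \<tau>_def ush_power P_def del: funpow.simps)
  have c: "\<tau> c_par = inverse c_par"
    by (simp add: \<tau>_def ush_power inverse_eq_divide del: funpow.simps)
  then have c\<sigma>: "\<sigma> c_par = inverse c_par" using \<sigma>[OF par_in(7)] by simp
  have "P \<in> gen_field (coords N)" unfolding P_def by (intro gen_field_intros par_in)
  from \<sigma>[OF this] have p: "\<sigma> P = P"
    by (simp add: \<tau>_def ush_power P_def del: funpow.simps)
  have e: "c_par powi (2 * (-1) ^ i) = (if even i then c_par\<^sup>2 else 1 / c_par\<^sup>2)" for i :: nat
    by (simp add: power_int_minus inverse_eq_divide)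
  have F: "\<sigma> (F_var i) = (if even i then c_par\<^sup>2 * \<tau> (ff i) else \<tau> (ff i) / c_par\<^sup>2)"
    and F_ff: "F_var i = (if even i then ff i / c_par\<^sup>2 else ff i * c_par\<^sup>2)" if "i \<in> {1..2*N}" for i
  proof -
    show F: "F_var i = (if even i then ff i / c_par\<^sup>2 else ff i * c_par\<^sup>2)"
      by (simp add: ff_def)
    have "F_var i \<in> gen_field (coords N)"
      using that by (auto simp: coords_def intro: gen_field.var)
    then show "\<sigma> (F_var i) = (if even i then c_par\<^sup>2 * \<tau> (ff i) else \<tau> (ff i) / c_par\<^sup>2)"
      by (simp add: \<sigma>) (simp add: F hom_simps[OF hom] c power_inverse divide_inverse mult.commute)
  qed
  \<comment> \<open>The powers of \<open>c_par\<close> cancel because the evolution inverts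
    \<open>c_par\<close>.\<close>
  have FF: "\<sigma> (F_var i) * F_var i = \<tau> (ff i) * ff i" if "i \<in> {1..2*N}" for i
    using F[OF that] F_ff[OF that] by simp
  have cF: "c_par powi (2 * (-1) ^ i) * F_var i = ff i" for i :: nat
    unfolding e by (simp add: ff_def)
  have cF': "c_par powi (2 * (-1) ^ i) * \<sigma> (F_var (i + 1)) = \<tau> (ff (i + 1))" if "i + 1 \<in> {1..2*N}" for i
    unfolding e F[OF that] by simp
  have A: "a_par i ^ (2 * N + 1) = AA (int i)" if "i \<in> {1..2*N}" for i
    using that by (simp add: AA_def aa_a_par)
  have X: "KK * b_par * c_par / (\<Prod>k=1..N. F_var (2 * k - 1)) = 1 / XX"
  proof -
    have "(\<Prod>k=1..N. F_var (2 * k - 1)) = (\<Prod>k=1..N. c_par\<^sup>2 * ff (2 * k - 1))"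
      by (intro prod.cong) (auto simp: ff_def)
    also have "\<dots> = c_par ^ (2 * N) * (\<Prod>k=1..N. ff (2 * k - 1))"
      by (simp add: prod.distrib power_mult)
    also have "c_par ^ (2 * N) = c_par * c_par ^ (2 * N - 1)"
      using N_pos by (simp flip: power_Suc)
    finally show ?thesis by (simp add: XX_def)
  qed
  have "painleve_system N a_par b_par c_par F_var (\<lambda>i. \<sigma> (F_var i))"
    unfolding painleve_system_def
  proof (intro conjI ballI)
    show "a_par i ^ (2 * N + 1) - c_par powi (2 * (-1) ^ i) * F_var i \<noteq> 0" if "i \<in> {1..2*N}" for i
      unfolding A[OF that] cF using ff_minus_AA[OF that] by auto
    show "1 - a_par (i + 1) ^ (2 * N + 1) * c_par powi (2 * (-1) ^ i) * \<sigma> (F_var (i + 1)) \<noteq> 0"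
      if "i \<in> {1..2*N-1}" for i
    proof -
      have i: "i + 1 \<in> {1..2*N}" using that by auto
      show ?thesis
        unfolding A[OF i] mult.assoc cF'[OF i] using time_step(3)[OF i] unfolding \<tau>_def .
    qed
    show "(\<Prod>k=1..N. F_var (2 * k - 1)) \<noteq> 0" by simp
    fix i assume i: "i \<in> {1..2*N}"
    have l: "a_par i ^ (2 * N + 1) * (\<sigma> (F_var i) * F_var i - 1) /
        (a_par i ^ (2 * N + 1) - c_par powi (2 * (-1) ^ i) * F_var i) = 1 / zz (2 * N + 1 - i)"
      unfolding A[OF i] cF FF[OF i] using time_step(1)[OF i] unfolding \<tau>_def .
    show "a_par i ^ (2 * N + 1) * (\<sigma> (F_var i) * F_var i - 1) /
        (a_par i ^ (2 * N + 1) - c_par powi (2 * (-1) ^ i) * F_var i) =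
        (if i < 2 * N
         then (\<sigma> (F_var (i + 1)) * F_var (i + 1) - 1) /
           (1 - a_par (i + 1) ^ (2 * N + 1) * c_par powi (2 * (-1) ^ i) * \<sigma> (F_var (i + 1)))
         else (\<Prod>k=1..2 * N. a_par k ^ k) * b_par * c_par / (\<Prod>k=1..N. F_var (2 * k - 1)))"
    proof (cases "i < 2 * N")
      case True
      then have i: "i + 1 \<in> {1..2*N}" by auto
      \<comment> \<open>The second identity of \<open>time_step\<close>, taken at
        \<open>i + 1\<close>, produces \<open>zz (2 * N + 2 - (i + 1))\<close>, the same term as the
        first identity at \<open>i\<close>.\<close>
      have "(\<sigma> (F_var (i + 1)) * F_var (i + 1) - 1) /
          (1 - a_par (i + 1) ^ (2 * N + 1) * c_par powi (2 * (-1) ^ i) * \<sigma> (F_var (i + 1))) = 1 / zz (2 * N + 1 - i)"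
        unfolding A[OF i] mult.assoc cF'[OF i] FF[OF i] using time_step(2)[OF i] by (simp add: \<tau>_def del: funpow.simps)
      then show ?thesis unfolding l using True by simp
    next
      case False
      \<comment> \<open>In the last equation the left-hand side is \<open>1 / zz 1\<close>, and
        \<open>zz 1 = XX\<close> was built from the right-hand side.\<close>
      then have "2 * N + 1 - i = 1" using i by auto
      then show ?thesis unfolding l using False X zz_simps(2) by (simp add: KK_def)
    qed
  qed
  then show ?thesis
    unfolding time_evolution_def using a b c\<sigma> p by (simp add: \<sigma>_def P_def)
qed

end

theorem theorem1p4:
  fixes N :: nat
  assumes "N > 0"
  shows "\<exists>m>0. \<exists>\<rho> T.
           birational_representation N \<rho> \<and>
           T \<in> carrier (ext_affine_weyl N) \<and>
           (\<forall>k>0. T [^]\<^bsub>ext_affine_weyl N\<^esub> (k::nat) \<noteq> \<one>\<^bsub>ext_affine_weyl N\<^esub>) \<and>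
           time_evolution N (q_par ^ m) (\<rho> T)"
proof -
  interpret weyl_rep N by unfold_locales (rule assms)
  have "(2 * N - 1) * (2 * N + 1) > 0" using assms by simp
  then show ?thesis
    using rep_is_birational_representation cls_carrier[of time_word] time_word_infinite time_evolution_time_word
    by blast
qed

end
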